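(* Let $(\xi,\mathbf g)\in\mathbb R^K\times L_2([0,A])^{K^2}$ and set $(\xi',\mathbf g')=\Gamma(\xi,\mathbf g)$. Then for all $(l,k)\in[K]^2$, $$\xi'_k=\xi_k\,\mathbb E_0\Big[\frac1{\lambda^k_A(f^0_k)}\Big]+\mathbb E_0\Big[\frac{\tilde\lambda^k_A(0,\mathbf g_k)}{\lambda^k_A(f^0_k)}\Big],\qquad g'_{l,k}=\mu^0_l\,\xi_k\,p_{l,k}+\mu^0_l\,g_{l,k}\,p_{l,k}+\mu^0_l\sum_{j=1}^K\zeta_{l,j,k}(g_{j,k}).$$
   Context: Fix $K\ge1$, $[K]=\{1,\dots,K\}$, $A>0$. Under $\mathbb P_0$ (expectation $\mathbb E_0$), $N=(N^1,\dots,N^K)$ is the stationary linear multivariate Hawkes process on $\mathbb R$ with parameter $f^0=(\nu^0,\mathbf h^0)$: $\nu^0\in(0,\infty)^K$, $\mathbf h^0=(h^0_{l,k})$ non-negative bounded functions supported in $[0,A]$, the matrix $(\int_0^Ah^0_{l,k})_{l,k}$ has spectral radius $<1$; intensities $\lambda^k_t(f^0_k)=\nu^0_k+\sum_l\int_{[t-A,t)}h^0_{l,k}(t-u)dN^l_u$. $\mu^0_l=\mathbb E_0[N^l([0,1])]$ is the mean intensity. For $\xi\in\mathbb R^K$ and a matrix $\mathbf g=(g_{l,k})$ of functions on $[0,A]$ with columns $\mathbf g_k=(g_{1,k},\dots,g_{K,k})$, $\tilde\lambda^k_t(\xi_k,\mathbf g_k)=\xi_k+\sum_l\int_{[t-A,t)}g_{l,k}(t-u)dN^l_u$.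 The score operator is $\mathcal S(\xi,\mathbf g)=\big(\int_0^1\tilde\lambda^k_t(\xi_k,\mathbf g_k)(\frac{dN^k_t}{\lambda^k_t(f^0_k)}-dt)\big)_{k\in[K]}$ and $\Gamma=\mathcal S^*\mathcal S$ is the information operator on $\mathbb R^K\times L_2([0,A])^{K^2}$ (adjoint for the usual $L_2$ inner product $\langle\cdot,\cdot\rangle_2$), i.e. for all $(\bar\xi,\bar{\mathbf g})$, $$\langle(\bar\xi,\bar{\mathbf g}),\Gamma(\xi,\mathbf g)\rangle_2=\sum_{k=1}^K\mathbb E_0\Big[\frac{\tilde\lambda^k_A(\bar\xi_k,\bar{\mathbf g}_k)\tilde\lambda^k_A(\xi_k,\mathbf g_k)}{\lambda^k_A(f^0_k)}\Big].$$ $\mathbb E_0^{(u,l)}$ is expectation under the Palm distribution $\mathbb P_0^{(u,l)}$ of $N$ at a point $u$ of mark $l$: for measurable $\Phi\ge0$, $\mathbb E_0[\sum_l\int\Phi(u,l,N)dN^l_u]=\sum_l\mu^0_l\int\mathbb E_0^{(u,l)}[\Phi(u,l,N)]du$. For $u\in[0,A]$, $$p_{l,k}(A-u)=\mathbb E_0^{(u,l)}\Big[\frac1{\lambda^k_A(f^0_k)}\Big],\qquad \zeta_{l,j,k}(g)(A-u)=\mathbb E_0^{(u,l)}\Big[\int_0^A\mathbf 1_{(s,j)\ne(u,l)}\,g(A-s)\frac{dN^j_s}{\lambda^k_A(f^0_k)}\Big].$$ *)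

theory Defs
  imports
    "HOL-Probability.Probability"
    "Jordan_Normal_Form.Spectral_Radius"
begin

section \<open>Configurations of a K-variate point process\<close>

text \<open>
  Marks are numbered \<open>0, \<dots>, K - 1\<close>. A configuration \<open>N\<close> assigns to each mark \<open>l\<close> the set \<open>N l\<close> of
  its points; as usual for multivariate point processes, points are simple, locally finite,
  and no two marks share a point. The measure \<open>dN\<^sup>l\<close> is counting measure on \<open>N l\<close>, so
  that integrals against it over bounded sets are finite sums over points.
\<close>

type_synonym config = "nat \<Rightarrow> real set"

definition configs :: "nat \<Rightarrow> config set" where
  "configs K = {N. (\<forall>l<K. \<forall>a b. finite (N l \<inter> {a..b})) \<and>
                   (\<forall>l<K. \<forall>j<K. l \<noteq> j \<longrightarrow> N l \<inter> N j = {})}"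

text \<open>The sigma-algebra generated by the restriction of the process to \<open>I\<close>.\<close>

definition history :: "nat \<Rightarrow> real set \<Rightarrow> config measure" where
  "history K I = sigma (configs K)
     {{N \<in> configs K. card (N l \<inter> {a<..b}) = n} | l a b n. l < K \<and> {a<..b} \<subseteq> I}"

abbreviation config_space :: "nat \<Rightarrow> config measure" where
  "config_space K \<equiv> history K UNIV"

definition shift :: "real \<Rightarrow> config \<Rightarrow> config" where
  "shift t N = (\<lambda>l. (+) t ` N l)"

definition predictable :: "nat \<Rightarrow> (real \<times> config) measure" where
  "predictable K = sigma (UNIV \<times> configs K)
     {{s<..t} \<times> B | s t B. B \<in> sets (history K {..s})}"

text \<open>
  \<open>lam\<close> is a stochastic intensity of the points of mark \<open>k\<close> with respect to the internal history
  of the whole multivariate process.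
\<close>

definition has_intensity ::
    "nat \<Rightarrow> config measure \<Rightarrow> nat \<Rightarrow> (real \<Rightarrow> config \<Rightarrow> real) \<Rightarrow> bool" where
  "has_intensity K P k lam \<longleftrightarrow>
     (\<forall>C :: real \<times> config \<Rightarrow> ennreal. C \<in> borel_measurable (predictable K) \<longrightarrow>
        (\<integral>\<^sup>+N. (\<integral>\<^sup>+t. C (t, N) \<partial>count_space (N k)) \<partial>P) =
        (\<integral>\<^sup>+N. (\<integral>\<^sup>+t. C (t, N) * ennreal (lam t N) \<partial>lborel) \<partial>P))"

section \<open>The stationary linear Hawkes process\<close>

text \<open>
  \<open>lin_intensity K A c f t N\<close> is \<open>c + (\<Sum>l. \<integral>\<^bsub>[t - A, t)\<^esub> f\<^sub>l (t - u) dN\<^sup>l\<^sub>u)\<close>. With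
  \<open>c = \<nu>\<^sub>k\<close> and the column \<open>f = h\<^sub>k\<close> it is the intensity of mark \<open>k\<close>; with \<open>(\<xi>\<^sub>k, g\<^sub>k)\<close> it is the
  signed linear functional written with a tilde over \<open>\<lambda>\<close>.
\<close>

definition lin_intensity ::
    "nat \<Rightarrow> real \<Rightarrow> real \<Rightarrow> (nat \<Rightarrow> real \<Rightarrow> real) \<Rightarrow> real \<Rightarrow> config \<Rightarrow> real" where
  "lin_intensity K A c f t N = c + (\<Sum>l<K. \<Sum>u \<in> N l \<inter> {t - A..<t}. f l (t - u))"

definition intensity ::
    "nat \<Rightarrow> real \<Rightarrow> (nat \<Rightarrow> real) \<Rightarrow> (nat \<Rightarrow> nat \<Rightarrow> real \<Rightarrow> real) \<Rightarrow> nat \<Rightarrow> real \<Rightarrow> config \<Rightarrow> real" where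
  "intensity K A \<nu> h k = lin_intensity K A (\<nu> k) (\<lambda>l. h l k)"

definition hawkes_parameter ::
    "nat \<Rightarrow> real \<Rightarrow> (nat \<Rightarrow> real) \<Rightarrow> (nat \<Rightarrow> nat \<Rightarrow> real \<Rightarrow> real) \<Rightarrow> bool" where
  "hawkes_parameter K A \<nu> h \<longleftrightarrow>
     (\<forall>k<K. 0 < \<nu> k) \<and>
     (\<forall>l<K. \<forall>k<K. h l k \<in> borel_measurable borel \<and> (\<forall>x. 0 \<le> h l k x) \<and>
        (\<exists>B. \<forall>x. h l k x \<le> B) \<and> (\<forall>x. x \<notin> {0..A} \<longrightarrow> h l k x = 0)) \<and>
     spectral_radius (mat K K (\<lambda>(l, k). complex_of_real (LINT x:{0..A}|lborel. h l k x))) < 1"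

text \<open>
  \<open>P\<close> is the law of the process. Finiteness of the mean number of points per unit time belongs to
  the definition: the stationary Hawkes process is the unique stationary process
  with these intensities and finite mean intensity.
\<close>

definition stationary_hawkes ::
    "nat \<Rightarrow> real \<Rightarrow> (nat \<Rightarrow> real) \<Rightarrow> (nat \<Rightarrow> nat \<Rightarrow> real \<Rightarrow> real) \<Rightarrow> config measure \<Rightarrow> bool" where
  "stationary_hawkes K A \<nu> h P \<longleftrightarrow>
     prob_space P \<and> sets P = sets (config_space K) \<and>
     (\<forall>t. distr P (config_space K) (shift t) = P) \<and>
     (\<forall>k<K. (\<integral>\<^sup>+N. of_nat (card (N k \<inter> {0..1})) \<partial>P) < \<infinity>) \<and>
     (\<forall>k<K. has_intensity K P k (intensity K A \<nu> h k))"

definition mean_intensity :: "config measure \<Rightarrow> nat \<Rightarrow> real" where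
  "mean_intensity P l = (\<integral>N. real (card (N l \<inter> {0..1})) \<partial>P)"

section \<open>Score and information operators\<close>

type_synonym param = "(nat \<Rightarrow> real) \<times> (nat \<Rightarrow> nat \<Rightarrow> real \<Rightarrow> real)"

text \<open>
  Elements of \<open>L\<^sub>2([0,A])\<close> are represented by functions, whose values outside \<open>[0,A]\<close>
  are irrelevant, and equality in \<open>L\<^sub>2([0,A])\<close> is equality almost everywhere on \<open>[0,A]\<close>. Likewise
  only coordinates below \<open>K\<close> matter.
\<close>

definition L2_on :: "real \<Rightarrow> (real \<Rightarrow> real) set" where
  "L2_on A = {f. set_borel_measurable borel {0..A} f \<and> set_integrable lborel {0..A} (\<lambda>x. (f x)\<^sup>2)}"

definition param_space :: "nat \<Rightarrow> real \<Rightarrow> param set" where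
  "param_space K A = {(\<xi>, g). \<forall>l<K. \<forall>k<K. g l k \<in> L2_on A}"

definition param_inner :: "nat \<Rightarrow> real \<Rightarrow> param \<Rightarrow> param \<Rightarrow> real" where
  "param_inner K A x y =
     (\<Sum>k<K. fst x k * fst y k) +
     (\<Sum>l<K. \<Sum>k<K. LINT s:{0..A}|lborel. snd x l k s * snd y l k s)"

text \<open>The integral over \<open>[0,1]\<close> against \<open>dN\<^sup>k / \<lambda>\<^sup>k - dt\<close>, split into its two parts.\<close>

definition score ::
    "nat \<Rightarrow> real \<Rightarrow> (nat \<Rightarrow> real) \<Rightarrow> (nat \<Rightarrow> nat \<Rightarrow> real \<Rightarrow> real) \<Rightarrow> param \<Rightarrow> nat \<Rightarrow> config \<Rightarrow> real" where
  "score K A \<nu> h x k N =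
     (\<Sum>t \<in> N k \<inter> {0..1}. lin_intensity K A (fst x k) (\<lambda>l. snd x l k) t N / intensity K A \<nu> h k t N)
     - (LINT t:{0..1}|lborel. lin_intensity K A (fst x k) (\<lambda>l. snd x l k) t N)"

text \<open>
  The adjoint of the score operator, from \<open>L\<^sub>2(P)\<^sup>K\<close> back to the parameter space. Its value is
  determined up to equality in \<open>L\<^sub>2\<close>; a representative is chosen.
\<close>

definition score_adjoint ::
    "nat \<Rightarrow> real \<Rightarrow> (nat \<Rightarrow> real) \<Rightarrow> (nat \<Rightarrow> nat \<Rightarrow> real \<Rightarrow> real) \<Rightarrow> config measure \<Rightarrow>
     (nat \<Rightarrow> config \<Rightarrow> real) \<Rightarrow> param" where
  "score_adjoint K A \<nu> h P Y =
     (SOME z. z \<in> param_space K A \<and>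
        (\<forall>x \<in> param_space K A.
           param_inner K A x z = (\<Sum>k<K. \<integral>N. score K A \<nu> h x k N * Y k N \<partial>P)))"

definition information_operator ::
    "nat \<Rightarrow> real \<Rightarrow> (nat \<Rightarrow> real) \<Rightarrow> (nat \<Rightarrow> nat \<Rightarrow> real \<Rightarrow> real) \<Rightarrow> config measure \<Rightarrow> param \<Rightarrow> param" where
  "information_operator K A \<nu> h P x = score_adjoint K A \<nu> h P (score K A \<nu> h x)"

section \<open>Palm distributions\<close>

text \<open>
  \<open>Q u l\<close> is the Palm distribution at a point \<open>u\<close> of mark \<open>l\<close>. Campbell's formula determines the
  family only for almost every \<open>u\<close>; any version is allowed.
\<close>

definition palm_family :: "nat \<Rightarrow> config measure \<Rightarrow> (real \<Rightarrow> nat \<Rightarrow> config measure) \<Rightarrow> bool" where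
  "palm_family K P Q \<longleftrightarrow>
     (\<forall>l<K. (\<lambda>u. Q u l) \<in> borel \<rightarrow>\<^sub>M prob_algebra (config_space K)) \<and>
     (\<forall>\<Phi> :: real \<Rightarrow> nat \<Rightarrow> config \<Rightarrow> ennreal.
        (\<forall>l<K. (\<lambda>(u, N). \<Phi> u l N) \<in> borel_measurable (borel \<Otimes>\<^sub>M config_space K)) \<longrightarrow>
        (\<integral>\<^sup>+N. (\<Sum>l<K. \<integral>\<^sup>+u. \<Phi> u l N \<partial>count_space (N l)) \<partial>P) =
        (\<Sum>l<K. ennreal (mean_intensity P l) * (\<integral>\<^sup>+u. (\<integral>\<^sup>+N. \<Phi> u l N \<partial>Q u l) \<partial>lborel)))"

text \<open>Both functions below take the argument \<open>x = A - u\<close>, that is, they use the point \<open>u = A - x\<close>.\<close>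

definition palm_p ::
    "nat \<Rightarrow> real \<Rightarrow> (nat \<Rightarrow> real) \<Rightarrow> (nat \<Rightarrow> nat \<Rightarrow> real \<Rightarrow> real) \<Rightarrow>
     (real \<Rightarrow> nat \<Rightarrow> config measure) \<Rightarrow> nat \<Rightarrow> nat \<Rightarrow> real \<Rightarrow> real" where
  "palm_p K A \<nu> h Q l k x = (\<integral>N. 1 / intensity K A \<nu> h k A N \<partial>Q (A - x) l)"

definition palm_zeta ::
    "nat \<Rightarrow> real \<Rightarrow> (nat \<Rightarrow> real) \<Rightarrow> (nat \<Rightarrow> nat \<Rightarrow> real \<Rightarrow> real) \<Rightarrow>
     (real \<Rightarrow> nat \<Rightarrow> config measure) \<Rightarrow> nat \<Rightarrow> nat \<Rightarrow> nat \<Rightarrow> (real \<Rightarrow> real) \<Rightarrow> real \<Rightarrow> real" where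
  "palm_zeta K A \<nu> h Q l j k g x =
     (\<integral>N. (\<Sum>s \<in> {s \<in> N j \<inter> {0..A}. (s, j) \<noteq> (A - x, l)}. g (A - s) / intensity K A \<nu> h k A N)
        \<partial>Q (A - x) l)"

end

theory Submission
  imports Defs
begin

text \<open>
  By definition \<open>\<Gamma>(\<xi>, g)\<close> is the element \<open>z\<close> of the parameter space such that the inner product of \<open>z\<close> with
  every parameter \<open>x\<close> is \<open>\<Sum>\<^sub>k E[S\<^sub>k(x) S\<^sub>k(\<xi>, g)]\<close>. So there are two things to do: compute this bilinear
  form, and find the \<open>z\<close> that represents it.

  The computation is a martingale isometry. The \<open>k\<close>-th score is the integral over \<open>[0,1]\<close> of the predictable
  process \<open>X / \<lambda>\<close> against the compensated process \<open>dN - \<lambda> dt\<close>, with \<open>X\<close> the linear functional that belongs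
  to \<open>x\<close>; hence \<open>E[S\<^sub>k(x) S\<^sub>k(y)]\<close> is the expectation of \<open>\<integral> X Y / \<lambda> dt\<close>, and by stationarity it equals
  \<open>E[X Y / \<lambda>]\<close> at time \<open>A\<close> (\<open>expectation_score_product\<close>). The isometry comes from pathwise integration by
  parts: for non-negative integrands it is an identity between extended non-negative numbers
  (\<open>isometry_nonneg\<close>), which may be rearranged once the terms are known to be finite.

  Finiteness is the analytic core. The bound \<open>E[(\<integral> \<phi> dN)\<^sup>2] \<le> C \<integral> \<phi>\<^sup>2\<close> (\<open>window_sum_L2\<close>) needs a second moment of
  the intensity, while the definition of the process only provides a first moment. But the isometry,
  localised, already bounds the compensated integrals by first moments (\<open>compensated_square_le\<close>). Hence
  \<open>\<lambda> \<le> W + T \<lambda>\<close>, where \<open>W\<close> is bounded in mean square and \<open>T\<close> smooths with the kernels \<open>h\<close>. The mean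
  intensities satisfy \<open>\<mu>\<^sub>k = \<nu>\<^sub>k + \<Sum>\<^sub>l (\<integral> h\<^sub>l\<^sub>k) \<mu>\<^sub>l\<close> with \<open>\<nu>\<^sub>k > 0\<close>, so in norms weighted by \<open>\<mu>\<close> the operator
  \<open>T\<close> is a strict contraction, in mean and in mean square. Iterating the inequality bounds \<open>\<lambda>\<close> in mean
  square (\<open>lam_second_moment\<close>).

  To find \<open>z\<close>, put \<open>F = Y / \<lambda>\<close> at time \<open>A\<close>. Since \<open>X\<close> is a constant plus sums of \<open>f(A - u)\<close> over the points
  \<open>u\<close>, Campbell's formula turns \<open>E[X F]\<close> into an inner product with the functions
  \<open>x \<mapsto> \<mu>\<^sub>l E\<^sup>(\<^sup>A\<^sup>-\<^sup>x\<^sup>,\<^sup>l\<^sup>)[F]\<close> (\<open>palm_duality\<close>), which are square integrable because \<open>f \<mapsto> E[X F]\<close> is bounded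
  (\<open>palm_L2_bound\<close>). So \<open>z\<close> exists, and it is unique up to null sets (\<open>param_inner_determines\<close>). Finally, under
  the Palm distribution at \<open>u\<close> there is almost surely a point of mark \<open>l\<close> at \<open>u\<close>; separating its
  contribution \<open>g\<^sub>l\<^sub>k(A - u)\<close> to \<open>Y\<close> from those of all other points gives the three terms of the formula
  (\<open>palm_score_formula\<close>).
\<close>

section \<open>Square integrals of extended non-negative functions\<close>

lemma power2_le_imp_le_ennreal:
  fixes a b :: ennreal
  assumes "a\<^sup>2 \<le> b\<^sup>2"
  shows "a \<le> b"
proof (rule ccontr)
  assume "\<not> a \<le> b"
  then have "b < a" by simp
  then have "b * b < a * a"
    by (cases a; cases b) (auto simp: ennreal_mult[symmetric] ennreal_less_iff ennreal_top_mult top_unique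
        intro!: mult_strict_mono split: if_splits)
  with assms show False by (simp add: power2_eq_square)
qed

lemma nn_integral_square_le_emeasure:
  assumes [measurable]: "f \<in> borel_measurable M"
  shows "(\<integral>\<^sup>+x. f x \<partial>M)\<^sup>2 \<le> emeasure M (space M) * (\<integral>\<^sup>+x. (f x)\<^sup>2 \<partial>M)"
  using Cauchy_Schwarz_nn_integral[of f M "\<lambda>_. 1"] by (simp add: mult.commute)

lemma nn_integral_mult_le_L2:
  fixes f g :: "'a \<Rightarrow> ennreal"
  assumes [measurable]: "f \<in> borel_measurable M" "g \<in> borel_measurable M"
    and f: "(\<integral>\<^sup>+x. (f x)\<^sup>2 \<partial>M) \<le> a\<^sup>2" and g: "(\<integral>\<^sup>+x. (g x)\<^sup>2 \<partial>M) \<le> b\<^sup>2"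
  shows "(\<integral>\<^sup>+x. f x * g x \<partial>M) \<le> a * b"
proof (rule power2_le_imp_le_ennreal)
  have "(\<integral>\<^sup>+x. f x * g x \<partial>M)\<^sup>2 \<le> (\<integral>\<^sup>+x. (f x)\<^sup>2 \<partial>M) * (\<integral>\<^sup>+x. (g x)\<^sup>2 \<partial>M)"
    by (rule Cauchy_Schwarz_nn_integral) auto
  also have "\<dots> \<le> a\<^sup>2 * b\<^sup>2" by (intro mult_mono f g) auto
  finally show "(\<integral>\<^sup>+x. f x * g x \<partial>M)\<^sup>2 \<le> (a * b)\<^sup>2" by (simp add: power_mult_distrib)
qed

lemma L2_bound_add:
  fixes f g :: "'a \<Rightarrow> ennreal"
  assumes [measurable]: "f \<in> borel_measurable M" "g \<in> borel_measurable M"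
    and f: "(\<integral>\<^sup>+x. (f x)\<^sup>2 \<partial>M) \<le> a\<^sup>2" and g: "(\<integral>\<^sup>+x. (g x)\<^sup>2 \<partial>M) \<le> b\<^sup>2"
  shows "(\<integral>\<^sup>+x. (f x + g x)\<^sup>2 \<partial>M) \<le> (a + b)\<^sup>2"
proof -
  have "(\<integral>\<^sup>+x. (f x + g x)\<^sup>2 \<partial>M) = (\<integral>\<^sup>+x. (f x)\<^sup>2 + 2 * (f x * g x) + (g x)\<^sup>2 \<partial>M)"
    by (intro nn_integral_cong) (simp add: power2_eq_square algebra_simps mult_2_right)
  also have "\<dots> = (\<integral>\<^sup>+x. (f x)\<^sup>2 \<partial>M) + 2 * (\<integral>\<^sup>+x. f x * g x \<partial>M) + (\<integral>\<^sup>+x. (g x)\<^sup>2 \<partial>M)"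
    by (simp add: nn_integral_add nn_integral_cmult)
  also have "\<dots> \<le> a\<^sup>2 + 2 * (a * b) + b\<^sup>2"
    by (intro add_mono mult_mono f g nn_integral_mult_le_L2) auto
  also have "\<dots> = (a + b)\<^sup>2"
    by (simp add: power2_eq_square algebra_simps mult_2_right)
  finally show ?thesis .
qed

lemma L2_bound_sum:
  fixes f :: "'i \<Rightarrow> 'a \<Rightarrow> ennreal"
  assumes "finite I" and [measurable]: "\<And>i. i \<in> I \<Longrightarrow> f i \<in> borel_measurable M"
    and "\<And>i. i \<in> I \<Longrightarrow> (\<integral>\<^sup>+x. (f i x)\<^sup>2 \<partial>M) \<le> (a i)\<^sup>2"
  shows "(\<integral>\<^sup>+x. (\<Sum>i\<in>I. f i x)\<^sup>2 \<partial>M) \<le> (\<Sum>i\<in>I. a i)\<^sup>2"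
  using assms
proof (induction I rule: finite_induct)
  case (insert i I)
  have "(\<integral>\<^sup>+x. (f i x + (\<Sum>i\<in>I. f i x))\<^sup>2 \<partial>M) \<le> (a i + (\<Sum>i\<in>I. a i))\<^sup>2"
    using insert by (intro L2_bound_add) (auto intro!: borel_measurable_sum)
  with insert.hyps show ?case by simp
qed simp

lemma nn_integral_weighted_square_le:
  fixes w f :: "'a \<Rightarrow> ennreal"
  assumes [measurable]: "w \<in> borel_measurable M" "f \<in> borel_measurable M"
  shows "(\<integral>\<^sup>+x. w x * f x \<partial>M)\<^sup>2 \<le> (\<integral>\<^sup>+x. w x \<partial>M) * (\<integral>\<^sup>+x. w x * (f x)\<^sup>2 \<partial>M)"
  using nn_integral_square_le_emeasure[of f "density M w"]
  by (simp add: nn_integral_density emeasure_density cong: nn_integral_cong_simp)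

text \<open>
  Minkowski's inequality for integrals: the norm of an average is at most the average of the norms. It
  follows from the Cauchy--Schwarz inequality for the measure with density \<open>w\<close>.
\<close>

lemma L2_bound_average:
  fixes w :: "'b \<Rightarrow> ennreal" and f :: "'b \<Rightarrow> 'a \<Rightarrow> ennreal"
  assumes "sigma_finite_measure L" "sigma_finite_measure M"
    and [measurable]: "w \<in> borel_measurable L" "(\<lambda>(s, x). f s x) \<in> borel_measurable (L \<Otimes>\<^sub>M M)"
    and f: "\<And>s. (\<integral>\<^sup>+x. (f s x)\<^sup>2 \<partial>M) \<le> b\<^sup>2"
  shows "(\<integral>\<^sup>+x. (\<integral>\<^sup>+s. w s * f s x \<partial>L)\<^sup>2 \<partial>M) \<le> ((\<integral>\<^sup>+s. w s \<partial>L) * b)\<^sup>2"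
proof -
  interpret pair_sigma_finite L M using assms(1,2) by (simp add: pair_sigma_finite_def)
  have "(\<integral>\<^sup>+x. (\<integral>\<^sup>+s. w s * f s x \<partial>L)\<^sup>2 \<partial>M) \<le>
      (\<integral>\<^sup>+x. (\<integral>\<^sup>+s. w s \<partial>L) * (\<integral>\<^sup>+s. w s * (f s x)\<^sup>2 \<partial>L) \<partial>M)"
    by (intro nn_integral_mono nn_integral_weighted_square_le) auto
  also have "\<dots> = (\<integral>\<^sup>+s. w s \<partial>L) * (\<integral>\<^sup>+x. (\<integral>\<^sup>+s. w s * (f s x)\<^sup>2 \<partial>L) \<partial>M)"
    by (intro nn_integral_cmult) auto
  also have "(\<integral>\<^sup>+x. (\<integral>\<^sup>+s. w s * (f s x)\<^sup>2 \<partial>L) \<partial>M) = (\<integral>\<^sup>+s. (\<integral>\<^sup>+x. w s * (f s x)\<^sup>2 \<partial>M) \<partial>L)"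
    by (intro Fubini') auto
  also have "\<dots> = (\<integral>\<^sup>+s. w s * (\<integral>\<^sup>+x. (f s x)\<^sup>2 \<partial>M) \<partial>L)"
    by (intro nn_integral_cong nn_integral_cmult) auto
  also have "\<dots> \<le> (\<integral>\<^sup>+s. w s * b\<^sup>2 \<partial>L)"
    by (intro nn_integral_mono mult_left_mono f) auto
  also have "\<dots> = (\<integral>\<^sup>+s. w s \<partial>L) * b\<^sup>2"
    by (intro nn_integral_multc) auto
  also have "(\<integral>\<^sup>+s. w s \<partial>L) * ((\<integral>\<^sup>+s. w s \<partial>L) * b\<^sup>2) = ((\<integral>\<^sup>+s. w s \<partial>L) * b)\<^sup>2"
    by (simp add: power2_eq_square mult_ac)
  finally show ?thesis by (auto simp: mult_left_mono)
qed

section \<open>Integrals over the points of a random configuration\<close>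

text \<open>
  After normalisation, counting measure on the points in a bounded interval is a sub-probability kernel;
  its measurability has to be checked only on intervals, where it is the hypothesis \<open>cnt\<close>. Only counts of
  the form \<open>card (S \<omega> \<inter> {a<..b})\<close> enter, so \<open>S\<close> may also be the part of a configuration that lies before a
  random time.
\<close>

lemma nn_integral_points_measurable:
  fixes S :: "'a \<Rightarrow> real set" and f :: "real \<times> 'a \<Rightarrow> ennreal"
  assumes fin: "\<And>\<omega> a b. \<omega> \<in> space M \<Longrightarrow> finite (S \<omega> \<inter> {a..b})"
    and cnt: "\<And>a b. (\<lambda>\<omega>. card (S \<omega> \<inter> {a<..b})) \<in> measurable M (count_space UNIV)"
    and f: "f \<in> borel_measurable (borel \<Otimes>\<^sub>M M)"
  shows "(\<lambda>\<omega>. \<integral>\<^sup>+s. f (s, \<omega>) \<partial>count_space (S \<omega>)) \<in> borel_measurable M"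
proof -
  define U where "U m \<omega> = S \<omega> \<inter> {- real m<..real m}" for m \<omega>
  define c where "c m \<omega> = ennreal (1 / (1 + real (card (U m \<omega>))))" for m \<omega>
  define \<kappa> where "\<kappa> m \<omega> = scale_measure (c m \<omega>) (distr (count_space (U m \<omega>)) borel (\<lambda>x. x))" for m \<omega>
  have finU: "finite (U m \<omega>)" if "\<omega> \<in> space M" for m \<omega>
    using fin[OF that, of "- real m" "real m"] by (rule rev_finite_subset) (auto simp: U_def)
  have cU[measurable]: "(\<lambda>\<omega>. card (U m \<omega>)) \<in> measurable M (count_space UNIV)" for m
    unfolding U_def by (rule cnt)
  have [measurable]: "c m \<in> borel_measurable M" for m
    unfolding c_def by measurable
  have em: "emeasure (\<kappa> m \<omega>) A = c m \<omega> * of_nat (card (U m \<omega> \<inter> A))"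
    if "\<omega> \<in> space M" "A \<in> sets borel" for m \<omega> A
  proof -
    have "emeasure (count_space (U m \<omega>)) (A \<inter> U m \<omega>) = of_nat (card (A \<inter> U m \<omega>))"
      using finU[OF that(1)] by (intro emeasure_count_space_finite) auto
    with that show ?thesis
      by (simp add: \<kappa>_def emeasure_distr Int_commute)
  qed
  have \<kappa>: "\<kappa> m \<in> measurable M (subprob_algebra borel)" for m
  proof (rule measurable_subprob_algebra_generated[where \<Omega>=UNIV and G="range (\<lambda>(a, b). {a<..b::real})"])
    show "sets (borel :: real measure) = sigma_sets UNIV (range (\<lambda>(a, b). {a<..b}))"
      by (subst borel_sigma_sets_Ioc) simp
    show "Int_stable (range (\<lambda>(a, b). {a<..b::real}))"
      by (auto simp: Int_stable_def image_iff greaterThanAtMost_def[symmetric])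
    show "subprob_space (\<kappa> m \<omega>)" if "\<omega> \<in> space M" for \<omega>
    proof
      have "c m \<omega> * of_nat (card (U m \<omega>)) \<le> 1"
        unfolding c_def by (simp add: ennreal_of_nat_eq_real_of_nat ennreal_mult'[symmetric] flip: ennreal_1)
      then show "emeasure (\<kappa> m \<omega>) (space (\<kappa> m \<omega>)) \<le> 1"
        using em[OF that, of UNIV m] by (simp add: \<kappa>_def space_scale_measure)
      show "space (\<kappa> m \<omega>) \<noteq> {}" by (simp add: \<kappa>_def space_scale_measure)
    qed
    show "(\<lambda>\<omega>. emeasure (\<kappa> m \<omega>) A) \<in> borel_measurable M" if A: "A \<in> range (\<lambda>(a, b). {a<..b})" for A
    proof -
      obtain a b where A: "A = {a<..b}" using A by auto
      have "U m \<omega> \<inter> A = S \<omega> \<inter> {max a (- real m)<..min b (real m)}" for \<omega>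
        by (auto simp: U_def A)
      then have [measurable]: "(\<lambda>\<omega>. card (U m \<omega> \<inter> A)) \<in> measurable M (count_space UNIV)"
        using cnt by simp
      have "(\<lambda>\<omega>. c m \<omega> * of_nat (card (U m \<omega> \<inter> A))) \<in> borel_measurable M" by measurable
      then show ?thesis
        by (rule measurable_cong[THEN iffD2, rotated]) (auto simp: em A)
    qed
    have "(\<lambda>\<omega>. c m \<omega> * of_nat (card (U m \<omega>))) \<in> borel_measurable M" by measurable
    then show "(\<lambda>\<omega>. emeasure (\<kappa> m \<omega>) UNIV) \<in> borel_measurable M"
      by (rule measurable_cong[THEN iffD2, rotated]) (auto simp: em)
  qed (auto simp: \<kappa>_def)
  have [measurable]: "(\<lambda>(\<omega>, s). f (s, \<omega>)) \<in> borel_measurable (M \<Otimes>\<^sub>M borel)"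
    using f by measurable
  have *: "(\<lambda>\<omega>. \<integral>\<^sup>+s. f (s, \<omega>) \<partial>\<kappa> m \<omega>) \<in> borel_measurable M" for m
    by (rule nn_integral_measurable_subprob_algebra2[OF _ \<kappa>]) measurable
  have eq: "(\<integral>\<^sup>+s. f (s, \<omega>) * indicator {- real m<..real m} s \<partial>count_space (S \<omega>)) =
      (1 + of_nat (card (U m \<omega>))) * (\<integral>\<^sup>+s. f (s, \<omega>) \<partial>\<kappa> m \<omega>)"
    if \<omega>: "\<omega> \<in> space M" for \<omega> m
  proof -
    have [measurable]: "(\<lambda>s. f (s, \<omega>)) \<in> borel_measurable borel"
      using f \<omega> by measurable
    have "(\<integral>\<^sup>+s. f (s, \<omega>) \<partial>\<kappa> m \<omega>) = c m \<omega> * (\<integral>\<^sup>+s. f (s, \<omega>) \<partial>count_space (U m \<omega>))"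
      unfolding \<kappa>_def by (simp add: nn_integral_scale_measure nn_integral_distr)
    moreover have "(1 + of_nat (card (U m \<omega>))) * c m \<omega> = 1"
      unfolding c_def
      by (simp add: ennreal_of_nat_eq_real_of_nat ennreal_mult'[symmetric] flip: ennreal_1 ennreal_plus)
    ultimately have "(1 + of_nat (card (U m \<omega>))) * (\<integral>\<^sup>+s. f (s, \<omega>) \<partial>\<kappa> m \<omega>) =
        (\<integral>\<^sup>+s. f (s, \<omega>) \<partial>count_space (U m \<omega>))"
      by (simp add: mult.assoc[symmetric])
    also have "\<dots> = (\<integral>\<^sup>+s. f (s, \<omega>) * indicator {- real m<..real m} s \<partial>count_space (S \<omega>))"
      by (subst (1 2) nn_integral_count_space_indicator)
         (auto simp: U_def intro!: nn_integral_cong split: split_indicator)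
    finally show ?thesis ..
  qed
  have **: "(\<lambda>\<omega>. \<integral>\<^sup>+s. f (s, \<omega>) * indicator {- real m<..real m} s \<partial>count_space (S \<omega>)) \<in> borel_measurable M" for m
  proof -
    have "(\<lambda>\<omega>. (1 + of_nat (card (U m \<omega>))) * (\<integral>\<^sup>+s. f (s, \<omega>) \<partial>\<kappa> m \<omega>)) \<in> borel_measurable M"
      using * by measurable
    then show ?thesis by (rule measurable_cong[THEN iffD2, rotated]) (rule eq)
  qed
  have "(\<integral>\<^sup>+s. f (s, \<omega>) \<partial>count_space (S \<omega>)) =
      (SUP m. \<integral>\<^sup>+s. f (s, \<omega>) * indicator {- real m<..real m} s \<partial>count_space (S \<omega>))" for \<omega>
  proof (subst nn_integral_monotone_convergence_SUP[symmetric])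
    show "incseq (\<lambda>m s. f (s, \<omega>) * indicator {- real m<..real m} s)"
      by (auto simp: incseq_def le_fun_def split: split_indicator)
    have "(SUP m. f (s, \<omega>) * indicator {- real m<..real m} s) = f (s, \<omega>)" for s
    proof (rule antisym)
      obtain m where "\<bar>s\<bar> < real m" using reals_Archimedean2 by blast
      then have "f (s, \<omega>) = f (s, \<omega>) * indicator {- real m<..real m} s"
        by (auto split: split_indicator)
      then show "f (s, \<omega>) \<le> (SUP m. f (s, \<omega>) * indicator {- real m<..real m} s)"
        by (metis (no_types, lifting) SUP_upper UNIV_I)
    qed (auto intro!: SUP_least split: split_indicator)
    then show "(\<integral>\<^sup>+s. f (s, \<omega>) \<partial>count_space (S \<omega>)) =
        (\<integral>\<^sup>+s. (SUP m. f (s, \<omega>) * indicator {- real m<..real m} s) \<partial>count_space (S \<omega>))" by simp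
  qed auto
  with ** show ?thesis by simp
qed

lemma configs_finite:
  assumes "N \<in> configs K" "l < K"
  shows "finite (N l \<inter> {a..b})" "finite (N l \<inter> {a<..b})" "finite (N l \<inter> {a..<b})"
proof -
  show *: "finite (N l \<inter> {a..b})" using assms by (auto simp: configs_def)
  show "finite (N l \<inter> {a<..b})" "finite (N l \<inter> {a..<b})"
    by (rule finite_subset[OF _ *], auto)+
qed

lemma countable_points:
  assumes "N \<in> configs K" "l < K"
  shows "countable (N l)"
proof -
  have "N l = (\<Union>m::nat. N l \<inter> {- real m..real m})"
  proof safe
    fix x assume "x \<in> N l"
    moreover obtain m where "\<bar>x\<bar> < real m" using reals_Archimedean2 by blast
    ultimately show "x \<in> (\<Union>m::nat. N l \<inter> {- real m..real m})" by (auto intro!: exI[of _ m])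
  qed
  moreover have "countable \<dots>"
    using configs_finite(1)[OF assms] by (intro countable_UN) (auto intro: countable_finite)
  ultimately show ?thesis by simp
qed

lemma space_history [simp]: "space (history K I) = configs K"
  unfolding history_def by (rule space_measure_of) auto

lemma sets_history:
  "sets (history K I) =
     sigma_sets (configs K) {{N \<in> configs K. card (N l \<inter> {a<..b}) = n} | l a b n. l < K \<and> {a<..b} \<subseteq> I}"
  unfolding history_def by (rule sets_measure_of) auto

lemma sets_history_mono: "I \<subseteq> J \<Longrightarrow> sets (history K I) \<subseteq> sets (history K J)"
  unfolding sets_history by (intro sigma_sets_mono') blast

lemma configs_in_history [simp]: "configs K \<in> sets (history K I)"
  using sets.top[of "history K I"] by simp

lemma measurable_count_history:
  assumes "l < K" "{a<..b} \<subseteq> I"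
  shows "(\<lambda>N. card (N l \<inter> {a<..b})) \<in> measurable (history K I) (count_space UNIV)"
proof (subst measurable_count_space_eq_countable, simp, intro conjI ballI)
  fix n :: nat
  have "(\<lambda>N. card (N l \<inter> {a<..b})) -` {n} \<inter> space (history K I) = {N \<in> configs K. card (N l \<inter> {a<..b}) = n}"
    by auto
  also have "\<dots> \<in> sets (history K I)"
    unfolding sets_history using assms by (intro sigma_sets.Basic) blast
  finally show "(\<lambda>N. card (N l \<inter> {a<..b})) -` {n} \<inter> space (history K I) \<in> sets (history K I)" .
qed auto

lemma measurable_into_history:
  assumes "\<And>x. x \<in> space M \<Longrightarrow> f x \<in> configs K"
    and "\<And>l a b. l < K \<Longrightarrow> {a<..b} \<subseteq> I \<Longrightarrow> (\<lambda>x. card (f x l \<inter> {a<..b})) \<in> measurable M (count_space UNIV)"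
  shows "f \<in> measurable M (history K I)"
  unfolding history_def
proof (rule measurable_measure_of)
  fix B assume "B \<in> {{N \<in> configs K. card (N l \<inter> {a<..b}) = n} | l a b n. l < K \<and> {a<..b} \<subseteq> I}"
  then obtain l a b n where B: "B = {N \<in> configs K. card (N l \<inter> {a<..b}) = n}" "l < K" "{a<..b} \<subseteq> I"
    by blast
  have "f -` B \<inter> space M = (\<lambda>x. card (f x l \<inter> {a<..b})) -` {n} \<inter> space M"
    using assms(1) by (auto simp: B)
  also have "\<dots> \<in> sets M"
    using assms(2)[OF B(2,3)] by (rule measurable_sets) auto
  finally show "f -` B \<inter> space M \<in> sets M" .
qed (use assms(1) in auto)

lemma points_integral_measurable:
  assumes "l < K" and f: "f \<in> borel_measurable (borel \<Otimes>\<^sub>M (M \<Otimes>\<^sub>M config_space K))"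
  shows "(\<lambda>(x, N). \<integral>\<^sup>+s. f (s, (x, N)) \<partial>count_space (N l)) \<in> borel_measurable (M \<Otimes>\<^sub>M config_space K)"
proof -
  have [measurable]: "(\<lambda>N. card (N l \<inter> {a<..b})) \<in> measurable (config_space K) (count_space UNIV)" for a b
    using assms(1) by (intro measurable_count_history) auto
  have "(\<lambda>\<omega>. \<integral>\<^sup>+s. f (s, \<omega>) \<partial>count_space (snd \<omega> l)) \<in> borel_measurable (M \<Otimes>\<^sub>M config_space K)"
  proof (rule nn_integral_points_measurable)
    show "finite (snd \<omega> l \<inter> {a..b})" if "\<omega> \<in> space (M \<Otimes>\<^sub>M config_space K)" for \<omega> a b
      using that assms(1) by (auto simp: space_pair_measure intro: configs_finite)
    show "(\<lambda>\<omega>. card (snd \<omega> l \<inter> {a<..b})) \<in> measurable (M \<Otimes>\<^sub>M config_space K) (count_space UNIV)" for a b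
      by measurable
  qed fact
  then show ?thesis by (simp add: case_prod_unfold)
qed

lemma points_integral_measurable':
  assumes "l < K" and [measurable]: "f \<in> borel_measurable (borel \<Otimes>\<^sub>M config_space K)"
  shows "(\<lambda>N. \<integral>\<^sup>+s. f (s, N) \<partial>count_space (N l)) \<in> borel_measurable (config_space K)"
proof -
  have "(\<lambda>(x::unit, N). \<integral>\<^sup>+s. (\<lambda>(s, x, N). f (s, N)) (s, (x, N)) \<partial>count_space (N l))
      \<in> borel_measurable (count_space UNIV \<Otimes>\<^sub>M config_space K)"
    using assms(1) by (rule points_integral_measurable) measurable
  from measurable_Pair2[OF this, of "()"] show ?thesis by simp
qed

section \<open>Predictable processes\<close>

lemma space_predictable [simp]: "space (predictable K) = UNIV \<times> configs K"
  unfolding predictable_def by (rule space_measure_of) (use sets.sets_into_space in fastforce)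

lemma sets_predictable:
  "sets (predictable K) = sigma_sets (UNIV \<times> configs K) {{s<..t} \<times> B | s t B. B \<in> sets (history K {..s})}"
  unfolding predictable_def by (rule sets_measure_of) (use sets.sets_into_space in fastforce)

lemma predictable_rectangle:
  "B \<in> sets (history K {..s}) \<Longrightarrow> {s<..t} \<times> B \<in> sets (predictable K)"
  unfolding sets_predictable by (intro sigma_sets.Basic) blast

lemma predictable_ray:
  assumes "B \<in> sets (history K {..s})"
  shows "{s<..} \<times> B \<in> sets (predictable K)"
proof -
  have "{s<..} \<times> B = (\<Union>n::nat. {s<..s + real n} \<times> B)"
  proof safe
    fix t N assume "s < t" "N \<in> B"
    moreover obtain n where "t - s < real n" using reals_Archimedean2 by blast
    ultimately show "(t, N) \<in> (\<Union>n::nat. {s<..s + real n} \<times> B)" by (auto intro!: exI[of _ n])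
  qed auto
  also have "\<dots> \<in> sets (predictable K)"
    using assms by (intro sets.countable_UN) (auto intro: predictable_rectangle)
  finally show ?thesis .
qed

lemma measurable_fst_predictable [measurable]: "fst \<in> borel_measurable (predictable K)"
proof (subst borel_measurable_iff_greater, intro allI)
  fix a :: real
  have "{w \<in> space (predictable K). a < fst w} = {a<..} \<times> configs K" by auto
  then show "{w \<in> space (predictable K). a < fst w} \<in> sets (predictable K)"
    by (simp add: predictable_ray)
qed

lemma measurable_into_predictable:
  assumes "\<And>x. x \<in> space M \<Longrightarrow> snd (f x) \<in> configs K"
    and "\<And>s t B. B \<in> sets (history K {..s}) \<Longrightarrow> f -` ({s<..t} \<times> B) \<inter> space M \<in> sets M"
  shows "f \<in> measurable M (predictable K)"
  unfolding predictable_def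
proof (rule measurable_measure_of)
  show "{{s<..t} \<times> B |s t B. B \<in> sets (history K {..s})} \<subseteq> Pow (UNIV \<times> configs K)"
    using sets.sets_into_space by fastforce
qed (use assms in \<open>auto simp: mem_Times_iff\<close>)

lemma predictable_into_product:
  "(\<lambda>x. x) \<in> measurable (borel \<Otimes>\<^sub>M config_space K) (predictable K)"
proof (rule measurable_into_predictable)
  fix s t :: real and B assume "B \<in> sets (history K {..s})"
  then have "B \<in> sets (config_space K)" using sets_history_mono[of "{..s}" UNIV K] by auto
  then have "{s<..t} \<times> B \<in> sets (borel \<Otimes>\<^sub>M config_space K)" by auto
  then show "(\<lambda>x. x) -` ({s<..t} \<times> B) \<inter> space (borel \<Otimes>\<^sub>M config_space K) \<in> sets (borel \<Otimes>\<^sub>M config_space K)"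
    by auto
qed (auto simp: space_pair_measure)

lemma predictable_imp_jointly_measurable:
  "f \<in> measurable (predictable K) L \<Longrightarrow> f \<in> measurable (borel \<Otimes>\<^sub>M config_space K) L"
  by (rule measurable_compose[OF predictable_into_product])

text \<open>
  The number of points in a bounded interval strictly before time \<open>t\<close> is left-continuous in \<open>t\<close>;
  the rational times \<open>q < t\<close> already see all of these points.
\<close>

lemma past_count_predictable:
  assumes l: "l < K"
  shows "(\<lambda>(t, N). card (N l \<inter> {..<t} \<inter> {a<..b})) \<in> measurable (predictable K) (count_space UNIV)"
proof -
  define c where "c = (\<lambda>(t, N). card (N l \<inter> {..<t} \<inter> {a<..b::real}))"
  have ge: "{w \<in> space (predictable K). n \<le> c w} \<in> sets (predictable K)" for n
  proof -
    have "{w \<in> space (predictable K). n \<le> c w} =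
        (\<Union>q\<in>\<rat>. {q<..} \<times> {N \<in> configs K. n \<le> card (N l \<inter> {a<..min b q})})"
    proof safe
      fix t N assume N: "(t, N) \<in> space (predictable K)" and n: "n \<le> c (t, N)"
      define F where "F = N l \<inter> {..<t} \<inter> {a<..b}"
      have F: "finite F"
        using N l by (intro finite_subset[OF _ configs_finite(2)[of N K l a b]]) (auto simp: F_def)
      define m where "m = Max (insert (t - 1) F)"
      have "m < t" using F unfolding m_def by (subst Max_less_iff) (auto simp: F_def)
      then obtain q where q: "m < q" "q < t" "q \<in> \<rat>" using Rats_dense_in_real by blast
      have "F \<subseteq> N l \<inter> {a<..min b q}"
      proof
        fix x assume "x \<in> F"
        then have "x \<le> m" using F by (simp add: m_def)
        with q \<open>x \<in> F\<close> show "x \<in> N l \<inter> {a<..min b q}" by (auto simp: F_def)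
      qed
      moreover have "finite (N l \<inter> {a<..min b q})"
        using N l by (auto intro: configs_finite)
      ultimately have "card F \<le> card (N l \<inter> {a<..min b q})" by (simp add: card_mono)
      with n have "n \<le> card (N l \<inter> {a<..min b q})" by (simp add: c_def F_def)
      with N q show "(t, N) \<in> (\<Union>q\<in>\<rat>. {q<..} \<times> {N \<in> configs K. n \<le> card (N l \<inter> {a<..min b q})})"
        by (auto intro!: bexI[of _ q])
    next
      fix q t :: real and N assume q: "q < t" "q \<in> \<rat>" and N: "N \<in> configs K" and n: "n \<le> card (N l \<inter> {a<..min b q})"
      have "finite (N l \<inter> {..<t} \<inter> {a<..b})"
        using N l by (intro finite_subset[OF _ configs_finite(2)[of N K l a b]]) auto
      then have "card (N l \<inter> {a<..min b q}) \<le> card (N l \<inter> {..<t} \<inter> {a<..b})"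
        using q by (intro card_mono) auto
      with n show "n \<le> c (t, N)" by (simp add: c_def)
    qed auto
    also have "\<dots> \<in> sets (predictable K)"
    proof (intro sets.countable_UN'' countable_rat predictable_ray)
      fix q :: real
      have [measurable]: "(\<lambda>N. card (N l \<inter> {a<..min b q})) \<in> measurable (history K {..q}) (count_space UNIV)"
        using l by (intro measurable_count_history) auto
      have "{N \<in> space (history K {..q}). n \<le> card (N l \<inter> {a<..min b q})} \<in> sets (history K {..q})"
        by measurable
      then show "{N \<in> configs K. n \<le> card (N l \<inter> {a<..min b q})} \<in> sets (history K {..q})" by simp
    qed
    finally show ?thesis .
  qed
  have "c \<in> measurable (predictable K) (count_space UNIV)"
  proof (subst measurable_count_space_eq_countable, simp, intro conjI ballI)
    fix n :: nat
    have "c -` {n} \<inter> space (predictable K) =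
        {w \<in> space (predictable K). n \<le> c w} - {w \<in> space (predictable K). Suc n \<le> c w}" by auto
    then show "c -` {n} \<inter> space (predictable K) \<in> sets (predictable K)"
      using ge by auto
  qed auto
  then show ?thesis by (simp add: c_def)
qed

lemma past_points_integral_predictable:
  assumes l: "l < K" and f: "f \<in> borel_measurable (borel \<Otimes>\<^sub>M predictable K)"
  shows "(\<lambda>(t, N). \<integral>\<^sup>+s. f (s, (t, N)) \<partial>count_space (N l \<inter> {..<t})) \<in> borel_measurable (predictable K)"
proof -
  have "(\<lambda>\<omega>. \<integral>\<^sup>+s. f (s, \<omega>) \<partial>count_space (snd \<omega> l \<inter> {..<fst \<omega>})) \<in> borel_measurable (predictable K)"
  proof (rule nn_integral_points_measurable)
    show "finite (snd \<omega> l \<inter> {..<fst \<omega>} \<inter> {a..b})" if "\<omega> \<in> space (predictable K)" for \<omega> a b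
      using that l by (intro finite_subset[OF _ configs_finite(1)[of "snd \<omega>" K l a b]]) auto
    show "(\<lambda>\<omega>. card (snd \<omega> l \<inter> {..<fst \<omega>} \<inter> {a<..b})) \<in> measurable (predictable K) (count_space UNIV)" for a b
      using past_count_predictable[OF l, of a b] by (simp add: case_prod_unfold)
  qed fact
  then show ?thesis by (simp add: case_prod_unfold)
qed

text \<open>
  A predictable process at an earlier time is known at time \<open>t\<close>: if \<open>s < t\<close> and \<open>(s, N) \<in> {a<..b} \<times> B\<close> with \<open>B\<close> in
  the history up to \<open>a\<close>, then \<open>t > a\<close>, and \<open>{a<..} \<times> B\<close> is predictable.
\<close>

lemma past_value_measurable:
  assumes \<psi>: "\<psi> \<in> borel_measurable (predictable K)"
  shows "(\<lambda>(s, (t, N)). \<psi> (s, N) * indicator {..<t} s :: ennreal) \<in> borel_measurable (borel \<Otimes>\<^sub>M predictable K)"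
proof -
  define \<Omega> where "\<Omega> = {w \<in> space (borel \<Otimes>\<^sub>M predictable K). fst w < fst (snd w)}"
  have \<Omega>[measurable]: "\<Omega> \<in> sets (borel \<Otimes>\<^sub>M predictable K)"
    unfolding \<Omega>_def by measurable
  let ?R = "restrict_space (borel \<Otimes>\<^sub>M predictable K) \<Omega>"
  have "(\<lambda>w. (fst w, snd (snd w))) \<in> measurable ?R (predictable K)"
  proof (rule measurable_into_predictable)
    show "snd (fst w, snd (snd w)) \<in> configs K" if "w \<in> space ?R" for w :: "real \<times> real \<times> config"
      using that by (auto simp: space_restrict_space space_pair_measure)
  next
    fix a b :: real and B assume B: "B \<in> sets (history K {..a})"
    have "B \<subseteq> configs K" using sets.sets_into_space[OF B] by simp
    then have "(\<lambda>w. (fst w, snd (snd w))) -` ({a<..b} \<times> B) \<inter> space ?R =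
        \<Omega> \<inter> ({a<..b} \<times> ({a<..} \<times> B))"
      by (auto simp: space_restrict_space space_pair_measure \<Omega>_def)
    also have "\<dots> \<in> sets ?R"
      using predictable_ray[OF B] by (subst sets_restrict_space_iff) auto
    finally show "(\<lambda>w. (fst w, snd (snd w))) -` ({a<..b} \<times> B) \<inter> space ?R \<in> sets ?R" .
  qed
  from measurable_compose[OF this \<psi>]
  have "(\<lambda>w. \<psi> (fst w, snd (snd w))) \<in> borel_measurable ?R" .
  then have "(\<lambda>w. \<psi> (fst w, snd (snd w)) * indicator \<Omega> w) \<in> borel_measurable (borel \<Otimes>\<^sub>M predictable K)"
    by (subst (asm) borel_measurable_restrict_space_iff_ennreal) auto
  then show ?thesis
    by (rule measurable_cong[THEN iffD1, rotated])
       (auto simp: \<Omega>_def space_pair_measure split: split_indicator)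
qed

lemma past_sum_predictable:
  assumes l: "l < K" and \<psi>: "\<psi> \<in> borel_measurable (predictable K)"
  shows "(\<lambda>(t, N). \<integral>\<^sup>+s. \<psi> (s, N) \<partial>count_space (N l \<inter> {..<t})) \<in> borel_measurable (predictable K)"
proof -
  have "(\<lambda>(t, N). \<integral>\<^sup>+s. (\<lambda>(s, (t, N)). \<psi> (s, N) * indicator {..<t} s) (s, (t, N)) \<partial>count_space (N l \<inter> {..<t}))
      \<in> borel_measurable (predictable K)"
    using past_points_integral_predictable[OF l past_value_measurable[OF \<psi>]] by simp
  then show ?thesis
    by (rule measurable_cong[THEN iffD1, rotated]) (auto intro!: nn_integral_cong)
qed

lemma past_integral_predictable:
  assumes \<psi>: "\<psi> \<in> borel_measurable (predictable K)"
  shows "(\<lambda>(t, N). \<integral>\<^sup>+s\<in>{..<t}. \<psi> (s, N) \<partial>lborel) \<in> borel_measurable (predictable K)"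
proof -
  have [measurable]: "(\<lambda>(s, (t, N)). \<psi> (s, N) * indicator {..<t} s) \<in> borel_measurable (borel \<Otimes>\<^sub>M predictable K)"
    by (rule past_value_measurable) fact
  have "(\<lambda>w. \<integral>\<^sup>+s. (\<lambda>(s, (t, N)). \<psi> (s, N) * indicator {..<t} s) (s, w) \<partial>lborel) \<in> borel_measurable (predictable K)"
    by measurable
  then show ?thesis by (simp add: case_prod_unfold)
qed

section \<open>Compensated integrals\<close>

lemma nn_integral_count_space_past:
  fixes g :: "real \<Rightarrow> ennreal"
  shows "(\<integral>\<^sup>+s\<in>{..<t}. g s \<partial>count_space S) = (\<integral>\<^sup>+s. g s \<partial>count_space (S \<inter> {..<t}))"
  by (subst (1 2) nn_integral_count_space_indicator)
     (auto intro!: nn_integral_cong split: split_indicator)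

text \<open>
  The product of two integrals is a double integral, which is split according to the order of the two
  times. The last term collects the common atoms.
\<close>

lemma integration_by_parts:
  fixes f g :: "real \<Rightarrow> ennreal"
  assumes sf: "sigma_finite_measure M1" "sigma_finite_measure M2"
    and id1: "(\<lambda>x. x) \<in> borel_measurable M1" and id2: "(\<lambda>x. x) \<in> borel_measurable M2"
    and [measurable]: "f \<in> borel_measurable M1" "g \<in> borel_measurable M2"
  shows "(\<integral>\<^sup>+t. f t \<partial>M1) * (\<integral>\<^sup>+s. g s \<partial>M2) =
     (\<integral>\<^sup>+t. f t * (\<integral>\<^sup>+s\<in>{..<t}. g s \<partial>M2) \<partial>M1) +
     (\<integral>\<^sup>+s. g s * (\<integral>\<^sup>+t\<in>{..<s}. f t \<partial>M1) \<partial>M2) +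
     (\<integral>\<^sup>+t. f t * (\<integral>\<^sup>+s\<in>{t}. g s \<partial>M2) \<partial>M1)"
proof -
  interpret pair_sigma_finite M1 M2 using sf by (simp add: pair_sigma_finite_def)
  have [measurable]: "(\<lambda>w. fst w) \<in> borel_measurable (M1 \<Otimes>\<^sub>M M2)" "(\<lambda>w. snd w) \<in> borel_measurable (M1 \<Otimes>\<^sub>M M2)"
      "(\<lambda>w. fst w) \<in> borel_measurable (M2 \<Otimes>\<^sub>M M1)" "(\<lambda>w. snd w) \<in> borel_measurable (M2 \<Otimes>\<^sub>M M1)"
    using measurable_compose[OF measurable_fst id1] measurable_compose[OF measurable_snd id2]
      measurable_compose[OF measurable_fst id2] measurable_compose[OF measurable_snd id1] by auto
  have le: "{w \<in> space (M1 \<Otimes>\<^sub>M M2). snd w < fst w} \<in> sets (M1 \<Otimes>\<^sub>M M2)"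
    "{w \<in> space (M1 \<Otimes>\<^sub>M M2). fst w < snd w} \<in> sets (M1 \<Otimes>\<^sub>M M2)"
    "{w \<in> space (M1 \<Otimes>\<^sub>M M2). snd w = fst w} \<in> sets (M1 \<Otimes>\<^sub>M M2)"
    by measurable
  have p: "(\<lambda>(t, s). g s * indicator {..<t} s) \<in> borel_measurable (M1 \<Otimes>\<^sub>M M2)"
    "(\<lambda>(t, s). g s * indicator {t<..} s) \<in> borel_measurable (M1 \<Otimes>\<^sub>M M2)"
    "(\<lambda>(t, s). g s * indicator {t} s) \<in> borel_measurable (M1 \<Otimes>\<^sub>M M2)"
  proof -
    note [measurable] = le
    have w: "(\<lambda>w. g (snd w) * indicator {w \<in> space (M1 \<Otimes>\<^sub>M M2). snd w < fst w} w) \<in> borel_measurable (M1 \<Otimes>\<^sub>M M2)"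
      "(\<lambda>w. g (snd w) * indicator {w \<in> space (M1 \<Otimes>\<^sub>M M2). fst w < snd w} w) \<in> borel_measurable (M1 \<Otimes>\<^sub>M M2)"
      "(\<lambda>w. g (snd w) * indicator {w \<in> space (M1 \<Otimes>\<^sub>M M2). snd w = fst w} w) \<in> borel_measurable (M1 \<Otimes>\<^sub>M M2)"
      by measurable
    from w(1) show "(\<lambda>(t, s). g s * indicator {..<t} s) \<in> borel_measurable (M1 \<Otimes>\<^sub>M M2)"
      by (rule measurable_cong[THEN iffD1, rotated]) (auto split: split_indicator)
    from w(2) show "(\<lambda>(t, s). g s * indicator {t<..} s) \<in> borel_measurable (M1 \<Otimes>\<^sub>M M2)"
      by (rule measurable_cong[THEN iffD1, rotated]) (auto split: split_indicator)
    from w(3) show "(\<lambda>(t, s). g s * indicator {t} s) \<in> borel_measurable (M1 \<Otimes>\<^sub>M M2)"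
      by (rule measurable_cong[THEN iffD1, rotated]) (auto split: split_indicator)
  qed
  have m: "(\<lambda>s. g s * indicator {..<t} s) \<in> borel_measurable M2"
      "(\<lambda>s. g s * indicator {t<..} s) \<in> borel_measurable M2"
      "(\<lambda>s. g s * indicator {t} s) \<in> borel_measurable M2" for t
    using id2 by measurable
  have "(\<integral>\<^sup>+t. f t \<partial>M1) * (\<integral>\<^sup>+s. g s \<partial>M2) = (\<integral>\<^sup>+t. f t * (\<integral>\<^sup>+s. g s \<partial>M2) \<partial>M1)"
    by (rule nn_integral_multc[symmetric]) auto
  also have "\<dots> = (\<integral>\<^sup>+t. f t * (\<integral>\<^sup>+s\<in>{..<t}. g s \<partial>M2) + f t * (\<integral>\<^sup>+s\<in>{t<..}. g s \<partial>M2)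
      + f t * (\<integral>\<^sup>+s\<in>{t}. g s \<partial>M2) \<partial>M1)"
  proof (intro nn_integral_cong)
    fix t
    have "(\<integral>\<^sup>+s. g s \<partial>M2) =
        (\<integral>\<^sup>+s. g s * indicator {..<t} s + g s * indicator {t<..} s + g s * indicator {t} s \<partial>M2)"
      by (intro nn_integral_cong) (auto split: split_indicator)
    also have "\<dots> = (\<integral>\<^sup>+s\<in>{..<t}. g s \<partial>M2) + (\<integral>\<^sup>+s\<in>{t<..}. g s \<partial>M2) + (\<integral>\<^sup>+s\<in>{t}. g s \<partial>M2)"
      using m by (simp add: nn_integral_add)
    finally show "f t * (\<integral>\<^sup>+s. g s \<partial>M2) = f t * (\<integral>\<^sup>+s\<in>{..<t}. g s \<partial>M2) + f t * (\<integral>\<^sup>+s\<in>{t<..}. g s \<partial>M2)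
      + f t * (\<integral>\<^sup>+s\<in>{t}. g s \<partial>M2)" by (simp add: distrib_left)
  qed
  also have "\<dots> = (\<integral>\<^sup>+t. f t * (\<integral>\<^sup>+s\<in>{..<t}. g s \<partial>M2) \<partial>M1) +
      (\<integral>\<^sup>+t. f t * (\<integral>\<^sup>+s\<in>{t<..}. g s \<partial>M2) \<partial>M1) + (\<integral>\<^sup>+t. f t * (\<integral>\<^sup>+s\<in>{t}. g s \<partial>M2) \<partial>M1)"
  proof -
    have [measurable]: "(\<lambda>t. \<integral>\<^sup>+s\<in>{..<t}. g s \<partial>M2) \<in> borel_measurable M1"
      "(\<lambda>t. \<integral>\<^sup>+s\<in>{t<..}. g s \<partial>M2) \<in> borel_measurable M1"
      "(\<lambda>t. \<integral>\<^sup>+s\<in>{t}. g s \<partial>M2) \<in> borel_measurable M1"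
      using p[THEN M2.borel_measurable_nn_integral_fst] by simp_all
    then show ?thesis by (simp add: nn_integral_add)
  qed
  also have "(\<integral>\<^sup>+t. f t * (\<integral>\<^sup>+s\<in>{t<..}. g s \<partial>M2) \<partial>M1) = (\<integral>\<^sup>+t. (\<integral>\<^sup>+s. f t * (g s * indicator {t<..} s) \<partial>M2) \<partial>M1)"
    using m by (intro nn_integral_cong nn_integral_cmult[symmetric]) auto
  also have "\<dots> = (\<integral>\<^sup>+s. (\<integral>\<^sup>+t. f t * (g s * indicator {t<..} s) \<partial>M1) \<partial>M2)"
  proof (rule Fubini'[symmetric])
    have "(\<lambda>w. f (fst w) * (\<lambda>(t, s). g s * indicator {t<..} s) w) \<in> borel_measurable (M1 \<Otimes>\<^sub>M M2)"
      using p(2) by measurable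
    then show "(\<lambda>(t, s). f t * (g s * indicator {t<..} s)) \<in> borel_measurable (M1 \<Otimes>\<^sub>M M2)"
      by (simp add: case_prod_unfold)
  qed
  also have "\<dots> = (\<integral>\<^sup>+s. (\<integral>\<^sup>+t. g s * (f t * indicator {..<s} t) \<partial>M1) \<partial>M2)"
    by (intro nn_integral_cong) (auto simp: mult_ac split: split_indicator)
  also have "\<dots> = (\<integral>\<^sup>+s. g s * (\<integral>\<^sup>+t\<in>{..<s}. f t \<partial>M1) \<partial>M2)"
    using id1 by (intro nn_integral_cong nn_integral_cmult) auto
  finally show ?thesis .
qed

lemma SUP_power2_ennreal:
  fixes a :: "nat \<Rightarrow> ennreal"
  assumes "incseq a"
  shows "(SUP n. a n)\<^sup>2 = (SUP n. (a n)\<^sup>2)"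
proof (rule antisym)
  have "(SUP n. a n)\<^sup>2 = (SUP m. SUP n. a n * a m)"
    unfolding power2_eq_square SUP_mult_right_ennreal SUP_mult_left_ennreal ..
  also have "\<dots> \<le> (SUP n. (a n)\<^sup>2)"
  proof (intro SUP_least)
    fix m n
    have "a n * a m \<le> (a (max m n))\<^sup>2"
      unfolding power2_eq_square using assms by (intro mult_mono) (auto simp: incseq_def)
    then show "a n * a m \<le> (SUP n. (a n)\<^sup>2)" by (meson SUP_upper2 UNIV_I)
  qed
  finally show "(SUP n. a n)\<^sup>2 \<le> (SUP n. (a n)\<^sup>2)" .
  show "(SUP n. (a n)\<^sup>2) \<le> (SUP n. a n)\<^sup>2"
    by (intro SUP_least power_mono SUP_upper) auto
qed

lemma SUP_min_of_nat_power2: "(SUP n::nat. (min a (of_nat n))\<^sup>2) = (a\<^sup>2 :: ennreal)"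
proof -
  have "(SUP n::nat. min a (of_nat n)) = a"
  proof (cases "a = \<infinity>")
    case True
    then show ?thesis by (simp add: ennreal_SUP_of_nat_eq_top)
  next
    case False
    then obtain n where "a < of_nat n" using ennreal_Ex_less_of_nat[of a] by (auto simp: less_top)
    then have "a = min a (of_nat n)" by (simp add: min_absorb1)
    then have "a \<le> (SUP n::nat. min a (of_nat n))" by (metis SUP_upper UNIV_I)
    then show ?thesis by (intro antisym SUP_least) auto
  qed
  moreover have "(SUP n::nat. min a (of_nat n))\<^sup>2 = (SUP n::nat. (min a (of_nat n))\<^sup>2)"
    by (intro SUP_power2_ennreal) (auto simp: incseq_def intro: min.coboundedI2)
  ultimately show ?thesis by simp
qed

text \<open>
  For \<open>x \<ge> y\<close> finite this is an equality. Truncated subtraction makes the square of \<open>x - y\<close> ignore the case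
  \<open>x < y\<close>, which is harmless: only upper bounds for \<open>x\<close> are drawn from it.
\<close>

lemma square_diff_le_ennreal:
  fixes x y :: ennreal
  shows "(x - y)\<^sup>2 + 2 * (x * y) \<le> x\<^sup>2 + y\<^sup>2"
proof (cases "x = \<infinity> \<or> y = \<infinity>")
  case False
  then obtain a b where ab: "x = ennreal a" "0 \<le> a" "y = ennreal b" "0 \<le> b"
    by (cases x; cases y) auto
  have 2: "(2::ennreal) = ennreal 2" by simp
  have eq: "x\<^sup>2 + y\<^sup>2 = ennreal (a\<^sup>2 + b\<^sup>2)" using ab by (simp add: ennreal_power)
  have xy: "2 * (x * y) = ennreal (2 * (a * b))"
    using ab unfolding 2 by (simp only: ennreal_mult[symmetric] mult_nonneg_nonneg zero_le_numeral)
  show ?thesis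
  proof (cases "b \<le> a")
    case True
    then have "(x - y)\<^sup>2 + 2 * (x * y) = ennreal ((a - b)\<^sup>2 + 2 * (a * b))"
      unfolding xy using ab by (simp add: ennreal_minus ennreal_power)
    also have "\<dots> = x\<^sup>2 + y\<^sup>2" unfolding eq by (simp add: power2_eq_square algebra_simps)
    finally show ?thesis by simp
  next
    case False
    then have "(x - y)\<^sup>2 + 2 * (x * y) = ennreal (2 * (a * b))"
      unfolding xy using ab by (simp add: ennreal_minus ennreal_neg)
    also have "\<dots> \<le> x\<^sup>2 + y\<^sup>2" unfolding eq
      using sum_squares_bound[of a b] by (intro ennreal_leI) (simp add: mult.assoc)
    finally show ?thesis .
  qed
qed (auto simp: power2_eq_square)

lemma le_diff_add_ennreal: "x \<le> (x - y) + (y :: ennreal)"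
  using linear[of x y] by (auto simp: diff_add_self_ennreal)

lemma square_add_le_ennreal:
  fixes x y :: ennreal
  shows "(x + y)\<^sup>2 \<le> 2 * x\<^sup>2 + 2 * y\<^sup>2"
proof -
  have "2 * (x * y) \<le> x\<^sup>2 + y\<^sup>2"
    using square_diff_le_ennreal[of x y] by (metis add.commute le_iff_add order_trans)
  then have "x\<^sup>2 + y\<^sup>2 + 2 * (x * y) \<le> x\<^sup>2 + y\<^sup>2 + (x\<^sup>2 + y\<^sup>2)" by (rule add_left_mono)
  moreover have "(x + y)\<^sup>2 = x\<^sup>2 + y\<^sup>2 + 2 * (x * y)"
    unfolding power2_eq_square mult_2 by (simp add: distrib_left distrib_right add_ac mult_ac)
  ultimately show ?thesis by (simp add: mult_2 add_ac)
qed

locale point_process_with_intensity =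
  fixes K :: nat and P :: "config measure" and k :: nat and lam :: "real \<Rightarrow> config \<Rightarrow> real"
  assumes prob_space_P: "prob_space P" and sets_P: "sets P = sets (config_space K)"
    and k: "k < K" and intensity: "has_intensity K P k lam"
    and lam_predictable: "(\<lambda>(t, N). ennreal (lam t N)) \<in> borel_measurable (predictable K)"
begin

sublocale prob_space P by (rule prob_space_P)

lemma space_P: "space P = configs K"
  using sets_eq_imp_space_eq[OF sets_P] by simp

text \<open>
  Integrands are extended non-negative processes \<open>\<psi>\<close>. The process \<open>past_sum \<psi>\<close> is the integral of \<open>\<psi>\<close> against
  \<open>dN\<close> strictly before \<open>t\<close>, and \<open>past_compensator \<psi>\<close> the one against \<open>\<lambda> dt\<close>; strictness makes both predictable,
  so that they may appear as factors of an integrand.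
\<close>

definition points_sum :: "(real \<times> config \<Rightarrow> ennreal) \<Rightarrow> config \<Rightarrow> ennreal" where
  "points_sum \<psi> N = (\<integral>\<^sup>+t. \<psi> (t, N) \<partial>count_space (N k))"

definition compensator :: "(real \<times> config \<Rightarrow> ennreal) \<Rightarrow> config \<Rightarrow> ennreal" where
  "compensator \<psi> N = (\<integral>\<^sup>+t. \<psi> (t, N) * ennreal (lam t N) \<partial>lborel)"

definition past_sum :: "(real \<times> config \<Rightarrow> ennreal) \<Rightarrow> real \<times> config \<Rightarrow> ennreal" where
  "past_sum \<psi> = (\<lambda>(t, N). \<integral>\<^sup>+s. \<psi> (s, N) \<partial>count_space (N k \<inter> {..<t}))"

definition past_compensator :: "(real \<times> config \<Rightarrow> ennreal) \<Rightarrow> real \<times> config \<Rightarrow> ennreal" where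
  "past_compensator \<psi> = (\<lambda>(t, N). \<integral>\<^sup>+s\<in>{..<t}. \<psi> (s, N) * ennreal (lam s N) \<partial>lborel)"

lemma measurable_product_P: "measurable (borel \<Otimes>\<^sub>M P) L = measurable (borel \<Otimes>\<^sub>M config_space K) L"
  by (rule measurable_cong_sets[OF sets_pair_measure_cong[OF refl sets_P] refl])

lemma predictable_jointly_measurable:
  "\<psi> \<in> borel_measurable (predictable K) \<Longrightarrow> \<psi> \<in> borel_measurable (borel \<Otimes>\<^sub>M P)"
  unfolding measurable_product_P by (rule predictable_imp_jointly_measurable)

lemmas lam_jointly_measurable = predictable_jointly_measurable[OF lam_predictable]

lemma measurable_points_sum [measurable (raw)]:
  assumes "\<psi> \<in> borel_measurable (predictable K)"
  shows "points_sum \<psi> \<in> borel_measurable P"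
proof -
  have "(\<lambda>N. \<integral>\<^sup>+t. \<psi> (t, N) \<partial>count_space (N k)) \<in> borel_measurable (config_space K)"
    using k predictable_imp_jointly_measurable[OF assms] by (rule points_integral_measurable')
  then show ?thesis
    unfolding points_sum_def[abs_def] by (simp add: measurable_cong_sets[OF sets_P refl])
qed

lemma measurable_compensator [measurable (raw)]:
  assumes "\<psi> \<in> borel_measurable (predictable K)"
  shows "compensator \<psi> \<in> borel_measurable P"
proof -
  have [measurable]: "\<psi> \<in> borel_measurable (borel \<Otimes>\<^sub>M P)" "(\<lambda>(t, N). ennreal (lam t N)) \<in> borel_measurable (borel \<Otimes>\<^sub>M P)"
    using assms by (auto intro: predictable_jointly_measurable lam_jointly_measurable)
  show ?thesis
    unfolding compensator_def[abs_def] by measurable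
qed

lemma measurable_past_sum [measurable (raw)]:
  "\<psi> \<in> borel_measurable (predictable K) \<Longrightarrow> past_sum \<psi> \<in> borel_measurable (predictable K)"
  unfolding past_sum_def using k by (rule past_sum_predictable)

lemma measurable_past_compensator [measurable (raw)]:
  assumes "\<psi> \<in> borel_measurable (predictable K)"
  shows "past_compensator \<psi> \<in> borel_measurable (predictable K)"
proof -
  have "(\<lambda>w. \<psi> w * (case w of (t, N) \<Rightarrow> ennreal (lam t N))) \<in> borel_measurable (predictable K)"
    by (rule borel_measurable_times_ennreal[OF assms lam_predictable])
  from past_integral_predictable[OF this] show ?thesis
    by (simp add: past_compensator_def)
qed

lemma points_sum_mono: "(\<And>t N. \<psi> (t, N) \<le> \<phi> (t, N)) \<Longrightarrow> points_sum \<psi> N \<le> points_sum \<phi> N"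
  unfolding points_sum_def by (intro nn_integral_mono) auto

lemma compensator_mono: "(\<And>t N. \<psi> (t, N) \<le> \<phi> (t, N)) \<Longrightarrow> compensator \<psi> N \<le> compensator \<phi> N"
  unfolding compensator_def by (intro nn_integral_mono mult_right_mono) auto

lemma past_sum_mono: "(\<And>t N. \<psi> (t, N) \<le> \<phi> (t, N)) \<Longrightarrow> past_sum \<psi> w \<le> past_sum \<phi> w"
  unfolding past_sum_def by (cases w) (simp add: nn_integral_mono)

lemma past_compensator_mono: "(\<And>t N. \<psi> (t, N) \<le> \<phi> (t, N)) \<Longrightarrow> past_compensator \<psi> w \<le> past_compensator \<phi> w"
  unfolding past_compensator_def by (cases w) (simp add: nn_integral_mono mult_right_mono)

lemma past_sum_le: "past_sum \<psi> (t, N) \<le> points_sum \<psi> N"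
  unfolding past_sum_def points_sum_def
  by (subst (1 2) nn_integral_count_space_indicator)
     (auto intro!: nn_integral_mono split: split_indicator)

lemma past_compensator_le: "past_compensator \<psi> (t, N) \<le> compensator \<psi> N"
  unfolding past_compensator_def compensator_def
  by (auto intro!: nn_integral_mono split: split_indicator)

lemma expectation_points_sum:
  assumes "\<psi> \<in> borel_measurable (predictable K)"
  shows "(\<integral>\<^sup>+N. points_sum \<psi> N \<partial>P) = (\<integral>\<^sup>+N. compensator \<psi> N \<partial>P)"
  using intensity assms unfolding has_intensity_def points_sum_def compensator_def by simp

lemma
  assumes \<psi>: "\<psi> \<in> borel_measurable (predictable K)" and \<phi>: "\<phi> \<in> borel_measurable (predictable K)"
    and N: "N \<in> configs K"
  shows points_sum_mult_points_sum: "points_sum \<psi> N * points_sum \<phi> N =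
      points_sum (\<lambda>w. \<psi> w * past_sum \<phi> w) N + points_sum (\<lambda>w. \<phi> w * past_sum \<psi> w) N
        + points_sum (\<lambda>w. \<psi> w * \<phi> w) N" (is ?SS)
    and points_sum_mult_compensator: "points_sum \<psi> N * compensator \<phi> N =
      points_sum (\<lambda>w. \<psi> w * past_compensator \<phi> w) N + compensator (\<lambda>w. \<phi> w * past_sum \<psi> w) N" (is ?SC)
    and compensator_mult_compensator: "compensator \<psi> N * compensator \<phi> N =
      compensator (\<lambda>w. \<psi> w * past_compensator \<phi> w) N + compensator (\<lambda>w. \<phi> w * past_compensator \<psi> w) N" (is ?CC)
proof -
  have N': "N \<in> space P" using N by (simp add: space_P)
  have [measurable]: "\<psi> \<in> borel_measurable (borel \<Otimes>\<^sub>M P)" "\<phi> \<in> borel_measurable (borel \<Otimes>\<^sub>M P)"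
      "(\<lambda>(t, N). ennreal (lam t N)) \<in> borel_measurable (borel \<Otimes>\<^sub>M P)"
    using \<psi> \<phi> by (auto intro: predictable_jointly_measurable lam_jointly_measurable)
  have [measurable]: "(\<lambda>t. \<psi> (t, N)) \<in> borel_measurable borel" "(\<lambda>t. \<phi> (t, N)) \<in> borel_measurable borel"
    using N' by measurable
  have lam: "(\<lambda>t. ennreal (lam t N)) \<in> borel_measurable borel"
    using measurable_compose[OF measurable_Pair2'[OF N'] lam_jointly_measurable] by simp
  have sf: "sigma_finite_measure (count_space (N k))" "sigma_finite_measure lborel"
    using countable_points[OF N k] by (auto intro: sigma_finite_measure_count_space_countable lborel.sigma_finite_measure_axioms)
  have diag: "(\<integral>\<^sup>+s\<in>{t}. g s \<partial>lborel) = 0" for t and g :: "real \<Rightarrow> ennreal"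
  proof -
    have "AE s in lborel. s \<noteq> t" by (rule AE_lborel_singleton)
    then have "AE s in lborel. g s * indicator {t} s = 0" by eventually_elim auto
    then have "(\<integral>\<^sup>+s\<in>{t}. g s \<partial>lborel) = (\<integral>\<^sup>+s. 0 \<partial>(lborel::real measure))" by (intro nn_integral_cong_AE) auto
    then show ?thesis by simp
  qed
  have diagc: "(\<integral>\<^sup>+s\<in>{t}. g s \<partial>count_space (N k)) = g t" if "t \<in> N k" for t and g :: "real \<Rightarrow> ennreal"
  proof -
    have "(\<integral>\<^sup>+s\<in>{t}. g s \<partial>count_space (N k)) = (\<Sum>s\<in>{t}. g s * indicator {t} s)"
      using that by (intro nn_integral_count_space') (auto split: split_indicator)
    then show ?thesis by simp
  qed
  show ?SS
    unfolding points_sum_def past_sum_def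
    by (subst integration_by_parts[OF sf(1) sf(1)])
       (auto simp: nn_integral_count_space_past diagc intro!: arg_cong2[where f="(+)"] nn_integral_cong)
  show ?SC
    unfolding points_sum_def past_sum_def compensator_def past_compensator_def
    by (subst integration_by_parts[OF sf(1) sf(2)])
       (use lam in \<open>simp_all add: nn_integral_count_space_past diag\<close>, simp add: mult_ac)
  show ?CC
    unfolding compensator_def past_compensator_def
    by (subst integration_by_parts[OF sf(2) sf(2)])
       (use lam in \<open>simp_all add: diag\<close>, simp add: mult_ac)
qed

lemma expectation_points_sum_mult_compensator:
  assumes [measurable]: "\<psi> \<in> borel_measurable (predictable K)" "\<phi> \<in> borel_measurable (predictable K)"
  shows "(\<integral>\<^sup>+N. points_sum \<psi> N * compensator \<phi> N \<partial>P) =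
      (\<integral>\<^sup>+N. compensator (\<lambda>w. \<psi> w * past_compensator \<phi> w) N \<partial>P) +
      (\<integral>\<^sup>+N. compensator (\<lambda>w. \<phi> w * past_sum \<psi> w) N \<partial>P)"
proof -
  have "(\<integral>\<^sup>+N. points_sum \<psi> N * compensator \<phi> N \<partial>P) =
      (\<integral>\<^sup>+N. points_sum (\<lambda>w. \<psi> w * past_compensator \<phi> w) N + compensator (\<lambda>w. \<phi> w * past_sum \<psi> w) N \<partial>P)"
    by (intro nn_integral_cong points_sum_mult_compensator assms) (simp add: space_P)
  then show ?thesis by (simp add: nn_integral_add expectation_points_sum)
qed

text \<open>
  The martingale isometry \<open>E[(\<integral>\<psi> dM)(\<integral>\<phi> dM)] = E[\<integral>\<psi>\<phi>\<lambda> dt]\<close> for \<open>dM = dN - \<lambda> dt\<close>, with the negative terms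
  moved to the other side so that it holds without any integrability. Each of the four products expands into
  iterated integrals; in expectation \<open>dN\<close> may be replaced by \<open>\<lambda> dt\<close> in the outer integral, and then the
  iterated integrals on the two sides agree. What remains is the diagonal of \<open>dN dN\<close>.
\<close>

lemma isometry_nonneg:
  assumes [measurable]: "\<psi> \<in> borel_measurable (predictable K)" "\<phi> \<in> borel_measurable (predictable K)"
  shows "(\<integral>\<^sup>+N. points_sum \<psi> N * points_sum \<phi> N \<partial>P) + (\<integral>\<^sup>+N. compensator \<psi> N * compensator \<phi> N \<partial>P) =
      (\<integral>\<^sup>+N. compensator (\<lambda>w. \<psi> w * \<phi> w) N \<partial>P) +
      (\<integral>\<^sup>+N. points_sum \<psi> N * compensator \<phi> N \<partial>P) + (\<integral>\<^sup>+N. points_sum \<phi> N * compensator \<psi> N \<partial>P)"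
proof -
  have 1: "(\<integral>\<^sup>+N. points_sum \<psi> N * points_sum \<phi> N \<partial>P) =
      (\<integral>\<^sup>+N. points_sum (\<lambda>w. \<psi> w * past_sum \<phi> w) N + points_sum (\<lambda>w. \<phi> w * past_sum \<psi> w) N
        + points_sum (\<lambda>w. \<psi> w * \<phi> w) N \<partial>P)"
    by (intro nn_integral_cong points_sum_mult_points_sum assms) (simp add: space_P)
  have 2: "(\<integral>\<^sup>+N. compensator \<psi> N * compensator \<phi> N \<partial>P) =
      (\<integral>\<^sup>+N. compensator (\<lambda>w. \<psi> w * past_compensator \<phi> w) N + compensator (\<lambda>w. \<phi> w * past_compensator \<psi> w) N \<partial>P)"
    by (intro nn_integral_cong compensator_mult_compensator assms) (simp add: space_P)
  show ?thesis
    unfolding 1 2 by (simp add: expectation_points_sum_mult_compensator nn_integral_add expectation_points_sum add_ac)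
qed

text \<open>
  Finiteness of the mixed moment allows it to be cancelled from both sides of the isometry.
\<close>

lemma compensated_square_le_aux:
  assumes [measurable]: "\<psi> \<in> borel_measurable (predictable K)"
    and fin: "(\<integral>\<^sup>+N. points_sum \<psi> N * compensator \<psi> N \<partial>P) < \<infinity>"
  shows "(\<integral>\<^sup>+N. (points_sum \<psi> N - compensator \<psi> N)\<^sup>2 \<partial>P) \<le> (\<integral>\<^sup>+N. compensator (\<lambda>w. (\<psi> w)\<^sup>2) N \<partial>P)"
proof -
  let ?c = "\<integral>\<^sup>+N. points_sum \<psi> N * compensator \<psi> N \<partial>P"
  have "(\<integral>\<^sup>+N. (points_sum \<psi> N - compensator \<psi> N)\<^sup>2 \<partial>P) + 2 * ?c =
      (\<integral>\<^sup>+N. (points_sum \<psi> N - compensator \<psi> N)\<^sup>2 + 2 * (points_sum \<psi> N * compensator \<psi> N) \<partial>P)"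
    by (simp add: nn_integral_add nn_integral_cmult)
  also have "\<dots> \<le> (\<integral>\<^sup>+N. (points_sum \<psi> N)\<^sup>2 + (compensator \<psi> N)\<^sup>2 \<partial>P)"
    by (intro nn_integral_mono square_diff_le_ennreal)
  also have "\<dots> = (\<integral>\<^sup>+N. points_sum \<psi> N * points_sum \<psi> N \<partial>P) + (\<integral>\<^sup>+N. compensator \<psi> N * compensator \<psi> N \<partial>P)"
    by (simp add: nn_integral_add power2_eq_square)
  also have "\<dots> = (\<integral>\<^sup>+N. compensator (\<lambda>w. (\<psi> w)\<^sup>2) N \<partial>P) + 2 * ?c"
    by (subst isometry_nonneg) (auto simp: power2_eq_square mult_2 add_ac)
  finally show ?thesis using fin
    by (auto simp: ennreal_mult_eq_top_iff)
qed

text \<open>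
  Only a first moment is assumed. The integrand is stopped as soon as the integral of \<open>\<psi>\<close> so far, against
  \<open>dN\<close> or against \<open>\<lambda> dt\<close>, reaches \<open>n\<close>. For the stopped integrand the mixed moment of the two integrals is at
  most \<open>2 n\<close> times the first moment, hence finite, and may be cancelled in the isometry. As \<open>n\<close> grows the
  stopped integrals increase to the full ones.
\<close>

lemma compensated_square_le:
  assumes [measurable]: "\<psi> \<in> borel_measurable (predictable K)"
    and fin: "(\<integral>\<^sup>+N. compensator \<psi> N \<partial>P) < \<infinity>"
  shows "(\<integral>\<^sup>+N. (points_sum \<psi> N - compensator \<psi> N)\<^sup>2 \<partial>P) \<le> (\<integral>\<^sup>+N. compensator (\<lambda>w. (\<psi> w)\<^sup>2) N \<partial>P)"
proof -
  define A where "A n = {w \<in> space (predictable K). past_sum \<psi> w < of_nat n \<and> past_compensator \<psi> w < of_nat n}" for n :: nat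
  define \<psi>n where "\<psi>n n w = \<psi> w * indicator (A n) w" for n w
  have [measurable]: "A n \<in> sets (predictable K)" for n unfolding A_def by measurable
  have [measurable]: "\<psi>n n \<in> borel_measurable (predictable K)" for n unfolding \<psi>n_def by measurable
  have le: "\<psi>n n w \<le> \<psi> w" for n w by (auto simp: \<psi>n_def split: split_indicator)
  have cut: "\<psi>n n w * past_sum (\<psi>n n) w \<le> of_nat n * \<psi> w" "\<psi>n n w * past_compensator (\<psi>n n) w \<le> of_nat n * \<psi> w" for n w
  proof -
    have "past_sum (\<psi>n n) w \<le> of_nat n" "past_compensator (\<psi>n n) w \<le> of_nat n" if "w \<in> A n"
      using that le past_sum_mono[of "\<psi>n n" \<psi> w] past_compensator_mono[of "\<psi>n n" \<psi> w]
      by (auto simp: A_def intro: order.trans less_imp_le)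
    then show "\<psi>n n w * past_sum (\<psi>n n) w \<le> of_nat n * \<psi> w" "\<psi>n n w * past_compensator (\<psi>n n) w \<le> of_nat n * \<psi> w"
      by (auto simp: \<psi>n_def mult.commute[of "of_nat n"] intro!: mult_left_mono split: split_indicator)
  qed
  have fin_n: "(\<integral>\<^sup>+N. compensator (\<lambda>w. of_nat n * \<psi> w) N \<partial>P) < \<infinity>" for n
  proof -
    have "compensator (\<lambda>w. of_nat n * \<psi> w) N = of_nat n * compensator \<psi> N" if "N \<in> space P" for N
    proof -
      have [measurable]: "(\<lambda>(t, N). ennreal (lam t N)) \<in> borel_measurable (borel \<Otimes>\<^sub>M P)" "\<psi> \<in> borel_measurable (borel \<Otimes>\<^sub>M P)"
        by (auto intro: predictable_jointly_measurable lam_jointly_measurable)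
      have [measurable]: "(\<lambda>t. ennreal (lam t N)) \<in> borel_measurable borel" "(\<lambda>t. \<psi> (t, N)) \<in> borel_measurable borel"
        using measurable_compose[OF measurable_Pair2'[OF that] lam_jointly_measurable] that by auto
      show ?thesis unfolding compensator_def by (subst nn_integral_cmult[symmetric]) (auto simp: mult_ac)
    qed
    then have "(\<integral>\<^sup>+N. compensator (\<lambda>w. of_nat n * \<psi> w) N \<partial>P) = (\<integral>\<^sup>+N. of_nat n * compensator \<psi> N \<partial>P)"
      by (intro nn_integral_cong) auto
    also have "\<dots> < \<infinity>"
      using fin by (simp add: nn_integral_cmult ennreal_mult_less_top of_nat_less_top)
    finally show ?thesis .
  qed
  have bound_n: "(\<integral>\<^sup>+N. (points_sum (\<psi>n n) N - compensator \<psi> N)\<^sup>2 \<partial>P) \<le> (\<integral>\<^sup>+N. compensator (\<lambda>w. (\<psi> w)\<^sup>2) N \<partial>P)" for n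
  proof -
    have "(\<integral>\<^sup>+N. compensator (\<lambda>w. \<psi>n n w * past_compensator (\<psi>n n) w) N \<partial>P) \<le> (\<integral>\<^sup>+N. compensator (\<lambda>w. of_nat n * \<psi> w) N \<partial>P)"
       "(\<integral>\<^sup>+N. compensator (\<lambda>w. \<psi>n n w * past_sum (\<psi>n n) w) N \<partial>P) \<le> (\<integral>\<^sup>+N. compensator (\<lambda>w. of_nat n * \<psi> w) N \<partial>P)"
      by (intro nn_integral_mono compensator_mono cut)+
    then have "(\<integral>\<^sup>+N. points_sum (\<psi>n n) N * compensator (\<psi>n n) N \<partial>P) < \<infinity>"
      using fin_n[of n] by (subst expectation_points_sum_mult_compensator) (auto intro: le_less_trans)
    then have "(\<integral>\<^sup>+N. (points_sum (\<psi>n n) N - compensator (\<psi>n n) N)\<^sup>2 \<partial>P) \<le> (\<integral>\<^sup>+N. compensator (\<lambda>w. (\<psi>n n w)\<^sup>2) N \<partial>P)"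
      by (intro compensated_square_le_aux) auto
    moreover have "(\<integral>\<^sup>+N. (points_sum (\<psi>n n) N - compensator \<psi> N)\<^sup>2 \<partial>P) \<le>
        (\<integral>\<^sup>+N. (points_sum (\<psi>n n) N - compensator (\<psi>n n) N)\<^sup>2 \<partial>P)"
      using le by (intro nn_integral_mono power_mono ennreal_mono_minus compensator_mono) auto
    moreover have "(\<integral>\<^sup>+N. compensator (\<lambda>w. (\<psi>n n w)\<^sup>2) N \<partial>P) \<le> (\<integral>\<^sup>+N. compensator (\<lambda>w. (\<psi> w)\<^sup>2) N \<partial>P)"
      using le by (intro nn_integral_mono compensator_mono power_mono) auto
    ultimately show ?thesis by (meson order.trans)
  qed
  have incA: "A m \<subseteq> A n" if "m \<le> n" for m n
    using that by (auto simp: A_def intro: less_le_trans)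
  have inc\<psi>: "\<psi>n m w \<le> \<psi>n n w" if "m \<le> n" for m n w
    using incA[OF that] by (auto simp: \<psi>n_def split: split_indicator)
  have inc: "incseq (\<lambda>n. points_sum (\<psi>n n) N)" for N
    using inc\<psi> by (auto simp: incseq_def intro!: points_sum_mono)
  have ae: "AE N in P. points_sum \<psi> N \<noteq> \<infinity> \<and> compensator \<psi> N \<noteq> \<infinity>"
  proof -
    have "AE N in P. compensator \<psi> N \<noteq> \<infinity>" "AE N in P. points_sum \<psi> N \<noteq> \<infinity>"
      using fin by (intro nn_integral_PInf_AE; simp add: expectation_points_sum measurable_compensator measurable_points_sum)+
    then show ?thesis by eventually_elim auto
  qed
  have lim: "points_sum \<psi> N = (SUP n. points_sum (\<psi>n n) N)"
    if N: "N \<in> configs K" and finN: "points_sum \<psi> N \<noteq> \<infinity>" "compensator \<psi> N \<noteq> \<infinity>" for N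
  proof -
    have "(SUP n. \<psi>n n (t, N)) = \<psi> (t, N)" for t
    proof (rule antisym)
      have "max (points_sum \<psi> N) (compensator \<psi> N) < \<infinity>" using finN by (auto simp: less_top)
      then obtain n where n: "max (points_sum \<psi> N) (compensator \<psi> N) < of_nat n"
        using ennreal_Ex_less_of_nat[of "max (points_sum \<psi> N) (compensator \<psi> N)"] by auto
      then have "(t, N) \<in> A n" using N past_sum_le[of \<psi> t N] past_compensator_le[of \<psi> t N]
        by (auto simp: A_def intro: le_less_trans)
      then have "\<psi> (t, N) = \<psi>n n (t, N)" by (simp add: \<psi>n_def)
      then show "\<psi> (t, N) \<le> (SUP n. \<psi>n n (t, N))" by (metis SUP_upper UNIV_I)
    qed (auto intro!: SUP_least le)
    then have "points_sum \<psi> N = (\<integral>\<^sup>+t. (SUP n. \<psi>n n (t, N)) \<partial>count_space (N k))" by (simp add: points_sum_def)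
    also have "\<dots> = (SUP n. points_sum (\<psi>n n) N)"
      unfolding points_sum_def using inc\<psi>
      by (intro nn_integral_monotone_convergence_SUP) (auto simp: incseq_def le_fun_def)
    finally show ?thesis .
  qed
  have "AE N in P. (points_sum \<psi> N - compensator \<psi> N)\<^sup>2 = (SUP n. (points_sum (\<psi>n n) N - compensator \<psi> N)\<^sup>2)"
    using ae AE_space
  proof eventually_elim
    case (elim N)
    then have "points_sum \<psi> N - compensator \<psi> N = (SUP n. points_sum (\<psi>n n) N - compensator \<psi> N)"
      using lim[of N] by (simp add: space_P SUP_diff_ennreal less_top)
    also have "\<dots>\<^sup>2 = (SUP n. (points_sum (\<psi>n n) N - compensator \<psi> N)\<^sup>2)"
      using inc[of N] by (intro SUP_power2_ennreal) (auto simp: incseq_def intro!: ennreal_minus_mono)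
    finally show ?case .
  qed
  then have "(\<integral>\<^sup>+N. (points_sum \<psi> N - compensator \<psi> N)\<^sup>2 \<partial>P) =
      (\<integral>\<^sup>+N. (SUP n. (points_sum (\<psi>n n) N - compensator \<psi> N)\<^sup>2) \<partial>P)"
    by (rule nn_integral_cong_AE)
  also have "\<dots> = (SUP n. \<integral>\<^sup>+N. (points_sum (\<psi>n n) N - compensator \<psi> N)\<^sup>2 \<partial>P)"
    using inc by (intro nn_integral_monotone_convergence_SUP)
      (auto simp: incseq_def le_fun_def intro!: power_mono ennreal_minus_mono)
  also have "\<dots> \<le> (\<integral>\<^sup>+N. compensator (\<lambda>w. (\<psi> w)\<^sup>2) N \<partial>P)"
    by (intro SUP_least bound_n)
  finally show ?thesis .
qed

end

section \<open>Moments of the stationary Hawkes process\<close>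

lemma measurable_stationary_shift: "shift r \<in> measurable (config_space K) (config_space K)"
proof (rule measurable_into_history)
  have img: "((+) r ` S) \<inter> {a..b} = (+) r ` (S \<inter> {a - r..b - r})" for S :: "real set" and a b
    by (auto simp: image_iff)
  have img': "((+) r ` S) \<inter> {a<..b} = (+) r ` (S \<inter> {a - r<..b - r})" for S :: "real set" and a b
    by (auto simp: image_iff)
  show "shift r N \<in> configs K" if N: "N \<in> space (config_space K)" for N
  proof -
    have "(+) r ` N l \<inter> (+) r ` N j = {}" if "l < K" "j < K" "l \<noteq> j" for l j
    proof -
      have "N l \<inter> N j = {}" using N that by (simp add: configs_def)
      then show ?thesis by (subst image_Int[symmetric]) auto
    qed
    with N show ?thesis by (auto simp: configs_def shift_def img)
  qed
  fix l a b assume l: "l < K"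
  have "card (shift r N l \<inter> {a<..b}) = card (N l \<inter> {a - r<..b - r})" for N
    unfolding shift_def img' by (rule card_image) simp
  then show "(\<lambda>N. card (shift r N l \<inter> {a<..b})) \<in> measurable (config_space K) (count_space UNIV)"
    using measurable_count_history[OF l, of "a - r" "b - r" UNIV] by simp
qed

lemma lin_intensity_shift: "lin_intensity K A c f t (shift r N) = lin_intensity K A c f (t - r) N"
proof -
  have "((+) r ` S) \<inter> {t - A..<t} = (+) r ` (S \<inter> {t - r - A..<t - r})" for S :: "real set"
    by (auto simp: image_iff)
  then have "(\<Sum>u\<in>shift r N l \<inter> {t - A..<t}. f l (t - u)) = (\<Sum>u\<in>N l \<inter> {t - r - A..<t - r}. f l (t - r - u))" for l
    by (simp add: shift_def sum.reindex algebra_simps)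
  then show ?thesis by (simp add: lin_intensity_def)
qed

definition window_sum :: "real \<Rightarrow> nat \<Rightarrow> (real \<Rightarrow> ennreal) \<Rightarrow> real \<Rightarrow> config \<Rightarrow> ennreal" where
  "window_sum A l \<phi> t N = (\<integral>\<^sup>+s\<in>{t - A..<t}. \<phi> (t - s) \<partial>count_space (N l))"

lemma window_sum_predictable:
  assumes l: "l < K" and [measurable]: "\<phi> \<in> borel_measurable borel"
  shows "(\<lambda>(t, N). window_sum A l \<phi> t N) \<in> borel_measurable (predictable K)"
proof -
  have [measurable]: "{w \<in> space (borel \<Otimes>\<^sub>M predictable K). fst (snd w) - A \<le> fst w} \<in> sets (borel \<Otimes>\<^sub>M predictable K)"
    by measurable
  have "(\<lambda>w. \<phi> (fst (snd w) - fst w) * indicator {w \<in> space (borel \<Otimes>\<^sub>M predictable K). fst (snd w) - A \<le> fst w} w)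
      \<in> borel_measurable (borel \<Otimes>\<^sub>M predictable K)" by measurable
  from past_points_integral_predictable[OF l this] show ?thesis
  proof (rule measurable_cong[THEN iffD1, rotated], safe)
    fix t N assume "(t, N) \<in> space (predictable K)"
    then show "(\<integral>\<^sup>+s. \<phi> (fst (snd (s, (t, N))) - fst (s, (t, N))) *
        indicator {w \<in> space (borel \<Otimes>\<^sub>M predictable K). fst (snd w) - A \<le> fst w} (s, (t, N)) \<partial>count_space (N l \<inter> {..<t}))
      = window_sum A l \<phi> t N"
      unfolding window_sum_def
      by (subst (1 2) nn_integral_count_space_indicator)
         (auto intro!: nn_integral_cong simp: space_pair_measure split: split_indicator)
  qed
qed

lemma window_sum_eq_sum:
  assumes "N \<in> configs K" "l < K" "\<And>x. 0 < x \<Longrightarrow> x \<le> A \<Longrightarrow> 0 \<le> f x"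
  shows "window_sum A l (\<lambda>x. ennreal (f x)) t N = ennreal (\<Sum>u \<in> N l \<inter> {t - A..<t}. f (t - u))"
proof -
  have "window_sum A l (\<lambda>x. ennreal (f x)) t N =
      (\<Sum>u \<in> N l \<inter> {t - A..<t}. ennreal (f (t - u)) * indicator {t - A..<t} u)"
    unfolding window_sum_def using configs_finite(3)[OF assms(1,2)]
    by (intro nn_integral_count_space') (auto split: split_indicator_asm)
  also have "\<dots> = (\<Sum>u \<in> N l \<inter> {t - A..<t}. ennreal (f (t - u)))"
    by (intro sum.cong) auto
  also have "\<dots> = ennreal (\<Sum>u \<in> N l \<inter> {t - A..<t}. f (t - u))"
    using assms(3) by (intro sum_ennreal) auto
  finally show ?thesis .
qed

locale hawkes =
  fixes K :: nat and A :: real and \<nu> :: "nat \<Rightarrow> real" and h :: "nat \<Rightarrow> nat \<Rightarrow> real \<Rightarrow> real"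
    and P :: "config measure"
  assumes A_pos: "0 < A" and parameter: "hawkes_parameter K A \<nu> h" and stationary: "stationary_hawkes K A \<nu> h P"
begin

sublocale prob_space P
  using stationary by (simp add: stationary_hawkes_def)

abbreviation lam :: "nat \<Rightarrow> real \<Rightarrow> config \<Rightarrow> real" where
  "lam k \<equiv> intensity K A \<nu> h k"

abbreviation \<mu> :: "nat \<Rightarrow> real" where
  "\<mu> \<equiv> mean_intensity P"

lemma sets_P: "sets P = sets (config_space K)"
  using stationary by (simp add: stationary_hawkes_def)

lemma space_P: "space P = configs K"
  using sets_eq_imp_space_eq[OF sets_P] by simp

lemma \<nu>_pos: "k < K \<Longrightarrow> 0 < \<nu> k"
  and h_measurable [measurable]: "l < K \<Longrightarrow> k < K \<Longrightarrow> h l k \<in> borel_measurable borel"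
  and h_nonneg: "l < K \<Longrightarrow> k < K \<Longrightarrow> 0 \<le> h l k x"
  and h_bounded: "l < K \<Longrightarrow> k < K \<Longrightarrow> \<exists>B. \<forall>x. h l k x \<le> B"
  using parameter by (auto simp: hawkes_parameter_def)

lemma measurable_P: "f \<in> measurable (config_space K) L \<Longrightarrow> f \<in> measurable P L"
  by (subst measurable_cong_sets[OF sets_P refl])

lemma expectation_shift:
  assumes "f \<in> borel_measurable (config_space K)"
  shows "(\<integral>\<^sup>+N. f (shift r N) \<partial>P) = (\<integral>\<^sup>+N. f N \<partial>P)"
proof -
  have "distr P (config_space K) (shift r) = P"
    using stationary by (simp add: stationary_hawkes_def)
  then have "(\<integral>\<^sup>+N. f N \<partial>P) = (\<integral>\<^sup>+N. f N \<partial>distr P (config_space K) (shift r))" by simp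
  also have "\<dots> = (\<integral>\<^sup>+N. f (shift r N) \<partial>P)"
    using assms by (intro nn_integral_distr measurable_P measurable_stationary_shift) auto
  finally show ?thesis ..
qed

lemma lam_eq_window_sum:
  assumes "N \<in> configs K" "k < K"
  shows "ennreal (lam k t N) = ennreal (\<nu> k) + (\<Sum>l<K. window_sum A l (\<lambda>x. ennreal (h l k x)) t N)"
proof -
  have "(\<Sum>l<K. window_sum A l (\<lambda>x. ennreal (h l k x)) t N) =
      (\<Sum>l<K. ennreal (\<Sum>u \<in> N l \<inter> {t - A..<t}. h l k (t - u)))"
    using assms by (intro sum.cong window_sum_eq_sum) (auto intro: h_nonneg)
  also have "\<dots> = ennreal (\<Sum>l<K. \<Sum>u \<in> N l \<inter> {t - A..<t}. h l k (t - u))"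
    using assms by (intro sum_ennreal sum_nonneg) (auto intro: h_nonneg)
  finally show ?thesis
    using assms \<nu>_pos[of k] unfolding intensity_def lin_intensity_def
    by (subst ennreal_plus) (auto intro!: sum_nonneg h_nonneg)
qed

lemma lam_ge: "k < K \<Longrightarrow> \<nu> k \<le> lam k t N"
  unfolding intensity_def lin_intensity_def by (auto intro!: sum_nonneg h_nonneg)

lemma lam_pos: "k < K \<Longrightarrow> 0 < lam k t N"
  using lam_ge[of k t N] \<nu>_pos[of k] by simp

lemma lam_predictable:
  assumes "k < K"
  shows "(\<lambda>(t, N). ennreal (lam k t N)) \<in> borel_measurable (predictable K)"
proof -
  have "(\<lambda>(t, N). window_sum A l (\<lambda>x. ennreal (h l k x)) t N) \<in> borel_measurable (predictable K)" if "l < K" for l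
    using that assms by (intro window_sum_predictable) auto
  then have "(\<lambda>w. ennreal (\<nu> k) + (\<Sum>l<K. window_sum A l (\<lambda>x. ennreal (h l k x)) (fst w) (snd w))) \<in> borel_measurable (predictable K)"
    by (intro borel_measurable_add borel_measurable_sum borel_measurable_const) (simp add: case_prod_unfold)
  then show ?thesis
    by (rule measurable_cong[THEN iffD1, rotated]) (use assms in \<open>auto simp: lam_eq_window_sum\<close>)
qed

lemma point_process: "k < K \<Longrightarrow> point_process_with_intensity K P k (lam k)"
  using stationary lam_predictable[of k]
  by unfold_locales (auto simp: stationary_hawkes_def)

lemma lam_jointly_measurable [measurable]:
  assumes "k < K"
  shows "(\<lambda>(t, N). ennreal (lam k t N)) \<in> borel_measurable (borel \<Otimes>\<^sub>M P)"
proof -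
  interpret k: point_process_with_intensity K P k "lam k" by (rule point_process[OF assms])
  show ?thesis by (rule k.lam_jointly_measurable)
qed

lemma lam_measurable_config:
  assumes "k < K"
  shows "(\<lambda>N. ennreal (lam k t N)) \<in> borel_measurable (config_space K)"
  using measurable_Pair2[OF predictable_imp_jointly_measurable[OF lam_predictable[OF assms]], of t] by simp

lemma expectation_lam_const:
  assumes "k < K"
  shows "(\<integral>\<^sup>+N. ennreal (lam k t N) \<partial>P) = (\<integral>\<^sup>+N. ennreal (lam k 0 N) \<partial>P)"
  using expectation_shift[OF lam_measurable_config[OF assms, of t], of t]
  by (simp add: intensity_def lin_intensity_shift)

text \<open>
  By stationarity \<open>E[\<lambda>\<^sub>t]\<close> does not depend on \<open>t\<close>, so its integral over \<open>[0,1]\<close>, which is the mean number of points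
  there, is its value.
\<close>

lemma expectation_lam:
  assumes k: "k < K"
  shows "(\<integral>\<^sup>+N. ennreal (lam k t N) \<partial>P) = ennreal (\<mu> k)"
proof -
  interpret k: point_process_with_intensity K P k "lam k" by (rule point_process[OF k])
  let ?c = "\<integral>\<^sup>+N. ennreal (lam k 0 N) \<partial>P"
  define C where "C = (\<lambda>w :: real \<times> config. indicator {0..1} (fst w) :: ennreal)"
  have C: "C \<in> borel_measurable (predictable K)" unfolding C_def by measurable
  have card: "k.points_sum C N = ennreal (real (card (N k \<inter> {0..1})))" if "N \<in> space P" for N
  proof -
    have "k.points_sum C N = (\<Sum>t\<in>N k \<inter> {0..1}. indicator {0..1} t)"
      using configs_finite(1)[of N K k 0 1] that k unfolding k.points_sum_def C_def fst_conv
      by (intro nn_integral_count_space') (auto simp: space_P split: split_indicator_asm)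
    also have "\<dots> = (\<Sum>t\<in>N k \<inter> {0..1}. 1)" by (intro sum.cong) auto
    also have "\<dots> = of_nat (card (N k \<inter> {0..1}))" by simp
    finally show ?thesis by (simp add: ennreal_of_nat_eq_real_of_nat)
  qed
  have m1: "(\<integral>\<^sup>+N. ennreal (real (card (N k \<inter> {0..1}))) \<partial>P) = ?c"
  proof -
    have "(\<integral>\<^sup>+N. ennreal (real (card (N k \<inter> {0..1}))) \<partial>P) = (\<integral>\<^sup>+N. k.points_sum C N \<partial>P)"
      by (intro nn_integral_cong) (simp add: card)
    also have "\<dots> = (\<integral>\<^sup>+N. k.compensator C N \<partial>P)" by (rule k.expectation_points_sum[OF C])
    also have "\<dots> = (\<integral>\<^sup>+N. (\<integral>\<^sup>+t. indicator {0..1} t * ennreal (lam k t N) \<partial>lborel) \<partial>P)"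
      by (simp add: k.compensator_def C_def)
    also have "\<dots> = (\<integral>\<^sup>+t. (\<integral>\<^sup>+N. indicator {0..1} t * ennreal (lam k t N) \<partial>P) \<partial>lborel)"
    proof -
      interpret pair_sigma_finite lborel P by unfold_locales
      show ?thesis using k by (intro Fubini') measurable
    qed
    also have "\<dots> = (\<integral>\<^sup>+t. indicator {0..1} t * (\<integral>\<^sup>+N. ennreal (lam k t N) \<partial>P) \<partial>lborel)"
      using measurable_P[OF lam_measurable_config[OF k]] by (intro nn_integral_cong nn_integral_cmult) auto
    also have "\<dots> = (\<integral>\<^sup>+t. indicator {0..1::real} t * ?c \<partial>lborel)"
      by (intro nn_integral_cong) (metis expectation_lam_const[OF k])
    also have "\<dots> = ?c" by (simp add: nn_integral_multc)
    finally show ?thesis .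
  qed
  have "(\<lambda>N. ennreal (real (card (N k \<inter> {0..1})))) \<in> borel_measurable P"
    using k.measurable_points_sum[OF C] by (rule measurable_cong[THEN iffD1, rotated]) (rule card)
  then have [measurable]: "(\<lambda>N. real (card (N k \<inter> {0..1}))) \<in> borel_measurable P" by simp
  have "?c < \<infinity>"
    using stationary k m1 by (auto simp: stationary_hawkes_def ennreal_of_nat_eq_real_of_nat)
  then have "?c = ennreal (enn2real ?c)" by simp
  also have "enn2real ?c = \<mu> k"
    unfolding mean_intensity_def by (subst integral_eq_nn_integral) (auto simp: m1)
  finally show ?thesis using expectation_lam_const[OF k] by simp
qed

lemma \<mu>_ge:
  assumes "k < K"
  shows "\<nu> k \<le> \<mu> k"
proof -
  have "ennreal (\<nu> k) = (\<integral>\<^sup>+N. ennreal (\<nu> k) \<partial>P)" by (simp add: emeasure_space_1)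
  also have "\<dots> \<le> (\<integral>\<^sup>+N. ennreal (lam k 0 N) \<partial>P)"
    using assms by (intro nn_integral_mono ennreal_leI lam_ge)
  finally have "ennreal (\<nu> k) \<le> ennreal (\<mu> k)" by (simp add: expectation_lam assms)
  then show ?thesis using \<nu>_pos[OF assms] by (simp add: ennreal_le_iff2)
qed

lemma \<mu>_pos: "k < K \<Longrightarrow> 0 < \<mu> k"
  using \<mu>_ge[of k] \<nu>_pos[of k] by simp

definition window_compensator :: "nat \<Rightarrow> (real \<Rightarrow> ennreal) \<Rightarrow> (real \<Rightarrow> config \<Rightarrow> ennreal) \<Rightarrow> real \<Rightarrow> config \<Rightarrow> ennreal" where
  "window_compensator l \<phi> f t N = (\<integral>\<^sup>+s. (\<phi> (t - s) * indicator {t - A..<t} s) * f s N \<partial>lborel)"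

abbreviation window_weight :: "(real \<Rightarrow> ennreal) \<Rightarrow> ennreal" where
  "window_weight \<phi> \<equiv> \<integral>\<^sup>+x\<in>{0<..A}. \<phi> x \<partial>lborel"

lemma window_weight_eq:
  assumes [measurable]: "\<phi> \<in> borel_measurable borel"
  shows "(\<integral>\<^sup>+s. \<phi> (t - s) * indicator {t - A..<t} s \<partial>lborel) = window_weight \<phi>"
proof -
  have "window_weight \<phi> = (\<integral>\<^sup>+s. \<phi> (t + (-1) * s) * indicator {0<..A} (t + (-1) * s) \<partial>lborel)"
    using nn_integral_real_affine[of "\<lambda>x. \<phi> x * indicator {0<..A} x" "-1" t] by simp
  also have "\<dots> = (\<integral>\<^sup>+s. \<phi> (t - s) * indicator {t - A..<t} s \<partial>lborel)"
    by (intro nn_integral_cong) (auto split: split_indicator)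
  finally show ?thesis ..
qed

lemma window_kernel_predictable:
  fixes \<phi> :: "real \<Rightarrow> ennreal"
  assumes [measurable]: "\<phi> \<in> borel_measurable borel"
  shows "(\<lambda>w. \<phi> (t - fst w) * indicator {t - A..<t} (fst w)) \<in> borel_measurable (predictable K)"
proof -
  have "(\<lambda>s. \<phi> (t - s) * indicator {t - A..<t} s) \<in> borel_measurable borel" by measurable
  from measurable_compose[OF measurable_fst_predictable this] show ?thesis .
qed

lemma expectation_window_compensator:
  assumes [measurable]: "\<phi> \<in> borel_measurable borel" "(\<lambda>(s, N). f s N) \<in> borel_measurable (borel \<Otimes>\<^sub>M P)"
    and f: "\<And>s. (\<integral>\<^sup>+N. f s N \<partial>P) \<le> c"
  shows "(\<integral>\<^sup>+N. window_compensator l \<phi> f t N \<partial>P) \<le> window_weight \<phi> * c"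
proof -
  interpret pair_sigma_finite lborel P by unfold_locales
  have "(\<integral>\<^sup>+N. window_compensator l \<phi> f t N \<partial>P) =
      (\<integral>\<^sup>+s. (\<integral>\<^sup>+N. (\<phi> (t - s) * indicator {t - A..<t} s) * f s N \<partial>P) \<partial>lborel)"
    unfolding window_compensator_def by (intro Fubini') measurable
  also have "\<dots> = (\<integral>\<^sup>+s. (\<phi> (t - s) * indicator {t - A..<t} s) * (\<integral>\<^sup>+N. f s N \<partial>P) \<partial>lborel)"
    by (intro nn_integral_cong nn_integral_cmult) measurable
  also have "\<dots> \<le> (\<integral>\<^sup>+s. (\<phi> (t - s) * indicator {t - A..<t} s) * c \<partial>lborel)"
    by (intro nn_integral_mono mult_left_mono f) auto
  also have "\<dots> = window_weight \<phi> * c"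
    by (subst nn_integral_multc) (auto simp: window_weight_eq)
  finally show ?thesis .
qed

lemma window_sum_eq_points_sum:
  assumes "l < K"
  shows "window_sum A l \<phi> t N =
    point_process_with_intensity.points_sum l (\<lambda>w. \<phi> (t - fst w) * indicator {t - A..<t} (fst w)) N"
  unfolding window_sum_def point_process_with_intensity.points_sum_def[OF point_process[OF assms]] by simp

lemma window_compensator_eq_compensator:
  assumes "l < K"
  shows "window_compensator l \<phi> (\<lambda>s N. ennreal (lam l s N)) t N =
    point_process_with_intensity.compensator (lam l) (\<lambda>w. \<phi> (t - fst w) * indicator {t - A..<t} (fst w)) N"
  unfolding window_compensator_def point_process_with_intensity.compensator_def[OF point_process[OF assms]] by simp

lemma expectation_window_sum:
  assumes l: "l < K" and [measurable]: "\<phi> \<in> borel_measurable borel"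
  shows "(\<integral>\<^sup>+N. window_sum A l \<phi> t N \<partial>P) = window_weight \<phi> * ennreal (\<mu> l)"
proof -
  interpret l: point_process_with_intensity K P l "lam l" by (rule point_process[OF l])
  interpret pair_sigma_finite lborel P by unfold_locales
  have "(\<integral>\<^sup>+N. window_sum A l \<phi> t N \<partial>P) = (\<integral>\<^sup>+N. window_compensator l \<phi> (\<lambda>s N. ennreal (lam l s N)) t N \<partial>P)"
    unfolding window_sum_eq_points_sum[OF l] window_compensator_eq_compensator[OF l]
    by (intro l.expectation_points_sum window_kernel_predictable) fact
  also have "\<dots> = (\<integral>\<^sup>+s. (\<integral>\<^sup>+N. (\<phi> (t - s) * indicator {t - A..<t} s) * ennreal (lam l s N) \<partial>P) \<partial>lborel)"
    unfolding window_compensator_def using l by (intro Fubini') measurable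
  also have "\<dots> = (\<integral>\<^sup>+s. (\<phi> (t - s) * indicator {t - A..<t} s) * (\<integral>\<^sup>+N. ennreal (lam l s N) \<partial>P) \<partial>lborel)"
    using measurable_P[OF lam_measurable_config[OF l]] by (intro nn_integral_cong nn_integral_cmult) auto
  also have "\<dots> = (\<integral>\<^sup>+s. (\<phi> (t - s) * indicator {t - A..<t} s) * ennreal (\<mu> l) \<partial>lborel)"
    by (simp add: expectation_lam l)
  also have "\<dots> = window_weight \<phi> * ennreal (\<mu> l)"
    by (subst nn_integral_multc) (auto simp: window_weight_eq)
  finally show ?thesis .
qed

lemma compensated_window_square_le:
  assumes l: "l < K" and [measurable]: "\<phi> \<in> borel_measurable borel" and fin: "window_weight \<phi> < \<infinity>"
  shows "(\<integral>\<^sup>+N. (window_sum A l \<phi> t N - window_compensator l \<phi> (\<lambda>s N. ennreal (lam l s N)) t N)\<^sup>2 \<partial>P)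
    \<le> window_weight (\<lambda>x. (\<phi> x)\<^sup>2) * ennreal (\<mu> l)"
proof -
  interpret l: point_process_with_intensity K P l "lam l" by (rule point_process[OF l])
  let ?\<psi> = "\<lambda>w :: real \<times> config. \<phi> (t - fst w) * indicator {t - A..<t} (fst w)"
  have "(\<integral>\<^sup>+N. l.compensator ?\<psi> N \<partial>P) \<le> window_weight \<phi> * ennreal (\<mu> l)"
    using expectation_window_compensator[of \<phi> "\<lambda>s N. ennreal (lam l s N)" "ennreal (\<mu> l)" l t] l
    by (simp add: window_compensator_eq_compensator[OF l] expectation_lam)
  also have "\<dots> < \<infinity>" using fin by (simp add: ennreal_mult_less_top)
  finally have "(\<integral>\<^sup>+N. (l.points_sum ?\<psi> N - l.compensator ?\<psi> N)\<^sup>2 \<partial>P) \<le> (\<integral>\<^sup>+N. l.compensator (\<lambda>w. (?\<psi> w)\<^sup>2) N \<partial>P)"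
    by (intro l.compensated_square_le window_kernel_predictable) auto
  also have "(\<lambda>w. (?\<psi> w)\<^sup>2) = (\<lambda>w. (\<phi> (t - fst w))\<^sup>2 * indicator {t - A..<t} (fst w))"
    by (auto split: split_indicator simp: fun_eq_iff)
  also have "(\<integral>\<^sup>+N. l.compensator (\<lambda>w. (\<phi> (t - fst w))\<^sup>2 * indicator {t - A..<t} (fst w)) N \<partial>P)
      \<le> window_weight (\<lambda>x. (\<phi> x)\<^sup>2) * ennreal (\<mu> l)"
    using expectation_window_compensator[of "\<lambda>x. (\<phi> x)\<^sup>2" "\<lambda>s N. ennreal (lam l s N)" "ennreal (\<mu> l)" l t] l
    by (simp add: window_compensator_eq_compensator[OF l] expectation_lam)
  finally show ?thesis
    unfolding window_sum_eq_points_sum[OF l] window_compensator_eq_compensator[OF l] .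
qed

abbreviation H :: "nat \<Rightarrow> nat \<Rightarrow> ennreal" where
  "H l k \<equiv> window_weight (\<lambda>x. ennreal (h l k x))"

text \<open>
  The mean intensities form a strictly subinvariant vector of the matrix \<open>H\<close>, since \<open>\<nu>\<close> is positive. This is
  the contraction property behind the second moment bound.
\<close>

lemma \<mu>_equation:
  assumes k: "k < K"
  shows "ennreal (\<mu> k) = ennreal (\<nu> k) + (\<Sum>l<K. H l k * ennreal (\<mu> l))"
proof -
  have "(\<lambda>N. window_sum A l (\<lambda>x. ennreal (h l k x)) 0 N) \<in> borel_measurable P" if "l < K" for l
    using measurable_Pair2[OF predictable_imp_jointly_measurable[OF window_sum_predictable[OF that]], of "\<lambda>x. ennreal (h l k x)" 0 A] k that
    by (intro measurable_P) simp
  then have "(\<integral>\<^sup>+N. ennreal (\<nu> k) + (\<Sum>l<K. window_sum A l (\<lambda>x. ennreal (h l k x)) 0 N) \<partial>P)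
      = ennreal (\<nu> k) + (\<Sum>l<K. \<integral>\<^sup>+N. window_sum A l (\<lambda>x. ennreal (h l k x)) 0 N \<partial>P)"
    using nn_integral_sum[of "{..<K}" "\<lambda>l N. window_sum A l (\<lambda>x. ennreal (h l k x)) 0 N" P]
    by (subst nn_integral_add) (simp_all add: emeasure_space_1)
  also have "\<dots> = ennreal (\<nu> k) + (\<Sum>l<K. H l k * ennreal (\<mu> l))"
    using k by (intro arg_cong2[where f="(+)"] sum.cong expectation_window_sum) auto
  also have "(\<integral>\<^sup>+N. ennreal (\<nu> k) + (\<Sum>l<K. window_sum A l (\<lambda>x. ennreal (h l k x)) 0 N) \<partial>P)
      = (\<integral>\<^sup>+N. ennreal (lam k 0 N) \<partial>P)"
    using k by (intro nn_integral_cong) (simp add: lam_eq_window_sum space_P)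
  finally show ?thesis using expectation_lam[OF k, of 0] by simp
qed

lemma window_bounded_finite:
  assumes "\<And>x. \<phi> x \<le> ennreal B"
  shows "window_weight \<phi> < \<infinity>"
proof -
  have "window_weight \<phi> \<le> (\<integral>\<^sup>+x\<in>{0<..A}. ennreal B \<partial>lborel)"
    by (intro nn_integral_mono mult_right_mono assms) auto
  also have "\<dots> = ennreal B * ennreal A" using A_pos by (simp add: nn_integral_cmult_indicator)
  also have "\<dots> < \<infinity>" by (simp add: ennreal_mult_less_top)
  finally show ?thesis .
qed

lemma H_finite:
  assumes "l < K" "k < K"
  shows "H l k < \<infinity>" "window_weight (\<lambda>x. (ennreal (h l k x))\<^sup>2) < \<infinity>"
proof -
  obtain B where "\<forall>x. h l k x \<le> B" using h_bounded[OF assms] by blast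
  then have *: "ennreal (h l k x) \<le> ennreal B" "(ennreal (h l k x))\<^sup>2 \<le> ennreal (B\<^sup>2)" for x
    using h_nonneg[OF assms, of x] by (auto simp: ennreal_power intro!: ennreal_leI power_mono)
  show "H l k < \<infinity>" by (rule window_bounded_finite[OF *(1)])
  show "window_weight (\<lambda>x. (ennreal (h l k x))\<^sup>2) < \<infinity>" by (rule window_bounded_finite[OF *(2)])
qed


lemma measurable_product_P:
  "f \<in> measurable (borel \<Otimes>\<^sub>M config_space K) L \<Longrightarrow> f \<in> measurable (borel \<Otimes>\<^sub>M P) L"
  by (subst measurable_cong_sets[OF sets_pair_measure_cong[OF refl sets_P] refl])

lemma window_sum_jointly_measurable:
  assumes "l < K" "\<phi> \<in> borel_measurable borel"
  shows "(\<lambda>(t, N). window_sum A l \<phi> t N) \<in> borel_measurable (borel \<Otimes>\<^sub>M P)"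
  by (intro measurable_product_P predictable_imp_jointly_measurable window_sum_predictable assms)

lemma window_sum_measurable [measurable]:
  assumes "l < K" "\<phi> \<in> borel_measurable borel"
  shows "(\<lambda>N. window_sum A l \<phi> t N) \<in> borel_measurable P"
  using measurable_Pair2[OF window_sum_jointly_measurable[OF assms], of t] by simp

lemma window_compensator_jointly_measurable:
  assumes [measurable]: "\<phi> \<in> borel_measurable borel" "(\<lambda>(s, N). f s N) \<in> borel_measurable (borel \<Otimes>\<^sub>M P)"
  shows "(\<lambda>(t, N). window_compensator l \<phi> f t N) \<in> borel_measurable (borel \<Otimes>\<^sub>M P)"
proof -
  have ind: "(indicator {t - A..<t} s :: ennreal) = (if t - A \<le> s \<and> s < t then 1 else 0)" for t s
    by auto
  have "(\<lambda>w. \<integral>\<^sup>+s. (\<phi> (fst w - s) * (if fst w - A \<le> s \<and> s < fst w then 1 else 0)) * f s (snd w) \<partial>lborel)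
      \<in> borel_measurable (borel \<Otimes>\<^sub>M P)" by measurable
  then show ?thesis by (simp add: window_compensator_def ind case_prod_unfold)
qed

lemma window_compensator_measurable:
  assumes "\<phi> \<in> borel_measurable borel" "(\<lambda>(s, N). f s N) \<in> borel_measurable (borel \<Otimes>\<^sub>M P)"
  shows "(\<lambda>N. window_compensator l \<phi> f t N) \<in> borel_measurable P"
  using measurable_Pair2[OF window_compensator_jointly_measurable[OF assms], of t] by simp

lemma window_compensator_L2:
  assumes [measurable]: "\<phi> \<in> borel_measurable borel" "(\<lambda>(s, N). f s N) \<in> borel_measurable (borel \<Otimes>\<^sub>M P)"
    and f: "\<And>s. (\<integral>\<^sup>+N. (f s N)\<^sup>2 \<partial>P) \<le> b\<^sup>2"
  shows "(\<integral>\<^sup>+N. (window_compensator l \<phi> f t N)\<^sup>2 \<partial>P) \<le> (window_weight \<phi> * b)\<^sup>2"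
proof -
  have "(\<integral>\<^sup>+N. (window_compensator l \<phi> f t N)\<^sup>2 \<partial>P) \<le>
      ((\<integral>\<^sup>+s. \<phi> (t - s) * indicator {t - A..<t} s \<partial>lborel) * b)\<^sup>2"
    unfolding window_compensator_def
  proof (rule L2_bound_average)
    show "sigma_finite_measure lborel" "sigma_finite_measure P" by unfold_locales
  qed (use f in measurable)
  then show ?thesis by (simp add: window_weight_eq)
qed

text \<open>
  The intensity satisfies \<open>\<lambda> \<le> innovation + smoothing \<lambda>\<close>: the points are replaced by their compensator at the
  cost of a compensated integral. Unrolling this \<open>m\<close> times bounds \<open>\<lambda>\<close> by \<open>majorant m + remainder m\<close>. The
  majorants are bounded in mean square uniformly in \<open>m\<close>, and the remainders tend to \<open>0\<close> in mean.
\<close>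

definition smoothing :: "(nat \<Rightarrow> real \<Rightarrow> config \<Rightarrow> ennreal) \<Rightarrow> nat \<Rightarrow> real \<Rightarrow> config \<Rightarrow> ennreal" where
  "smoothing f k t N = (\<Sum>l<K. window_compensator l (\<lambda>x. ennreal (h l k x)) (f l) t N)"

definition innovation :: "nat \<Rightarrow> real \<Rightarrow> config \<Rightarrow> ennreal" where
  "innovation k t N = ennreal (\<nu> k) + (\<Sum>l<K. window_sum A l (\<lambda>x. ennreal (h l k x)) t N -
     window_compensator l (\<lambda>x. ennreal (h l k x)) (\<lambda>s N. ennreal (lam l s N)) t N)"

primrec majorant :: "nat \<Rightarrow> nat \<Rightarrow> real \<Rightarrow> config \<Rightarrow> ennreal" where
  "majorant 0 = (\<lambda>k t N. 0)"
| "majorant (Suc m) = (\<lambda>k t N. innovation k t N + smoothing (majorant m) k t N)"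

primrec remainder :: "nat \<Rightarrow> nat \<Rightarrow> real \<Rightarrow> config \<Rightarrow> ennreal" where
  "remainder 0 = (\<lambda>k t N. ennreal (lam k t N))"
| "remainder (Suc m) = smoothing (remainder m)"

lemma smoothing_measurable:
  assumes "k < K" "\<And>l. l < K \<Longrightarrow> (\<lambda>(t, N). f l t N) \<in> borel_measurable (borel \<Otimes>\<^sub>M P)"
  shows "(\<lambda>(t, N). smoothing f k t N) \<in> borel_measurable (borel \<Otimes>\<^sub>M P)"
proof -
  have "(\<lambda>w. \<Sum>l<K. window_compensator l (\<lambda>x. ennreal (h l k x)) (f l) (fst w) (snd w)) \<in> borel_measurable (borel \<Otimes>\<^sub>M P)"
  proof (intro borel_measurable_sum)
    fix l assume "l \<in> {..<K}"
    then have "(\<lambda>(t, N). window_compensator l (\<lambda>x. ennreal (h l k x)) (f l) t N) \<in> borel_measurable (borel \<Otimes>\<^sub>M P)"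
      using assms by (intro window_compensator_jointly_measurable) auto
    then show "(\<lambda>w. window_compensator l (\<lambda>x. ennreal (h l k x)) (f l) (fst w) (snd w)) \<in> borel_measurable (borel \<Otimes>\<^sub>M P)"
      by (simp add: case_prod_unfold)
  qed
  then show ?thesis by (simp add: smoothing_def case_prod_unfold)
qed

lemma innovation_measurable:
  assumes "k < K"
  shows "(\<lambda>(t, N). innovation k t N) \<in> borel_measurable (borel \<Otimes>\<^sub>M P)"
proof -
  have "(\<lambda>w. ennreal (\<nu> k) + (\<Sum>l<K. window_sum A l (\<lambda>x. ennreal (h l k x)) (fst w) (snd w) -
     window_compensator l (\<lambda>x. ennreal (h l k x)) (\<lambda>s N. ennreal (lam l s N)) (fst w) (snd w))) \<in> borel_measurable (borel \<Otimes>\<^sub>M P)"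
  proof (intro borel_measurable_sum borel_measurable_add borel_measurable_const borel_measurable_minus_ennreal)
    fix l assume l: "l \<in> {..<K}"
    then have "(\<lambda>(t, N). window_compensator l (\<lambda>x. ennreal (h l k x)) (\<lambda>s N. ennreal (lam l s N)) t N) \<in> borel_measurable (borel \<Otimes>\<^sub>M P)"
      using assms by (intro window_compensator_jointly_measurable lam_jointly_measurable) auto
    then show "(\<lambda>w. window_compensator l (\<lambda>x. ennreal (h l k x)) (\<lambda>s N. ennreal (lam l s N)) (fst w) (snd w)) \<in> borel_measurable (borel \<Otimes>\<^sub>M P)"
      by (simp add: case_prod_unfold)
    have "(\<lambda>(t, N). window_sum A l (\<lambda>x. ennreal (h l k x)) t N) \<in> borel_measurable (borel \<Otimes>\<^sub>M P)"
      using assms l by (intro window_sum_jointly_measurable) auto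
    then show "(\<lambda>w. window_sum A l (\<lambda>x. ennreal (h l k x)) (fst w) (snd w)) \<in> borel_measurable (borel \<Otimes>\<^sub>M P)"
      by (simp add: case_prod_unfold)
  qed
  then show ?thesis by (simp add: innovation_def case_prod_unfold)
qed

lemma majorant_measurable:
  "k < K \<Longrightarrow> (\<lambda>(t, N). majorant m k t N) \<in> borel_measurable (borel \<Otimes>\<^sub>M P)"
proof (induction m arbitrary: k)
  case (Suc m)
  have "(\<lambda>(t, N). smoothing (majorant m) k t N) \<in> borel_measurable (borel \<Otimes>\<^sub>M P)"
    using Suc by (intro smoothing_measurable) auto
  with innovation_measurable[OF Suc.prems] show ?case
    by (simp add: case_prod_unfold)
qed simp

lemma remainder_measurable:
  "k < K \<Longrightarrow> (\<lambda>(t, N). remainder m k t N) \<in> borel_measurable (borel \<Otimes>\<^sub>M P)"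
  by (induction m arbitrary: k) (auto intro: smoothing_measurable lam_jointly_measurable)

lemma measurable_at_time:
  "(\<lambda>(t, N). f t N) \<in> measurable (borel \<Otimes>\<^sub>M P) L \<Longrightarrow> (\<lambda>N. f t N) \<in> measurable P L"
  using measurable_Pair2[of "\<lambda>(t, N). f t N" borel P L t] by simp

lemma measurable_at_config:
  "(\<lambda>(t, N). f t N) \<in> borel_measurable (borel \<Otimes>\<^sub>M P) \<Longrightarrow> N \<in> space P \<Longrightarrow> (\<lambda>t. f t N) \<in> borel_measurable borel"
  using measurable_Pair1[of "\<lambda>(t, N). f t N" borel P borel N] by simp

lemma lam_le_majorant_plus_remainder:
  assumes "k < K" and N: "N \<in> configs K"
  shows "ennreal (lam k t N) \<le> majorant m k t N + remainder m k t N"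
  using assms(1)
proof (induction m arbitrary: k t)
  case (Suc m)
  let ?\<phi> = "\<lambda>l x. ennreal (h l k x)"
  have N': "N \<in> space P" using N by (simp add: space_P)
  have "ennreal (lam k t N) = ennreal (\<nu> k) + (\<Sum>l<K. window_sum A l (?\<phi> l) t N)"
    by (rule lam_eq_window_sum) fact+
  also have "\<dots> \<le> ennreal (\<nu> k) + (\<Sum>l<K. (window_sum A l (?\<phi> l) t N -
      window_compensator l (?\<phi> l) (\<lambda>s N. ennreal (lam l s N)) t N) +
      window_compensator l (?\<phi> l) (\<lambda>s N. ennreal (lam l s N)) t N)"
    by (intro add_left_mono sum_mono le_diff_add_ennreal)
  also have "\<dots> = innovation k t N + (\<Sum>l<K. window_compensator l (?\<phi> l) (\<lambda>s N. ennreal (lam l s N)) t N)"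
    by (simp add: innovation_def sum.distrib add.assoc)
  also have "\<dots> \<le> innovation k t N + (\<Sum>l<K. window_compensator l (?\<phi> l) (majorant m l) t N
      + window_compensator l (?\<phi> l) (remainder m l) t N)"
  proof (intro add_left_mono sum_mono)
    fix l assume "l \<in> {..<K}"
    then have l: "l < K" by simp
    have [measurable]: "(\<lambda>s. majorant m l s N) \<in> borel_measurable borel" "(\<lambda>s. remainder m l s N) \<in> borel_measurable borel"
      "h l k \<in> borel_measurable borel"
      using l N' Suc.prems by (auto intro: measurable_at_config majorant_measurable remainder_measurable)
    have "window_compensator l (?\<phi> l) (\<lambda>s N. ennreal (lam l s N)) t N \<le>
        (\<integral>\<^sup>+s. (?\<phi> l (t - s) * indicator {t - A..<t} s) * majorant m l s N
          + (?\<phi> l (t - s) * indicator {t - A..<t} s) * remainder m l s N \<partial>lborel)"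
      unfolding window_compensator_def distrib_left[symmetric]
      using Suc.IH[OF l] by (intro nn_integral_mono mult_left_mono) auto
    also have "\<dots> = window_compensator l (?\<phi> l) (majorant m l) t N + window_compensator l (?\<phi> l) (remainder m l) t N"
      unfolding window_compensator_def by (rule nn_integral_add) measurable
    finally show "window_compensator l (?\<phi> l) (\<lambda>s N. ennreal (lam l s N)) t N \<le> \<dots>" .
  qed
  also have "\<dots> = majorant (Suc m) k t N + remainder (Suc m) k t N"
    by (simp add: smoothing_def sum.distrib add.assoc)
  finally show ?case .
qed simp

text \<open>
  The compensated window integrals have mean square at most \<open>\<mu>\<^sub>l \<integral> h\<^sub>l\<^sub>k\<^sup>2\<close>, which is finite since the kernels are
  bounded.
\<close>

lemma innovation_L2_bounded:
  obtains w :: real where "0 < w" "\<And>k t. k < K \<Longrightarrow> (\<integral>\<^sup>+N. (innovation k t N)\<^sup>2 \<partial>P) \<le> (ennreal w)\<^sup>2"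
proof -
  define \<beta> where "\<beta> l k = enn2real (window_weight (\<lambda>x. (ennreal (h l k x))\<^sup>2) * ennreal (\<mu> l)) + 1" for l k
  have \<beta>: "0 < \<beta> l k" for l k by (simp add: \<beta>_def add_nonneg_pos)
  define w where "w = 1 + (\<Sum>k<K. \<nu> k + (\<Sum>l<K. \<beta> l k))"
  have "0 < w"
    unfolding w_def by (intro add_pos_nonneg sum_nonneg add_nonneg_nonneg) (auto intro: less_imp_le \<nu>_pos \<beta>)
  moreover have "(\<integral>\<^sup>+N. (innovation k t N)\<^sup>2 \<partial>P) \<le> (ennreal w)\<^sup>2" if k: "k < K" for k t
  proof -
    let ?D = "\<lambda>l N. window_sum A l (\<lambda>x. ennreal (h l k x)) t N -
       window_compensator l (\<lambda>x. ennreal (h l k x)) (\<lambda>s N. ennreal (lam l s N)) t N"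
    have meas: "?D l \<in> borel_measurable P" if "l < K" for l
      using k that by (intro borel_measurable_minus_ennreal window_sum_measurable window_compensator_measurable lam_jointly_measurable) auto
    have D: "(\<integral>\<^sup>+N. (?D l N)\<^sup>2 \<partial>P) \<le> (ennreal (\<beta> l k))\<^sup>2" if l: "l < K" for l
    proof -
      let ?c = "window_weight (\<lambda>x. (ennreal (h l k x))\<^sup>2) * ennreal (\<mu> l)"
      have "(\<integral>\<^sup>+N. (?D l N)\<^sup>2 \<partial>P) \<le> ?c"
        using k l by (intro compensated_window_square_le H_finite) auto
      also have "?c = ennreal (enn2real ?c)"
        using H_finite(2)[OF l k] by (simp add: ennreal_mult_less_top)
      also have "\<dots> \<le> ennreal ((\<beta> l k)\<^sup>2)"
        by (intro ennreal_leI) (simp add: \<beta>_def power2_eq_square algebra_simps)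
      finally show ?thesis using \<beta>[of l k] by (simp add: ennreal_power less_imp_le)
    qed
    have "(\<integral>\<^sup>+N. (innovation k t N)\<^sup>2 \<partial>P) \<le> (ennreal (\<nu> k) + (\<Sum>l<K. ennreal (\<beta> l k)))\<^sup>2"
      unfolding innovation_def
      by (intro L2_bound_add L2_bound_sum) (auto simp: emeasure_space_1 intro!: D meas borel_measurable_sum)
    also have "ennreal (\<nu> k) + (\<Sum>l<K. ennreal (\<beta> l k)) = ennreal (\<nu> k + (\<Sum>l<K. \<beta> l k))"
      using \<nu>_pos[OF k] \<beta> by (simp add: sum_ennreal less_imp_le sum_nonneg)
    also have "\<dots> \<le> ennreal w"
    proof (rule ennreal_leI)
      have "\<nu> k + (\<Sum>l<K. \<beta> l k) \<le> (\<Sum>k<K. \<nu> k + (\<Sum>l<K. \<beta> l k))"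
        using k \<nu>_pos \<beta> by (intro member_le_sum) (auto intro!: add_nonneg_nonneg sum_nonneg simp: less_imp_le)
      then show "\<nu> k + (\<Sum>l<K. \<beta> l k) \<le> w" by (simp add: w_def)
    qed
    finally show ?thesis by (simp add: power_mono)
  qed
  ultimately show thesis by (rule that)
qed

text \<open>
  If the innovations have norm at most \<open>w \<le> B \<nu>\<^sub>k\<close>, then the bound \<open>B \<mu>\<^sub>k\<close> propagates from \<open>m\<close> to \<open>m + 1\<close>, because
  \<open>B \<nu>\<^sub>k + \<Sum>\<^sub>l H\<^sub>l\<^sub>k B \<mu>\<^sub>l = B \<mu>\<^sub>k\<close>.
\<close>

lemma majorant_L2_bounded:
  obtains B :: ennreal where "B < \<infinity>" "\<And>m k t. k < K \<Longrightarrow> (\<integral>\<^sup>+N. (majorant m k t N)\<^sup>2 \<partial>P) \<le> (B * ennreal (\<mu> k))\<^sup>2"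
proof -
  obtain w where w: "0 < w" "\<And>k t. k < K \<Longrightarrow> (\<integral>\<^sup>+N. (innovation k t N)\<^sup>2 \<partial>P) \<le> (ennreal w)\<^sup>2"
    by (rule innovation_L2_bounded) blast
  define B where "B = (\<Sum>k<K. w / \<nu> k)"
  have B0: "0 \<le> B" unfolding B_def using w \<nu>_pos by (auto intro!: sum_nonneg divide_nonneg_nonneg simp: less_imp_le)
  have B: "w \<le> B * \<nu> k" if "k < K" for k
  proof -
    have "w / \<nu> k \<le> B" unfolding B_def using that w \<nu>_pos
      by (intro member_le_sum) (auto intro!: divide_nonneg_nonneg simp: less_imp_le)
    then show ?thesis using \<nu>_pos[OF that] by (simp add: divide_le_eq)
  qed
  have "(\<integral>\<^sup>+N. (majorant m k t N)\<^sup>2 \<partial>P) \<le> (ennreal B * ennreal (\<mu> k))\<^sup>2" if "k < K" for m k t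
    using that
  proof (induction m arbitrary: k t)
    case (Suc m)
    have "(\<integral>\<^sup>+N. (majorant (Suc m) k t N)\<^sup>2 \<partial>P) \<le> (ennreal w + (\<Sum>l<K. H l k * (ennreal B * ennreal (\<mu> l))))\<^sup>2"
      unfolding majorant.simps smoothing_def using Suc
      by (intro L2_bound_add L2_bound_sum w window_compensator_L2 window_compensator_measurable measurable_at_time
          innovation_measurable majorant_measurable borel_measurable_sum) auto
    also have "ennreal w + (\<Sum>l<K. H l k * (ennreal B * ennreal (\<mu> l))) \<le> ennreal B * ennreal (\<nu> k) + ennreal B * (\<Sum>l<K. H l k * ennreal (\<mu> l))"
    proof (intro add_mono)
      show "ennreal w \<le> ennreal B * ennreal (\<nu> k)"
        using B[OF Suc.prems] \<nu>_pos[OF Suc.prems] B0 by (simp add: ennreal_mult[symmetric] ennreal_leI)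
    qed (simp add: sum_distrib_left mult_ac)
    also have "\<dots> = ennreal B * ennreal (\<mu> k)"
      by (simp add: \<mu>_equation[OF Suc.prems] distrib_left)
    finally show ?case by (simp add: power_mono)
  qed simp
  then show thesis by (intro that[of "ennreal B"]) auto
qed

text \<open>
  The mean of \<open>remainder m\<close> is the vector \<open>\<mu>\<close> after \<open>m\<close> applications of \<open>H\<close>, and each application shrinks it by
  a factor \<open>r < 1\<close> for which \<open>\<mu>\<^sub>k - \<nu>\<^sub>k \<le> r \<mu>\<^sub>k\<close>.
\<close>

lemma remainder_expectation:
  obtains r :: real where "0 \<le> r" "r < 1" "\<And>m k t. k < K \<Longrightarrow> (\<integral>\<^sup>+N. remainder m k t N \<partial>P) \<le> ennreal (r ^ m * \<mu> k)"
proof -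
  define S where "S = (\<Sum>k<K. \<mu> k / \<nu> k)"
  have S0: "0 \<le> S" unfolding S_def using \<mu>_pos \<nu>_pos by (auto intro!: sum_nonneg divide_nonneg_nonneg simp: less_imp_le)
  define r where "r = 1 - 1 / (1 + S)"
  have r: "0 \<le> r" "r < 1" using S0 by (auto simp: r_def)
  have \<mu>r: "\<mu> k - \<nu> k \<le> r * \<mu> k" if "k < K" for k
  proof -
    have "\<mu> k / \<nu> k \<le> S" unfolding S_def using that \<mu>_pos \<nu>_pos
      by (intro member_le_sum) (auto intro!: divide_nonneg_nonneg simp: less_imp_le)
    then have "\<mu> k \<le> (1 + S) * \<nu> k" using \<nu>_pos[OF that] by (simp add: field_simps)
    then have "\<mu> k / (1 + S) \<le> \<nu> k" using S0 by (simp add: field_simps)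
    then show ?thesis by (simp add: r_def algebra_simps)
  qed
  have Hr: "(\<Sum>l<K. H l k * ennreal (\<mu> l)) \<le> ennreal (r * \<mu> k)" if k: "k < K" for k
  proof -
    have "ennreal (\<nu> k) + (\<Sum>l<K. H l k * ennreal (\<mu> l)) = ennreal (\<nu> k) + ennreal (\<mu> k - \<nu> k)"
      using \<mu>_equation[OF k] \<nu>_pos[OF k] \<mu>_ge[OF k] by (simp add: ennreal_plus[symmetric] del: ennreal_plus)
    then have "(\<Sum>l<K. H l k * ennreal (\<mu> l)) = ennreal (\<mu> k - \<nu> k)"
      by (simp add: ennreal_add_left_cancel)
    also have "\<dots> \<le> ennreal (r * \<mu> k)" by (intro ennreal_leI \<mu>r k)
    finally show ?thesis .
  qed
  have "(\<integral>\<^sup>+N. remainder m k t N \<partial>P) \<le> ennreal (r ^ m * \<mu> k)" if "k < K" for m k t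
    using that
  proof (induction m arbitrary: k t)
    case 0
    then show ?case by (simp add: expectation_lam)
  next
    case (Suc m)
    have "(\<integral>\<^sup>+N. remainder (Suc m) k t N \<partial>P) =
        (\<Sum>l<K. \<integral>\<^sup>+N. window_compensator l (\<lambda>x. ennreal (h l k x)) (remainder m l) t N \<partial>P)"
      unfolding remainder.simps smoothing_def using Suc.prems
      by (intro nn_integral_sum window_compensator_measurable remainder_measurable) auto
    also have "\<dots> \<le> (\<Sum>l<K. H l k * ennreal (r ^ m * \<mu> l))"
      using Suc by (intro sum_mono expectation_window_compensator remainder_measurable) auto
    also have "\<dots> = ennreal (r ^ m) * (\<Sum>l<K. H l k * ennreal (\<mu> l))"
      unfolding sum_distrib_left using r by (intro sum.cong refl) (simp add: ennreal_mult' mult.left_commute)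
    also have "\<dots> \<le> ennreal (r ^ m) * ennreal (r * \<mu> k)"
      by (intro mult_left_mono Hr Suc.prems) auto
    also have "\<dots> = ennreal (r ^ Suc m * \<mu> k)"
      using r by (simp add: ennreal_mult'[symmetric] mult_ac)
    finally show ?case .
  qed
  with r show thesis by (intro that[of r]) auto
qed

text \<open>
  Mean square control of the majorants and control in mean of the remainders are combined by truncating \<open>\<lambda>\<close>
  at a level \<open>n\<close>: first \<open>m\<close> tends to infinity and removes the remainder, then \<open>n\<close> removes the truncation.
\<close>

lemma lam_second_moment:
  obtains \<Lambda> :: ennreal where "\<Lambda> < \<infinity>" "\<And>k t. k < K \<Longrightarrow> (\<integral>\<^sup>+N. (ennreal (lam k t N))\<^sup>2 \<partial>P) \<le> \<Lambda>"
proof -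
  obtain B where B: "B < \<infinity>" "\<And>m k t. k < K \<Longrightarrow> (\<integral>\<^sup>+N. (majorant m k t N)\<^sup>2 \<partial>P) \<le> (B * ennreal (\<mu> k))\<^sup>2"
    by (rule majorant_L2_bounded) blast
  obtain r where r: "0 \<le> r" "r < 1" "\<And>m k t. k < K \<Longrightarrow> (\<integral>\<^sup>+N. remainder m k t N \<partial>P) \<le> ennreal (r ^ m * \<mu> k)"
    by (rule remainder_expectation) blast
  have bound: "(\<integral>\<^sup>+N. (ennreal (lam k t N))\<^sup>2 \<partial>P) \<le> 2 * (B * ennreal (\<mu> k))\<^sup>2" if k: "k < K" for k t
  proof -
    have [measurable]: "(\<lambda>N. ennreal (lam k t N)) \<in> borel_measurable P"
      by (intro measurable_at_time lam_jointly_measurable k)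
    have trunc: "(\<integral>\<^sup>+N. (min (ennreal (lam k t N)) (of_nat n))\<^sup>2 \<partial>P) \<le> 2 * (B * ennreal (\<mu> k))\<^sup>2" for n :: nat
    proof -
      have "(\<integral>\<^sup>+N. (min (ennreal (lam k t N)) (of_nat n))\<^sup>2 \<partial>P) \<le> 2 * (B * ennreal (\<mu> k))\<^sup>2 + ennreal (2 * real n * (r ^ m * \<mu> k))" for m
      proof -
        have [measurable]: "(\<lambda>N. majorant m k t N) \<in> borel_measurable P" "(\<lambda>N. remainder m k t N) \<in> borel_measurable P"
          using k by (auto intro: measurable_at_time majorant_measurable remainder_measurable)
        have "(\<integral>\<^sup>+N. (min (ennreal (lam k t N)) (of_nat n))\<^sup>2 \<partial>P) \<le>
            (\<integral>\<^sup>+N. 2 * (majorant m k t N)\<^sup>2 + 2 * of_nat n * remainder m k t N \<partial>P)"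
        proof (rule nn_integral_mono)
          fix N assume "N \<in> space P"
          then have "ennreal (lam k t N) \<le> majorant m k t N + remainder m k t N"
            using k by (intro lam_le_majorant_plus_remainder) (auto simp: space_P)
          then have "min (ennreal (lam k t N)) (of_nat n) \<le> majorant m k t N + min (remainder m k t N) (of_nat n)"
            by (smt (verit) add_increasing dual_order.trans min.cobounded1 min.cobounded2 min_def zero_le)
          then have "(min (ennreal (lam k t N)) (of_nat n))\<^sup>2 \<le> (majorant m k t N + min (remainder m k t N) (of_nat n))\<^sup>2"
            by (intro power_mono) auto
          also have "\<dots> \<le> 2 * (majorant m k t N)\<^sup>2 + 2 * (min (remainder m k t N) (of_nat n))\<^sup>2"
            by (rule square_add_le_ennreal)
          \<comment> \<open>Truncation makes the square of the remainder linear in it.\<close>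
          also have "(min (remainder m k t N) (of_nat n))\<^sup>2 \<le> of_nat n * remainder m k t N"
            unfolding power2_eq_square by (intro mult_mono) auto
          finally show "(min (ennreal (lam k t N)) (of_nat n))\<^sup>2 \<le> 2 * (majorant m k t N)\<^sup>2 + 2 * of_nat n * remainder m k t N"
            by (simp add: add_left_mono mult_left_mono mult.assoc)
        qed
        also have "\<dots> = 2 * (\<integral>\<^sup>+N. (majorant m k t N)\<^sup>2 \<partial>P) + 2 * of_nat n * (\<integral>\<^sup>+N. remainder m k t N \<partial>P)"
          by (simp add: nn_integral_add nn_integral_cmult)
        also have "\<dots> \<le> 2 * (B * ennreal (\<mu> k))\<^sup>2 + 2 * of_nat n * ennreal (r ^ m * \<mu> k)"
          using k by (intro add_mono mult_left_mono B r) auto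
        also have "2 * of_nat n * ennreal (r ^ m * \<mu> k) = ennreal (2 * real n * (r ^ m * \<mu> k))"
          by (simp add: ennreal_mult' ennreal_of_nat_eq_real_of_nat)
        finally show ?thesis .
      qed
      moreover have "(\<lambda>m. 2 * (B * ennreal (\<mu> k))\<^sup>2 + ennreal (2 * real n * (r ^ m * \<mu> k))) \<longlonglongrightarrow> 2 * (B * ennreal (\<mu> k))\<^sup>2 + ennreal (2 * real n * (0 * \<mu> k))"
        using r by (intro tendsto_intros tendsto_ennrealI LIMSEQ_realpow_zero) auto
      ultimately show ?thesis by (intro LIMSEQ_le_const) auto
    qed
    have "(\<integral>\<^sup>+N. (ennreal (lam k t N))\<^sup>2 \<partial>P) = (\<integral>\<^sup>+N. (SUP n::nat. (min (ennreal (lam k t N)) (of_nat n))\<^sup>2) \<partial>P)"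
      by (simp only: SUP_min_of_nat_power2)
    also have "\<dots> = (SUP n::nat. \<integral>\<^sup>+N. (min (ennreal (lam k t N)) (of_nat n))\<^sup>2 \<partial>P)"
      by (intro nn_integral_monotone_convergence_SUP)
         (auto simp: incseq_def le_fun_def intro!: power_mono min.mono)
    also have "\<dots> \<le> 2 * (B * ennreal (\<mu> k))\<^sup>2" by (intro SUP_least trunc)
    finally show ?thesis .
  qed
  show thesis
  proof (rule that)
    show "(\<Sum>k<K. 2 * (B * ennreal (\<mu> k))\<^sup>2) < \<infinity>"
      using B by (auto simp: ennreal_mult_less_top power2_eq_square)
    fix k t assume k: "k < K"
    have "(\<integral>\<^sup>+N. (ennreal (lam k t N))\<^sup>2 \<partial>P) \<le> 2 * (B * ennreal (\<mu> k))\<^sup>2" by (rule bound[OF k])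
    also have "\<dots> \<le> (\<Sum>k<K. 2 * (B * ennreal (\<mu> k))\<^sup>2)"
      using k by (intro member_le_sum) auto
    finally show "(\<integral>\<^sup>+N. (ennreal (lam k t N))\<^sup>2 \<partial>P) \<le> (\<Sum>k<K. 2 * (B * ennreal (\<mu> k))\<^sup>2)" .
  qed
qed

text \<open>
  The window integral is at most its compensated part plus its compensator. The former has mean square at most
  \<open>\<mu>\<^sub>l \<integral> \<phi>\<^sup>2\<close>; for the latter the Cauchy--Schwarz inequality separates \<open>\<integral> \<phi>\<^sup>2\<close> from the second moment of \<open>\<lambda>\<close>.
\<close>

lemma window_sum_L2:
  obtains C :: ennreal where "C < \<infinity>"
    "\<And>l \<phi> t. l < K \<Longrightarrow> \<phi> \<in> borel_measurable borel \<Longrightarrow> window_weight (\<lambda>x. (\<phi> x)\<^sup>2) < \<infinity> \<Longrightarrow>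
       (\<integral>\<^sup>+N. (window_sum A l \<phi> t N)\<^sup>2 \<partial>P) \<le> C * window_weight (\<lambda>x. (\<phi> x)\<^sup>2)"
proof -
  obtain \<Lambda> where \<Lambda>: "\<Lambda> < \<infinity>" "\<And>k t. k < K \<Longrightarrow> (\<integral>\<^sup>+N. (ennreal (lam k t N))\<^sup>2 \<partial>P) \<le> \<Lambda>"
    by (rule lam_second_moment) blast
  define C where "C = 2 * (\<Sum>l<K. ennreal (\<mu> l)) + 2 * (ennreal A * \<Lambda>)"
  have "C < \<infinity>" using \<Lambda> by (auto simp: C_def ennreal_mult_less_top)
  moreover have "(\<integral>\<^sup>+N. (window_sum A l \<phi> t N)\<^sup>2 \<partial>P) \<le> C * window_weight (\<lambda>x. (\<phi> x)\<^sup>2)"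
    if l: "l < K" and [measurable]: "\<phi> \<in> borel_measurable borel" and fin: "window_weight (\<lambda>x. (\<phi> x)\<^sup>2) < \<infinity>" for l \<phi> t
  proof -
    let ?S = "window_weight (\<lambda>x. (\<phi> x)\<^sup>2)"
    let ?Y = "window_compensator l \<phi> (\<lambda>s N. ennreal (lam l s N)) t"
    note [measurable] = window_sum_measurable[OF l, of \<phi> t] window_compensator_measurable[OF _ lam_jointly_measurable[OF l], of \<phi> l t]
    have lamN[measurable]: "(\<lambda>s. ennreal (lam l s N)) \<in> borel_measurable borel" if "N \<in> space P" for N
      by (rule measurable_at_config[OF lam_jointly_measurable[OF l] that])
    interpret pair_sigma_finite lborel P by unfold_locales
    have "(window_weight \<phi>)\<^sup>2 \<le> (\<integral>\<^sup>+x. indicator {0<..A} x \<partial>lborel) * (\<integral>\<^sup>+x. indicator {0<..A} x * (\<phi> x)\<^sup>2 \<partial>lborel)"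
      using nn_integral_weighted_square_le[of "indicator {0<..A}" lborel \<phi>] by (simp add: mult.commute)
    also have "\<dots> < \<infinity>" using fin A_pos by (simp add: mult.commute ennreal_mult_less_top)
    finally have fin1: "window_weight \<phi> < \<infinity>" by (simp add: power_less_top_ennreal)
    have Y: "(\<integral>\<^sup>+N. (?Y N)\<^sup>2 \<partial>P) \<le> ennreal A * \<Lambda> * ?S"
    proof -
      have "(?Y N)\<^sup>2 \<le> ?S * (\<integral>\<^sup>+s. indicator {t - A..<t} s * (ennreal (lam l s N))\<^sup>2 \<partial>lborel)" if N: "N \<in> space P" for N
      proof -
        have [measurable]: "(\<lambda>s. ennreal (lam l s N)) \<in> borel_measurable borel" by (rule lamN[OF N])
        have "(?Y N)\<^sup>2 = (\<integral>\<^sup>+s. (\<phi> (t - s) * indicator {t - A..<t} s) * (indicator {t - A..<t} s * ennreal (lam l s N)) \<partial>lborel)\<^sup>2"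
          unfolding window_compensator_def
          by (intro arg_cong[where f="\<lambda>x. x\<^sup>2"] nn_integral_cong) (auto split: split_indicator)
        also have "\<dots> \<le> (\<integral>\<^sup>+s. (\<phi> (t - s) * indicator {t - A..<t} s)\<^sup>2 \<partial>lborel) *
            (\<integral>\<^sup>+s. (indicator {t - A..<t} s * ennreal (lam l s N))\<^sup>2 \<partial>lborel)"
          by (rule Cauchy_Schwarz_nn_integral) measurable
        also have "(\<integral>\<^sup>+s. (\<phi> (t - s) * indicator {t - A..<t} s)\<^sup>2 \<partial>lborel) = ?S"
          by (subst window_weight_eq[symmetric, where t=t]) (auto intro!: nn_integral_cong split: split_indicator)
        also have "(\<integral>\<^sup>+s. (indicator {t - A..<t} s * ennreal (lam l s N))\<^sup>2 \<partial>lborel) =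
            (\<integral>\<^sup>+s. indicator {t - A..<t} s * (ennreal (lam l s N))\<^sup>2 \<partial>lborel)"
          by (auto intro!: nn_integral_cong split: split_indicator)
        finally show ?thesis .
      qed
      then have "(\<integral>\<^sup>+N. (?Y N)\<^sup>2 \<partial>P) \<le> (\<integral>\<^sup>+N. ?S * (\<integral>\<^sup>+s. indicator {t - A..<t} s * (ennreal (lam l s N))\<^sup>2 \<partial>lborel) \<partial>P)"
        by (intro nn_integral_mono)
      also have "\<dots> = ?S * (\<integral>\<^sup>+N. (\<integral>\<^sup>+s. indicator {t - A..<t} s * (ennreal (lam l s N))\<^sup>2 \<partial>lborel) \<partial>P)"
        using l by (intro nn_integral_cmult) measurable
      also have "(\<integral>\<^sup>+N. (\<integral>\<^sup>+s. indicator {t - A..<t} s * (ennreal (lam l s N))\<^sup>2 \<partial>lborel) \<partial>P) =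
          (\<integral>\<^sup>+s. (\<integral>\<^sup>+N. indicator {t - A..<t} s * (ennreal (lam l s N))\<^sup>2 \<partial>P) \<partial>lborel)"
        using l by (intro Fubini') measurable
      also have "\<dots> = (\<integral>\<^sup>+s. indicator {t - A..<t} s * (\<integral>\<^sup>+N. (ennreal (lam l s N))\<^sup>2 \<partial>P) \<partial>lborel)"
        using measurable_at_time[OF lam_jointly_measurable[OF l]] by (intro nn_integral_cong nn_integral_cmult) auto
      also have "\<dots> \<le> (\<integral>\<^sup>+s. indicator {t - A..<t} s * \<Lambda> \<partial>lborel)"
        by (intro nn_integral_mono mult_left_mono \<Lambda> l) auto
      also have "\<dots> = ennreal A * \<Lambda>" using A_pos by (simp add: nn_integral_multc)
      finally have "(\<integral>\<^sup>+N. (?Y N)\<^sup>2 \<partial>P) \<le> ?S * (ennreal A * \<Lambda>)" by (simp add: mult_left_mono)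
      then show ?thesis by (simp add: mult_ac)
    qed
    have "(\<integral>\<^sup>+N. (window_sum A l \<phi> t N)\<^sup>2 \<partial>P) \<le> (\<integral>\<^sup>+N. 2 * (window_sum A l \<phi> t N - ?Y N)\<^sup>2 + 2 * (?Y N)\<^sup>2 \<partial>P)"
    proof (rule nn_integral_mono)
      fix N
      have "window_sum A l \<phi> t N \<le> (window_sum A l \<phi> t N - ?Y N) + ?Y N" by (rule le_diff_add_ennreal)
      then have "(window_sum A l \<phi> t N)\<^sup>2 \<le> ((window_sum A l \<phi> t N - ?Y N) + ?Y N)\<^sup>2" by (intro power_mono) auto
      also have "\<dots> \<le> 2 * (window_sum A l \<phi> t N - ?Y N)\<^sup>2 + 2 * (?Y N)\<^sup>2" by (rule square_add_le_ennreal)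
      finally show "(window_sum A l \<phi> t N)\<^sup>2 \<le> 2 * (window_sum A l \<phi> t N - ?Y N)\<^sup>2 + 2 * (?Y N)\<^sup>2" .
    qed
    also have "\<dots> = 2 * (\<integral>\<^sup>+N. (window_sum A l \<phi> t N - ?Y N)\<^sup>2 \<partial>P) + 2 * (\<integral>\<^sup>+N. (?Y N)\<^sup>2 \<partial>P)"
      by (simp add: nn_integral_add nn_integral_cmult)
    also have "\<dots> \<le> 2 * (?S * ennreal (\<mu> l)) + 2 * (ennreal A * \<Lambda> * ?S)"
      using l fin1 by (intro add_mono mult_left_mono Y compensated_window_square_le) auto
    also have "\<dots> \<le> 2 * (?S * (\<Sum>l<K. ennreal (\<mu> l))) + 2 * (ennreal A * \<Lambda> * ?S)"
      using l by (intro add_mono mult_left_mono member_le_sum order_refl) auto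
    also have "\<dots> = C * ?S" by (simp add: C_def algebra_simps)
    finally show ?thesis .
  qed
  ultimately show thesis by (rule that)
qed

end

section \<open>The isometry for signed integrands\<close>

lemma L2_ennreal_product:
  fixes f g :: "'a \<Rightarrow> ennreal"
  assumes [measurable]: "f \<in> borel_measurable M" "g \<in> borel_measurable M"
    and f: "(\<integral>\<^sup>+x. (f x)\<^sup>2 \<partial>M) < \<infinity>" and g: "(\<integral>\<^sup>+x. (g x)\<^sup>2 \<partial>M) < \<infinity>"
  shows "(\<integral>\<^sup>+x. f x * g x \<partial>M) < \<infinity>"
    and "integrable M (\<lambda>x. enn2real (f x) * enn2real (g x))"
    and "(\<integral>x. enn2real (f x) * enn2real (g x) \<partial>M) = enn2real (\<integral>\<^sup>+x. f x * g x \<partial>M)"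
proof -
  have "(\<integral>\<^sup>+x. f x * g x \<partial>M)\<^sup>2 \<le> (\<integral>\<^sup>+x. (f x)\<^sup>2 \<partial>M) * (\<integral>\<^sup>+x. (g x)\<^sup>2 \<partial>M)"
    by (rule Cauchy_Schwarz_nn_integral) auto
  also have "\<dots> < \<infinity>" using f g by (simp add: ennreal_mult_less_top)
  finally show fin: "(\<integral>\<^sup>+x. f x * g x \<partial>M) < \<infinity>" by (simp add: power_less_top_ennreal)
  have "AE x in M. f x * g x \<noteq> \<infinity>"
    using fin by (intro nn_integral_PInf_AE) auto
  then have ae: "AE x in M. ennreal (enn2real (f x) * enn2real (g x)) = f x * g x"
    by eventually_elim (simp flip: enn2real_mult add: less_top)
  have eq: "(\<integral>\<^sup>+x. ennreal (enn2real (f x) * enn2real (g x)) \<partial>M) = (\<integral>\<^sup>+x. f x * g x \<partial>M)"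
    by (rule nn_integral_cong_AE[OF ae])
  show "integrable M (\<lambda>x. enn2real (f x) * enn2real (g x))"
    using eq fin by (intro integrableI_nonneg) auto
  show "(\<integral>x. enn2real (f x) * enn2real (g x) \<partial>M) = enn2real (\<integral>\<^sup>+x. f x * g x \<partial>M)"
    by (subst integral_eq_nn_integral) (auto simp: eq)
qed

context point_process_with_intensity
begin

definition compensated :: "(real \<times> config \<Rightarrow> ennreal) \<Rightarrow> config \<Rightarrow> real" where
  "compensated p N = enn2real (points_sum p N) - enn2real (compensator p N)"

text \<open>
  These conditions on an integrand make both of its integrals square integrable, so that all terms of the
  isometry are finite.
\<close>

definition finite_energy :: "(real \<times> config \<Rightarrow> ennreal) \<Rightarrow> bool" where
  "finite_energy p \<longleftrightarrow> p \<in> borel_measurable (predictable K) \<and>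
     (\<integral>\<^sup>+N. (compensator p N)\<^sup>2 \<partial>P) < \<infinity> \<and> (\<integral>\<^sup>+N. compensator (\<lambda>w. (p w)\<^sup>2) N \<partial>P) < \<infinity>"

lemma finite_energy_compensator:
  assumes "finite_energy p"
  shows "(\<integral>\<^sup>+N. compensator p N \<partial>P) < \<infinity>"
proof -
  have [measurable]: "p \<in> borel_measurable (predictable K)" using assms by (simp add: finite_energy_def)
  have "(\<integral>\<^sup>+N. compensator p N \<partial>P)\<^sup>2 \<le> emeasure P (space P) * (\<integral>\<^sup>+N. (compensator p N)\<^sup>2 \<partial>P)"
    by (rule nn_integral_square_le_emeasure) measurable
  also have "\<dots> < \<infinity>" using assms by (simp add: emeasure_space_1 finite_energy_def)
  finally show ?thesis by (simp add: power_less_top_ennreal)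
qed

lemma finite_energy_points_sum:
  assumes "finite_energy p"
  shows "(\<integral>\<^sup>+N. (points_sum p N)\<^sup>2 \<partial>P) < \<infinity>"
proof -
  have [measurable]: "p \<in> borel_measurable (predictable K)" using assms by (simp add: finite_energy_def)
  have "(\<integral>\<^sup>+N. (points_sum p N)\<^sup>2 \<partial>P) \<le> (\<integral>\<^sup>+N. 2 * (points_sum p N - compensator p N)\<^sup>2 + 2 * (compensator p N)\<^sup>2 \<partial>P)"
  proof (rule nn_integral_mono)
    fix N
    have "(points_sum p N)\<^sup>2 \<le> ((points_sum p N - compensator p N) + compensator p N)\<^sup>2"
      by (intro power_mono le_diff_add_ennreal) auto
    also have "\<dots> \<le> 2 * (points_sum p N - compensator p N)\<^sup>2 + 2 * (compensator p N)\<^sup>2"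
      by (rule square_add_le_ennreal)
    finally show "(points_sum p N)\<^sup>2 \<le> 2 * (points_sum p N - compensator p N)\<^sup>2 + 2 * (compensator p N)\<^sup>2" .
  qed
  also have "\<dots> = 2 * (\<integral>\<^sup>+N. (points_sum p N - compensator p N)\<^sup>2 \<partial>P) + 2 * (\<integral>\<^sup>+N. (compensator p N)\<^sup>2 \<partial>P)"
    by (simp add: nn_integral_add nn_integral_cmult)
  also have "\<dots> \<le> 2 * (\<integral>\<^sup>+N. compensator (\<lambda>w. (p w)\<^sup>2) N \<partial>P) + 2 * (\<integral>\<^sup>+N. (compensator p N)\<^sup>2 \<partial>P)"
    using finite_energy_compensator[OF assms] by (intro add_mono mult_left_mono compensated_square_le) auto
  also have "\<dots> < \<infinity>"
    using assms by (simp add: finite_energy_def ennreal_mult_less_top)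
  finally show ?thesis .
qed

lemma compensated_isometry:
  assumes p: "finite_energy p" and q: "finite_energy q"
  shows "integrable P (\<lambda>N. compensated p N * compensated q N)"
    and "(\<integral>N. compensated p N * compensated q N \<partial>P) = enn2real (\<integral>\<^sup>+N. compensator (\<lambda>w. p w * q w) N \<partial>P)"
proof -
  have pq[measurable]: "p \<in> borel_measurable (predictable K)" "q \<in> borel_measurable (predictable K)"
    using p q by (auto simp: finite_energy_def)
  have fin: "(\<integral>\<^sup>+N. (compensator p N)\<^sup>2 \<partial>P) < \<infinity>" "(\<integral>\<^sup>+N. (compensator q N)\<^sup>2 \<partial>P) < \<infinity>"
    "(\<integral>\<^sup>+N. (points_sum p N)\<^sup>2 \<partial>P) < \<infinity>" "(\<integral>\<^sup>+N. (points_sum q N)\<^sup>2 \<partial>P) < \<infinity>"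
    using p q finite_energy_points_sum by (auto simp: finite_energy_def)
  note XX = L2_ennreal_product[OF _ _ fin(3,4)] and XY = L2_ennreal_product[OF _ _ fin(3,2)]
    and YX = L2_ennreal_product[OF _ _ fin(1,4)] and YY = L2_ennreal_product[OF _ _ fin(1,2)]
  have eq: "compensated p N * compensated q N =
      enn2real (points_sum p N) * enn2real (points_sum q N) - enn2real (points_sum p N) * enn2real (compensator q N)
      - enn2real (compensator p N) * enn2real (points_sum q N) + enn2real (compensator p N) * enn2real (compensator q N)" for N
    by (simp add: compensated_def algebra_simps)
  show "integrable P (\<lambda>N. compensated p N * compensated q N)"
    unfolding eq by (intro Bochner_Integration.integrable_add Bochner_Integration.integrable_diff XX(2) XY(2) YX(2) YY(2)) measurable
  have "(\<integral>N. compensated p N * compensated q N \<partial>P) =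
      enn2real (\<integral>\<^sup>+N. points_sum p N * points_sum q N \<partial>P) - enn2real (\<integral>\<^sup>+N. points_sum p N * compensator q N \<partial>P)
      - enn2real (\<integral>\<^sup>+N. compensator p N * points_sum q N \<partial>P) + enn2real (\<integral>\<^sup>+N. compensator p N * compensator q N \<partial>P)"
    unfolding eq using XX(2) XY(2) YX(2) YY(2) by (simp add: XX(3) XY(3) YX(3) YY(3))
  moreover have "(\<integral>\<^sup>+N. compensator (\<lambda>w. p w * q w) N \<partial>P) < \<infinity>"
  proof -
    have "(\<integral>\<^sup>+N. compensator (\<lambda>w. p w * q w) N \<partial>P) \<le>
        (\<integral>\<^sup>+N. points_sum p N * points_sum q N \<partial>P) + (\<integral>\<^sup>+N. compensator p N * compensator q N \<partial>P)"
      unfolding isometry_nonneg[OF pq] by (simp add: add.assoc)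
    also have "\<dots> < \<infinity>" using XX(1) YY(1) by simp
    finally show ?thesis .
  qed
  moreover have "enn2real (\<integral>\<^sup>+N. points_sum p N * points_sum q N \<partial>P) + enn2real (\<integral>\<^sup>+N. compensator p N * compensator q N \<partial>P) =
      enn2real (\<integral>\<^sup>+N. compensator (\<lambda>w. p w * q w) N \<partial>P) + enn2real (\<integral>\<^sup>+N. points_sum p N * compensator q N \<partial>P)
      + enn2real (\<integral>\<^sup>+N. compensator p N * points_sum q N \<partial>P)"
    using arg_cong[OF isometry_nonneg[OF pq], of enn2real] XX(1) XY(1) YX(1) YY(1) calculation(2)
    by (simp add: enn2real_plus mult.commute)
  ultimately show "(\<integral>N. compensated p N * compensated q N \<partial>P) = enn2real (\<integral>\<^sup>+N. compensator (\<lambda>w. p w * q w) N \<partial>P)"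
    by simp
qed

text \<open>
  The conversion to extended non-negative numbers discards negative values, so this is the positive part of \<open>\<psi>\<close>
  on \<open>J\<close>. The negative part is the positive part of \<open>- \<psi>\<close>.
\<close>

definition positive_part :: "real set \<Rightarrow> (real \<times> config \<Rightarrow> real) \<Rightarrow> real \<times> config \<Rightarrow> ennreal" where
  "positive_part J \<psi> w = ennreal (\<psi> w) * indicator J (fst w)"

lemma positive_part_predictable [measurable (raw)]:
  assumes [measurable]: "\<psi> \<in> borel_measurable (predictable K)"
  shows "positive_part {a..b} \<psi> \<in> borel_measurable (predictable K)"
  unfolding positive_part_def[abs_def] by measurable

lemma points_sum_positive_part:
  assumes "N \<in> configs K"
  shows "points_sum (positive_part {a..b} \<psi>) N = ennreal (\<Sum>t\<in>N k \<inter> {a..b}. max 0 (\<psi> (t, N)))"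
proof -
  have "points_sum (positive_part {a..b} \<psi>) N = (\<Sum>t\<in>N k \<inter> {a..b}. ennreal (\<psi> (t, N)) * indicator {a..b} t)"
    unfolding points_sum_def positive_part_def fst_conv using configs_finite(1)[OF assms k]
    by (intro nn_integral_count_space') (auto split: split_indicator_asm)
  also have "\<dots> = (\<Sum>t\<in>N k \<inter> {a..b}. ennreal (max 0 (\<psi> (t, N))))"
    by (intro sum.cong) (auto simp: max_def ennreal_neg)
  also have "\<dots> = ennreal (\<Sum>t\<in>N k \<inter> {a..b}. max 0 (\<psi> (t, N)))"
    by (intro sum_ennreal) auto
  finally show ?thesis .
qed

lemma compensated_signed_eq:
  assumes \<psi>: "\<psi> \<in> borel_measurable (predictable K)" and lam_nonneg: "\<And>t N. 0 \<le> lam t N"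
    and N: "N \<in> configs K"
    and fin: "compensator (positive_part {a..b} \<psi>) N < \<infinity>" "compensator (positive_part {a..b} (\<lambda>w. - \<psi> w)) N < \<infinity>"
  shows "(\<Sum>t\<in>N k \<inter> {a..b}. \<psi> (t, N)) - (LINT t:{a..b}|lborel. \<psi> (t, N) * lam t N) =
    compensated (positive_part {a..b} \<psi>) N - compensated (positive_part {a..b} (\<lambda>w. - \<psi> w)) N"
proof -
  have N': "N \<in> space P" using N by (simp add: space_P)
  have sum: "(\<Sum>t\<in>N k \<inter> {a..b}. \<psi> (t, N)) = enn2real (points_sum (positive_part {a..b} \<psi>) N)
      - enn2real (points_sum (positive_part {a..b} (\<lambda>w. - \<psi> w)) N)"
  proof -
    have "(\<Sum>t\<in>N k \<inter> {a..b}. \<psi> (t, N)) = (\<Sum>t\<in>N k \<inter> {a..b}. max 0 (\<psi> (t, N)) - max 0 (- \<psi> (t, N)))"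
      by (intro sum.cong) (auto simp: max_def)
    then show ?thesis using N
      by (simp add: points_sum_positive_part sum_subtractf sum_nonneg)
  qed
  have "(\<lambda>w. \<psi> w) \<in> borel_measurable (borel \<Otimes>\<^sub>M P)"
    using predictable_imp_jointly_measurable[OF \<psi>] by (simp add: measurable_product_P)
  from measurable_compose[OF measurable_Pair2'[OF N'] this] have [measurable]: "(\<lambda>t. \<psi> (t, N)) \<in> borel_measurable borel" .
  have "(\<lambda>t. ennreal (lam t N)) \<in> borel_measurable borel"
    using measurable_compose[OF measurable_Pair2'[OF N'] lam_jointly_measurable] by simp
  then have "(\<lambda>t. enn2real (ennreal (lam t N))) \<in> borel_measurable borel" by measurable
  then have [measurable]: "(\<lambda>t. lam t N) \<in> borel_measurable borel" by (simp add: lam_nonneg)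
  have parts: "(\<integral>\<^sup>+t. ennreal (indicator {a..b} t *\<^sub>R (\<psi> (t, N) * lam t N)) \<partial>lborel) = compensator (positive_part {a..b} \<psi>) N"
      "(\<integral>\<^sup>+t. ennreal (- (indicator {a..b} t *\<^sub>R (\<psi> (t, N) * lam t N))) \<partial>lborel) = compensator (positive_part {a..b} (\<lambda>w. - \<psi> w)) N"
    unfolding compensator_def positive_part_def fst_conv
    by (intro nn_integral_cong; auto simp: ennreal_mult''[OF lam_nonneg, symmetric] split: split_indicator)+
  have "integrable lborel (\<lambda>t. indicator {a..b} t *\<^sub>R (\<psi> (t, N) * lam t N))"
    by (subst real_integrable_def, unfold parts) (use fin in auto)
  then have "(LINT t:{a..b}|lborel. \<psi> (t, N) * lam t N) = enn2real (compensator (positive_part {a..b} \<psi>) N)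
      - enn2real (compensator (positive_part {a..b} (\<lambda>w. - \<psi> w)) N)"
    unfolding set_lebesgue_integral_def by (subst real_lebesgue_integral_def) (auto simp only: parts)
  with sum show ?thesis by (simp add: compensated_def)
qed

lemma compensated_signed_measurable:
  assumes \<psi>: "\<psi> \<in> borel_measurable (predictable K)" and lam_nonneg: "\<And>t N. 0 \<le> lam t N"
  shows "(\<lambda>N. (\<Sum>t\<in>N k \<inter> {a..b}. \<psi> (t, N)) - (LINT t:{a..b}|lborel. \<psi> (t, N) * lam t N)) \<in> borel_measurable P"
proof (rule borel_measurable_diff)
  have "(\<lambda>N. enn2real (points_sum (positive_part {a..b} \<psi>) N)
      - enn2real (points_sum (positive_part {a..b} (\<lambda>w. - \<psi> w)) N)) \<in> borel_measurable P"
    using \<psi> by measurable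
  then show "(\<lambda>N. \<Sum>t\<in>N k \<inter> {a..b}. \<psi> (t, N)) \<in> borel_measurable P"
  proof (rule measurable_cong[THEN iffD1, rotated])
    fix N assume "N \<in> space P"
    moreover have "(\<Sum>t\<in>N k \<inter> {a..b}. \<psi> (t, N)) = (\<Sum>t\<in>N k \<inter> {a..b}. max 0 (\<psi> (t, N)) - max 0 (- \<psi> (t, N)))"
      by (intro sum.cong) (auto simp: max_def)
    ultimately show "enn2real (points_sum (positive_part {a..b} \<psi>) N)
      - enn2real (points_sum (positive_part {a..b} (\<lambda>w. - \<psi> w)) N) = (\<Sum>t\<in>N k \<inter> {a..b}. \<psi> (t, N))"
      by (simp add: space_P points_sum_positive_part sum_subtractf sum_nonneg)
  qed
  have [measurable]: "\<psi> \<in> borel_measurable (borel \<Otimes>\<^sub>M P)"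
    using predictable_imp_jointly_measurable[OF \<psi>] by (simp add: measurable_product_P)
  have "(\<lambda>w. enn2real ((\<lambda>(t, N). ennreal (lam t N)) w)) \<in> borel_measurable (borel \<Otimes>\<^sub>M P)"
    using lam_jointly_measurable by measurable
  then have [measurable]: "(\<lambda>(t, N). lam t N) \<in> borel_measurable (borel \<Otimes>\<^sub>M P)"
    by (simp add: lam_nonneg case_prod_unfold)
  show "(\<lambda>N. LINT t:{a..b}|lborel. \<psi> (t, N) * lam t N) \<in> borel_measurable P"
    unfolding set_lebesgue_integral_def by measurable
qed

text \<open>
  The isometry for real integrands follows by bilinearity. The four expectations on the right are kept separate
  because each of them will be evaluated by stationarity.
\<close>

lemma signed_isometry:
  assumes \<psi>: "\<psi> \<in> borel_measurable (predictable K)" and \<phi>: "\<phi> \<in> borel_measurable (predictable K)"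
    and lam_nonneg: "\<And>t N. 0 \<le> lam t N"
    and fin\<psi>: "finite_energy (positive_part {a..b} \<psi>)" "finite_energy (positive_part {a..b} (\<lambda>w. - \<psi> w))"
    and fin\<phi>: "finite_energy (positive_part {a..b} \<phi>)" "finite_energy (positive_part {a..b} (\<lambda>w. - \<phi> w))"
  defines "M \<equiv> \<lambda>\<psi> N. (\<Sum>t\<in>N k \<inter> {a..b}. \<psi> (t, N)) - (LINT t:{a..b}|lborel. \<psi> (t, N) * lam t N)"
    and "E \<equiv> \<lambda>\<psi> \<phi>. enn2real (\<integral>\<^sup>+N. compensator (\<lambda>w. positive_part {a..b} \<psi> w * positive_part {a..b} \<phi> w) N \<partial>P)"
  shows "(\<integral>N. M \<psi> N * M \<phi> N \<partial>P) =
      E \<psi> \<phi> - E \<psi> (\<lambda>w. - \<phi> w) - E (\<lambda>w. - \<psi> w) \<phi> + E (\<lambda>w. - \<psi> w) (\<lambda>w. - \<phi> w)"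
proof -
  have meas: "M \<psi> \<in> borel_measurable P" "M \<phi> \<in> borel_measurable P"
    unfolding M_def by (intro compensated_signed_measurable \<psi> \<phi> lam_nonneg)+
  let ?p = "\<lambda>\<psi>. compensated (positive_part {a..b} \<psi>)" and ?n = "\<lambda>\<psi>. compensated (positive_part {a..b} (\<lambda>w. - \<psi> w))"
  have ae: "AE N in P. compensator p N < \<infinity>" if "finite_energy p" for p
  proof -
    have "AE N in P. compensator p N \<noteq> \<infinity>"
      using finite_energy_compensator[OF that] that
      by (intro nn_integral_PInf_AE) (auto simp: finite_energy_def measurable_compensator)
    then show ?thesis by (simp add: less_top)
  qed
  have "AE N in P. M \<psi> N * M \<phi> N = ?p \<psi> N * ?p \<phi> N - ?p \<psi> N * ?n \<phi> N - ?n \<psi> N * ?p \<phi> N + ?n \<psi> N * ?n \<phi> N"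
    using ae[OF fin\<psi>(1)] ae[OF fin\<psi>(2)] ae[OF fin\<phi>(1)] ae[OF fin\<phi>(2)] AE_space
  proof eventually_elim
    case (elim N)
    then have N: "N \<in> configs K" by (simp add: space_P)
    have "M \<psi> N = ?p \<psi> N - ?n \<psi> N" "M \<phi> N = ?p \<phi> N - ?n \<phi> N"
      unfolding M_def by (intro compensated_signed_eq[OF _ lam_nonneg N] \<psi> \<phi> elim)+
    then show ?case by (simp only:) (simp add: algebra_simps)
  qed
  note isoi = compensated_isometry(1)[OF fin\<psi>(1) fin\<phi>(1)] compensated_isometry(1)[OF fin\<psi>(1) fin\<phi>(2)]
      compensated_isometry(1)[OF fin\<psi>(2) fin\<phi>(1)] compensated_isometry(1)[OF fin\<psi>(2) fin\<phi>(2)]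
  note isov = compensated_isometry(2)[OF fin\<psi>(1) fin\<phi>(1)] compensated_isometry(2)[OF fin\<psi>(1) fin\<phi>(2)]
      compensated_isometry(2)[OF fin\<psi>(2) fin\<phi>(1)] compensated_isometry(2)[OF fin\<psi>(2) fin\<phi>(2)]
  have "(\<integral>N. M \<psi> N * M \<phi> N \<partial>P) =
      (\<integral>N. ?p \<psi> N * ?p \<phi> N - ?p \<psi> N * ?n \<phi> N - ?n \<psi> N * ?p \<phi> N + ?n \<psi> N * ?n \<phi> N \<partial>P)"
    using \<open>AE N in P. _\<close> meas isoi by (intro integral_cong_AE) auto
  also have "\<dots> = E \<psi> \<phi> - E \<psi> (\<lambda>w. - \<phi> w) - E (\<lambda>w. - \<psi> w) \<phi> + E (\<lambda>w. - \<psi> w) (\<lambda>w. - \<phi> w)"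
    unfolding E_def using isoi by (simp add: isov)
  finally show ?thesis .
qed

end

section \<open>The inner product of two scores\<close>

lemma abs_mult_le_add_squares: "\<bar>a * b\<bar> \<le> a\<^sup>2 + (b::real)\<^sup>2"
  using sum_squares_bound[of "\<bar>a\<bar>" "\<bar>b\<bar>"] abs_ge_zero[of "a * b"]
  unfolding abs_mult power2_abs mult.assoc by linarith

lemma signed_product_expansion:
  fixes a b L :: "'a \<Rightarrow> real"
  assumes [measurable]: "a \<in> borel_measurable M" "b \<in> borel_measurable M" "L \<in> borel_measurable M"
    and L: "\<And>x. 0 \<le> L x" and int: "integrable M (\<lambda>x. a x * b x * L x)"
  defines "E \<equiv> \<lambda>a b. enn2real (\<integral>\<^sup>+x. ennreal (a x) * ennreal (b x) * ennreal (L x) \<partial>M)"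
  shows "(\<integral>x. a x * b x * L x \<partial>M) = E a b - E a (\<lambda>x. - b x) - E (\<lambda>x. - a x) b + E (\<lambda>x. - a x) (\<lambda>x. - b x)"
proof -
  have piece: "integrable M (\<lambda>x. max 0 (f x) * max 0 (g x) * L x)"
      "(\<integral>x. max 0 (f x) * max 0 (g x) * L x \<partial>M) = E f g"
    if [measurable]: "f \<in> borel_measurable M" "g \<in> borel_measurable M"
      and le: "\<And>x. \<bar>f x * g x\<bar> \<le> \<bar>a x * b x\<bar>" for f g
  proof -
    have "\<bar>max 0 (f x) * max 0 (g x)\<bar> \<le> \<bar>a x * b x\<bar>" for x
      using le[of x] by (auto simp: max_def abs_mult split: if_splits)
    then have "\<bar>max 0 (f x) * max 0 (g x) * L x\<bar> \<le> \<bar>a x * b x * L x\<bar>" for x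
      using L[of x] by (simp add: abs_mult mult_right_mono)
    then show "integrable M (\<lambda>x. max 0 (f x) * max 0 (g x) * L x)"
      by (intro Bochner_Integration.integrable_bound[OF int]) auto
    have "ennreal (max 0 (f x) * max 0 (g x) * L x) = ennreal (f x) * ennreal (g x) * ennreal (L x)" for x
      using L[of x] by (simp add: ennreal_mult' max_def ennreal_neg)
    then show "(\<integral>x. max 0 (f x) * max 0 (g x) * L x \<partial>M) = E f g"
      unfolding E_def by (subst integral_eq_nn_integral) (auto simp: L)
  qed
  have eq: "a x * b x * L x = max 0 (a x) * max 0 (b x) * L x - max 0 (a x) * max 0 (- b x) * L x
      - max 0 (- a x) * max 0 (b x) * L x + max 0 (- a x) * max 0 (- b x) * L x" for x
    by (auto simp: max_def)
  note p = piece[of a b] piece[of a "\<lambda>x. - b x"] piece[of "\<lambda>x. - a x" b] piece[of "\<lambda>x. - a x" "\<lambda>x. - b x"]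
  show ?thesis
    unfolding eq by (simp add: p)
qed

context hawkes
begin

text \<open>
  The values of an element of \<open>L2_on A\<close> outside \<open>[0,A]\<close> are arbitrary, and there the function may fail to be
  measurable. They are never used: a window only involves arguments in \<open>(0, A]\<close>.
\<close>

lemma L2_on_restrict_measurable:
  "f \<in> L2_on A \<Longrightarrow> (\<lambda>x. indicator {0..A} x * f x) \<in> borel_measurable borel"
  by (simp add: L2_on_def set_borel_measurable_def)

lemma L2_on_window_weight:
  assumes "f \<in> L2_on A"
  shows "window_weight (\<lambda>x. (ennreal \<bar>indicator {0..A} x * f x\<bar>)\<^sup>2) < \<infinity>"
proof -
  have "integrable lborel (\<lambda>x. indicator {0..A} x *\<^sub>R (f x)\<^sup>2)"
    using assms by (simp add: L2_on_def set_integrable_def)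
  then have "(\<integral>\<^sup>+x. ennreal (indicator {0..A} x * (f x)\<^sup>2) \<partial>lborel) < \<infinity>"
    by (simp add: integrable_iff_bounded)
  moreover have "window_weight (\<lambda>x. (ennreal \<bar>indicator {0..A} x * f x\<bar>)\<^sup>2) \<le>
      (\<integral>\<^sup>+x. ennreal (indicator {0..A} x * (f x)\<^sup>2) \<partial>lborel)"
    by (intro nn_integral_mono) (auto simp: ennreal_power split: split_indicator)
  ultimately show ?thesis by (simp add: le_less_trans)
qed

lemma L2_on_uminus: "f \<in> L2_on A \<Longrightarrow> (\<lambda>x. - f x) \<in> L2_on A"
  by (simp add: L2_on_def set_borel_measurable_def)

lemma window_sum_max:
  assumes "N \<in> configs K" "l < K"
  shows "window_sum A l (\<lambda>x. ennreal (indicator {0..A} x * f x)) t N =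
    ennreal (\<Sum>u\<in>N l \<inter> {t - A..<t}. max 0 (f (t - u)))"
proof -
  have "window_sum A l (\<lambda>x. ennreal (indicator {0..A} x * f x)) t N = window_sum A l (\<lambda>x. ennreal (max 0 (f x))) t N"
    unfolding window_sum_def
    by (intro nn_integral_cong) (auto simp: max_def ennreal_neg split: split_indicator)
  also have "\<dots> = ennreal (\<Sum>u\<in>N l \<inter> {t - A..<t}. max 0 (f (t - u)))"
    by (rule window_sum_eq_sum[OF assms]) simp
  finally show ?thesis .
qed

lemma sum_window_eq:
  assumes "N \<in> configs K" "l < K"
  shows "(\<Sum>u\<in>N l \<inter> {t - A..<t}. f (t - u)) =
    enn2real (window_sum A l (\<lambda>x. ennreal (indicator {0..A} x * f x)) t N)
      - enn2real (window_sum A l (\<lambda>x. ennreal (indicator {0..A} x * - f x)) t N)"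
proof -
  have "(\<Sum>u\<in>N l \<inter> {t - A..<t}. f (t - u)) = (\<Sum>u\<in>N l \<inter> {t - A..<t}. max 0 (f (t - u)) - max 0 (- f (t - u)))"
    by (intro sum.cong) (auto simp: max_def)
  then show ?thesis
    unfolding window_sum_max[OF assms, where f=f] window_sum_max[OF assms, where f="\<lambda>x. - f x"]
    by (simp add: sum_subtractf sum_nonneg)
qed

lemma lin_intensity_predictable:
  assumes g: "\<And>l. l < K \<Longrightarrow> g l \<in> L2_on A"
  shows "(\<lambda>(t, N). lin_intensity K A c g t N) \<in> borel_measurable (predictable K)"
proof -
  have m: "(\<lambda>w. window_sum A l (\<lambda>x. ennreal (indicator {0..A} x * f x)) (fst w) (snd w)) \<in> borel_measurable (predictable K)"
    if "l < K" "f \<in> L2_on A" for l f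
  proof -
    have "(\<lambda>x. ennreal (indicator {0..A} x * f x)) \<in> borel_measurable borel"
      using L2_on_restrict_measurable[OF that(2)] by measurable
    from window_sum_predictable[OF that(1) this, of A] show ?thesis by (simp add: case_prod_unfold)
  qed
  have "(\<lambda>w. c + (\<Sum>l<K. enn2real (window_sum A l (\<lambda>x. ennreal (indicator {0..A} x * g l x)) (fst w) (snd w))
      - enn2real (window_sum A l (\<lambda>x. ennreal (indicator {0..A} x * - g l x)) (fst w) (snd w)))) \<in> borel_measurable (predictable K)"
    by (intro borel_measurable_add borel_measurable_const borel_measurable_sum borel_measurable_diff borel_measurable_enn2real m g L2_on_uminus) auto
  then show ?thesis
    by (rule measurable_cong[THEN iffD1, rotated])
       (auto simp: lin_intensity_def sum_window_eq intro!: sum.cong)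
qed

lemma lam_real_predictable:
  assumes "k < K"
  shows "(\<lambda>(t, N). lam k t N) \<in> borel_measurable (predictable K)"
proof -
  have "(\<lambda>w. enn2real ((\<lambda>(t, N). ennreal (lam k t N)) w)) \<in> borel_measurable (predictable K)"
    by (intro borel_measurable_enn2real lam_predictable assms)
  then show ?thesis using assms by (simp add: case_prod_unfold less_imp_le lam_pos)
qed

lemma abs_lin_intensity_le:
  assumes N: "N \<in> configs K"
  shows "ennreal \<bar>lin_intensity K A c g t N\<bar> \<le>
    ennreal \<bar>c\<bar> + (\<Sum>l<K. window_sum A l (\<lambda>x. ennreal \<bar>indicator {0..A} x * g l x\<bar>) t N)"
proof -
  have "\<bar>lin_intensity K A c g t N\<bar> \<le> \<bar>c\<bar> + (\<Sum>l<K. \<bar>\<Sum>u\<in>N l \<inter> {t - A..<t}. g l (t - u)\<bar>)"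
    unfolding lin_intensity_def by (rule order.trans[OF abs_triangle_ineq]) (intro add_left_mono sum_abs)
  also have "\<dots> \<le> \<bar>c\<bar> + (\<Sum>l<K. \<Sum>u\<in>N l \<inter> {t - A..<t}. max 0 \<bar>g l (t - u)\<bar>)"
    by (intro add_left_mono sum_mono order.trans[OF sum_abs]) auto
  finally have "ennreal \<bar>lin_intensity K A c g t N\<bar> \<le> ennreal (\<bar>c\<bar> + (\<Sum>l<K. \<Sum>u\<in>N l \<inter> {t - A..<t}. max 0 \<bar>g l (t - u)\<bar>))"
    by (rule ennreal_leI)
  also have "\<dots> = ennreal \<bar>c\<bar> + (\<Sum>l<K. ennreal (\<Sum>u\<in>N l \<inter> {t - A..<t}. max 0 \<bar>g l (t - u)\<bar>))"
    by (subst ennreal_plus) (auto intro!: sum_nonneg simp: sum_ennreal)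
  also have "(\<Sum>l<K. ennreal (\<Sum>u\<in>N l \<inter> {t - A..<t}. max 0 \<bar>g l (t - u)\<bar>)) =
      (\<Sum>l<K. window_sum A l (\<lambda>x. ennreal \<bar>indicator {0..A} x * g l x\<bar>) t N)"
    using window_sum_max[OF N, of _ "\<lambda>x. \<bar>g l x\<bar>" for l] by (intro sum.cong) (auto simp: abs_mult)
  finally show ?thesis .
qed

lemma lin_intensity_L2:
  assumes g: "\<And>l. l < K \<Longrightarrow> g l \<in> L2_on A"
  obtains D :: ennreal where "D < \<infinity>" "\<And>t. (\<integral>\<^sup>+N. (ennreal \<bar>lin_intensity K A c g t N\<bar>)\<^sup>2 \<partial>P) \<le> D\<^sup>2"
proof -
  obtain C where C: "C < \<infinity>" "\<And>l \<phi> t. l < K \<Longrightarrow> \<phi> \<in> borel_measurable borel \<Longrightarrow> window_weight (\<lambda>x. (\<phi> x)\<^sup>2) < \<infinity> \<Longrightarrow>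
       (\<integral>\<^sup>+N. (window_sum A l \<phi> t N)\<^sup>2 \<partial>P) \<le> C * window_weight (\<lambda>x. (\<phi> x)\<^sup>2)"
    by (rule window_sum_L2) blast
  let ?\<phi> = "\<lambda>l x. ennreal \<bar>indicator {0..A} x * g l x\<bar>"
  define d where "d l = 1 + C * window_weight (\<lambda>x. (?\<phi> l x)\<^sup>2)" for l
  have meas: "?\<phi> l \<in> borel_measurable borel" if "l < K" for l
    using L2_on_restrict_measurable[OF g[OF that]] by measurable
  have d: "(\<integral>\<^sup>+N. (window_sum A l (?\<phi> l) t N)\<^sup>2 \<partial>P) \<le> (d l)\<^sup>2" if "l < K" for l t
  proof -
    have "(\<integral>\<^sup>+N. (window_sum A l (?\<phi> l) t N)\<^sup>2 \<partial>P) \<le> C * window_weight (\<lambda>x. (?\<phi> l x)\<^sup>2)"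
      by (intro C that meas L2_on_window_weight g)
    also have "\<dots> \<le> 1 * d l" by (simp add: d_def)
    also have "\<dots> \<le> d l * d l" by (intro mult_right_mono) (auto simp: d_def)
    finally show ?thesis by (simp add: power2_eq_square)
  qed
  show thesis
  proof (rule that)
    have "d l < \<infinity>" if "l < K" for l
      using C(1) L2_on_window_weight[OF g[OF that]] by (simp add: d_def ennreal_mult_less_top)
    then show "ennreal \<bar>c\<bar> + (\<Sum>l<K. d l) < \<infinity>" by simp
    fix t
    have "(\<integral>\<^sup>+N. (ennreal \<bar>lin_intensity K A c g t N\<bar>)\<^sup>2 \<partial>P) \<le>
        (\<integral>\<^sup>+N. (ennreal \<bar>c\<bar> + (\<Sum>l<K. window_sum A l (?\<phi> l) t N))\<^sup>2 \<partial>P)"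
      by (intro nn_integral_mono power_mono abs_lin_intensity_le) (auto simp: space_P)
    also have "\<dots> \<le> (ennreal \<bar>c\<bar> + (\<Sum>l<K. d l))\<^sup>2"
      by (intro L2_bound_add L2_bound_sum borel_measurable_sum) (auto simp: emeasure_space_1 intro!: d window_sum_measurable meas)
    finally show "(\<integral>\<^sup>+N. (ennreal \<bar>lin_intensity K A c g t N\<bar>)\<^sup>2 \<partial>P) \<le> (ennreal \<bar>c\<bar> + (\<Sum>l<K. d l))\<^sup>2" .
  qed
qed

lemma real_predictable_jointly_measurable:
  "\<psi> \<in> borel_measurable (predictable K) \<Longrightarrow> \<psi> \<in> borel_measurable (borel \<Otimes>\<^sub>M P)"
  by (intro measurable_product_P predictable_imp_jointly_measurable)

text \<open>
  The ratio of the functional to the intensity has finite energy: its product with \<open>\<lambda>\<close> is bounded by a linear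
  functional, which is bounded in mean square, and \<open>\<lambda> \<ge> \<nu>\<^sub>k\<close> bounds the product of its square with \<open>\<lambda>\<close>.
\<close>

lemma finite_energy_score:
  assumes k: "k < K" and g: "\<And>l. l < K \<Longrightarrow> g l \<in> L2_on A"
    and \<psi>: "\<psi> \<in> borel_measurable (predictable K)"
    and le: "\<And>t N. \<bar>\<psi> (t, N)\<bar> * lam k t N \<le> \<bar>lin_intensity K A c g t N\<bar>"
  shows "point_process_with_intensity.finite_energy K P (lam k)
     (point_process_with_intensity.positive_part {0..1} \<psi>)"
proof -
  interpret k: point_process_with_intensity K P k "lam k" by (rule point_process[OF k])
  interpret pair_sigma_finite lborel P by unfold_locales
  obtain D where D: "D < \<infinity>" "\<And>t. (\<integral>\<^sup>+N. (ennreal \<bar>lin_intensity K A c g t N\<bar>)\<^sup>2 \<partial>P) \<le> D\<^sup>2"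
    by (rule lin_intensity_L2[OF g]) blast+
  let ?G = "\<lambda>t N. ennreal \<bar>lin_intensity K A c g t N\<bar>"
  have "(\<lambda>(t, N). lin_intensity K A c g t N) \<in> borel_measurable (borel \<Otimes>\<^sub>M P)"
    by (intro real_predictable_jointly_measurable lin_intensity_predictable g)
  then have G[measurable]: "(\<lambda>(t, N). ?G t N) \<in> borel_measurable (borel \<Otimes>\<^sub>M P)" by measurable
  have le1: "ennreal (\<psi> (t, N)) * ennreal (lam k t N) \<le> ?G t N" for t N
  proof -
    have "ennreal (\<psi> (t, N)) * ennreal (lam k t N) = ennreal (\<psi> (t, N) * lam k t N)"
      using lam_pos[OF k, of t N] by (simp add: ennreal_mult'')
    also have "\<dots> \<le> ennreal (\<bar>\<psi> (t, N)\<bar> * lam k t N)"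
      using lam_pos[OF k, of t N] by (intro ennreal_leI mult_right_mono) auto
    also have "\<dots> \<le> ?G t N" by (intro ennreal_leI le)
    finally show ?thesis .
  qed
  have c1: "k.compensator (k.positive_part {0..1} \<psi>) N \<le> (\<integral>\<^sup>+t. indicator {0..1} t * ?G t N \<partial>lborel)" for N
    unfolding k.compensator_def k.positive_part_def fst_conv
    using le1 by (intro nn_integral_mono) (auto split: split_indicator)
  have "(\<integral>\<^sup>+N. (k.compensator (k.positive_part {0..1} \<psi>) N)\<^sup>2 \<partial>P) \<le> (\<integral>\<^sup>+N. (\<integral>\<^sup>+t. indicator {0..1} t * ?G t N \<partial>lborel)\<^sup>2 \<partial>P)"
    using c1 by (intro nn_integral_mono power_mono) auto
  also have "\<dots> \<le> ((\<integral>\<^sup>+t. indicator {0..1::real} t \<partial>lborel) * D)\<^sup>2"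
  proof (rule L2_bound_average)
    show "sigma_finite_measure lborel" "sigma_finite_measure P" by unfold_locales
  qed (use D in measurable)
  also have "\<dots> < \<infinity>" using D by (simp add: power_less_top_ennreal)
  finally have 1: "(\<integral>\<^sup>+N. (k.compensator (k.positive_part {0..1} \<psi>) N)\<^sup>2 \<partial>P) < \<infinity>" .
  have le2: "(ennreal (\<psi> (t, N)))\<^sup>2 * ennreal (lam k t N) \<le> ennreal (1 / \<nu> k) * (?G t N)\<^sup>2" for t N
  proof -
    have l: "0 < lam k t N" "\<nu> k \<le> lam k t N" "0 < \<nu> k" using lam_pos[OF k] lam_ge[OF k] \<nu>_pos[OF k] by auto
    have "ennreal (\<psi> (t, N)) \<le> ennreal \<bar>\<psi> (t, N)\<bar>" by (intro ennreal_leI) simp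
    then have "(ennreal (\<psi> (t, N)))\<^sup>2 * ennreal (lam k t N) \<le> (ennreal \<bar>\<psi> (t, N)\<bar>)\<^sup>2 * ennreal (lam k t N)"
      by (intro mult_right_mono power_mono) auto
    also have "\<dots> = ennreal ((\<psi> (t, N))\<^sup>2 * lam k t N)"
      using l by (simp add: ennreal_power ennreal_mult'')
    also have "\<dots> \<le> ennreal (1 / \<nu> k * (lin_intensity K A c g t N)\<^sup>2)"
    proof (rule ennreal_leI)
      have "(\<psi> (t, N))\<^sup>2 * lam k t N * \<nu> k \<le> (\<psi> (t, N))\<^sup>2 * lam k t N * lam k t N"
        using l by (intro mult_left_mono) auto
      also have "\<dots> = (\<bar>\<psi> (t, N)\<bar> * lam k t N)\<^sup>2" by (simp add: power2_eq_square)
      also have "\<dots> \<le> \<bar>lin_intensity K A c g t N\<bar>\<^sup>2" using l by (intro power_mono le) auto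
      finally show "(\<psi> (t, N))\<^sup>2 * lam k t N \<le> 1 / \<nu> k * (lin_intensity K A c g t N)\<^sup>2"
        using l by (simp add: field_simps)
    qed
    also have "\<dots> = ennreal (1 / \<nu> k) * (?G t N)\<^sup>2"
      using l by (subst ennreal_mult'[of "1 / \<nu> k"]) (simp_all add: ennreal_power)
    finally show ?thesis .
  qed
  have "(\<integral>\<^sup>+N. k.compensator (\<lambda>w. (k.positive_part {0..1} \<psi> w)\<^sup>2) N \<partial>P) \<le>
      (\<integral>\<^sup>+N. (\<integral>\<^sup>+t. indicator {0..1} t * (ennreal (1 / \<nu> k) * (?G t N)\<^sup>2) \<partial>lborel) \<partial>P)"
    unfolding k.compensator_def k.positive_part_def fst_conv
    using le2 by (intro nn_integral_mono) (auto split: split_indicator)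
  also have "\<dots> = (\<integral>\<^sup>+t. (\<integral>\<^sup>+N. indicator {0..1} t * (ennreal (1 / \<nu> k) * (?G t N)\<^sup>2) \<partial>P) \<partial>lborel)"
    by (rule Fubini') measurable
  also have "\<dots> = (\<integral>\<^sup>+t. indicator {0..1} t * (ennreal (1 / \<nu> k) * (\<integral>\<^sup>+N. (?G t N)\<^sup>2 \<partial>P)) \<partial>lborel)"
    using measurable_at_time[OF G] by (intro nn_integral_cong) (simp add: nn_integral_cmult)
  also have "\<dots> \<le> (\<integral>\<^sup>+t. indicator {0..1::real} t * (ennreal (1 / \<nu> k) * D\<^sup>2) \<partial>lborel)"
    by (intro nn_integral_mono mult_left_mono D) auto
  also have "\<dots> = ennreal (1 / \<nu> k) * D\<^sup>2" by (simp add: nn_integral_multc)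
  also have "\<dots> < \<infinity>" using D by (simp add: ennreal_mult_less_top power_less_top_ennreal)
  finally have 2: "(\<integral>\<^sup>+N. k.compensator (\<lambda>w. (k.positive_part {0..1} \<psi> w)\<^sup>2) N \<partial>P) < \<infinity>" .
  show ?thesis
    unfolding k.finite_energy_def using 1 2 \<psi> by (simp add: k.positive_part_predictable)
qed

lemma expectation_stationary:
  assumes F: "(\<lambda>(t, N). F t N) \<in> borel_measurable (predictable K)"
    and shift: "\<And>t r N. F t (shift r N) = F (t - r) N"
  shows "(\<integral>\<^sup>+N. F t N \<partial>P) = (\<integral>\<^sup>+N. F s N \<partial>P)"
proof -
  have "(\<lambda>N. F t N) \<in> borel_measurable (config_space K)"
    using measurable_Pair2[OF predictable_imp_jointly_measurable[OF F], of t] by simp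
  from expectation_shift[OF this, of "t - s"] show ?thesis by (simp add: shift)
qed

lemma lin_intensity_measurable:
  assumes "\<And>l. l < K \<Longrightarrow> g l \<in> L2_on A"
  shows "(\<lambda>N. lin_intensity K A c g t N) \<in> borel_measurable P"
  by (intro measurable_at_time real_predictable_jointly_measurable lin_intensity_predictable assms)

lemma lam_measurable:
  assumes "k < K"
  shows "(\<lambda>N. lam k t N) \<in> borel_measurable P"
  by (intro measurable_at_time real_predictable_jointly_measurable lam_real_predictable assms)

lemma lin_intensity_square_integrable:
  assumes g: "\<And>l. l < K \<Longrightarrow> g l \<in> L2_on A"
  shows "integrable P (\<lambda>N. (lin_intensity K A c g t N)\<^sup>2)"
proof -
  obtain D where D: "D < \<infinity>" "\<And>t. (\<integral>\<^sup>+N. (ennreal \<bar>lin_intensity K A c g t N\<bar>)\<^sup>2 \<partial>P) \<le> D\<^sup>2"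
    by (rule lin_intensity_L2[OF g]) blast+
  have "(\<integral>\<^sup>+N. ennreal ((lin_intensity K A c g t N)\<^sup>2) \<partial>P) \<le> D\<^sup>2"
    using D(2)[of t] by (simp add: ennreal_power)
  also have "\<dots> < \<infinity>" using D by (simp add: power_less_top_ennreal)
  finally show ?thesis
    using lin_intensity_measurable[OF g] by (intro integrableI_nonneg) auto
qed

lemma lin_intensity_product_integrable:
  assumes k: "k < K" and g: "\<And>l. l < K \<Longrightarrow> g l \<in> L2_on A" and g': "\<And>l. l < K \<Longrightarrow> g' l \<in> L2_on A"
  shows "integrable P (\<lambda>N. lin_intensity K A c g t N * lin_intensity K A c' g' t N / lam k t N)"
proof (rule Bochner_Integration.integrable_bound)
  show "integrable P (\<lambda>N. ((lin_intensity K A c g t N)\<^sup>2 + (lin_intensity K A c' g' t N)\<^sup>2) / \<nu> k)"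
    using g g' by (intro integrable_divide Bochner_Integration.integrable_add lin_intensity_square_integrable)
  show "(\<lambda>N. lin_intensity K A c g t N * lin_intensity K A c' g' t N / lam k t N) \<in> borel_measurable P"
    using g g' k by (intro borel_measurable_divide borel_measurable_times lin_intensity_measurable lam_measurable)
  have "norm (a * b / L) \<le> norm ((a\<^sup>2 + b\<^sup>2) / \<nu> k)" if "\<nu> k \<le> L" for a b L :: real
  proof -
    have "\<bar>a * b\<bar> / L \<le> \<bar>a * b\<bar> / \<nu> k" using that \<nu>_pos[OF k] by (intro divide_left_mono) auto
    also have "\<dots> \<le> (a\<^sup>2 + b\<^sup>2) / \<nu> k"
      using \<nu>_pos[OF k] by (intro divide_right_mono abs_mult_le_add_squares) simp
    finally show ?thesis using that \<nu>_pos[OF k] by simp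
  qed
  then show "AE N in P. norm (lin_intensity K A c g t N * lin_intensity K A c' g' t N / lam k t N)
      \<le> norm (((lin_intensity K A c g t N)\<^sup>2 + (lin_intensity K A c' g' t N)\<^sup>2) / \<nu> k)"
    using lam_ge[OF k] by auto
qed

text \<open>
  The isometry gives the expectation of \<open>\<integral> X Y / \<lambda> dt\<close> over \<open>[0,1]\<close>. The integrand is stationary, so time \<open>A\<close> may be
  taken instead of averaging over the unit interval.
\<close>

lemma expectation_score_product:
  assumes x: "x \<in> param_space K A" and y: "y \<in> param_space K A" and k: "k < K"
  defines "X \<equiv> lin_intensity K A (fst x k) (\<lambda>l. snd x l k)" and "Y \<equiv> lin_intensity K A (fst y k) (\<lambda>l. snd y l k)"
  shows "(\<integral>N. score K A \<nu> h x k N * score K A \<nu> h y k N \<partial>P) = (\<integral>N. X A N * Y A N / lam k A N \<partial>P)"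
proof -
  interpret k: point_process_with_intensity K P k "lam k" by (rule point_process[OF k])
  interpret pair_sigma_finite lborel P by unfold_locales
  have gx: "\<And>l. l < K \<Longrightarrow> snd x l k \<in> L2_on A" and gy: "\<And>l. l < K \<Longrightarrow> snd y l k \<in> L2_on A"
    using x y k by (auto simp: param_space_def)
  define \<psi> \<phi> where "\<psi> = (\<lambda>(t, N). X t N / lam k t N)" and "\<phi> = (\<lambda>(t, N). Y t N / lam k t N)"
  note lamr = lam_real_predictable[OF k]
  have "(\<lambda>w. (\<lambda>(t, N). X t N) w / (\<lambda>(t, N). lam k t N) w) \<in> borel_measurable (predictable K)"
    "(\<lambda>w. (\<lambda>(t, N). Y t N) w / (\<lambda>(t, N). lam k t N) w) \<in> borel_measurable (predictable K)"
    unfolding X_def Y_def by (intro borel_measurable_divide lin_intensity_predictable lamr gx gy; assumption)+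
  then have \<psi>: "\<psi> \<in> borel_measurable (predictable K)" and \<phi>: "\<phi> \<in> borel_measurable (predictable K)"
    by (simp_all add: \<psi>_def \<phi>_def case_prod_unfold)
  have lam0: "0 \<le> lam k t N" and lampos: "0 < lam k t N" for t N using lam_pos[OF k, of t N] by auto
  have le: "\<bar>\<psi> (t, N)\<bar> * lam k t N \<le> \<bar>X t N\<bar>" "\<bar>- \<psi> (t, N)\<bar> * lam k t N \<le> \<bar>X t N\<bar>"
      "\<bar>\<phi> (t, N)\<bar> * lam k t N \<le> \<bar>Y t N\<bar>" "\<bar>- \<phi> (t, N)\<bar> * lam k t N \<le> \<bar>Y t N\<bar>" for t N
    using lampos[of t N] by (auto simp: \<psi>_def \<phi>_def)
  have fe: "k.finite_energy (k.positive_part {0..1} \<psi>)" "k.finite_energy (k.positive_part {0..1} (\<lambda>w. - \<psi> w))"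
    "k.finite_energy (k.positive_part {0..1} \<phi>)" "k.finite_energy (k.positive_part {0..1} (\<lambda>w. - \<phi> w))"
    using le \<psi> \<phi> unfolding X_def Y_def
    by (intro finite_energy_score[OF k, where g="\<lambda>l. snd x l k" and c="fst x k"]
          finite_energy_score[OF k, where g="\<lambda>l. snd y l k" and c="fst y k"] gx gy; simp)+
  have score: "score K A \<nu> h x k N = (\<Sum>t\<in>N k \<inter> {0..1}. \<psi> (t, N)) - (LINT t:{0..1}|lborel. \<psi> (t, N) * lam k t N)"
    "score K A \<nu> h y k N = (\<Sum>t\<in>N k \<inter> {0..1}. \<phi> (t, N)) - (LINT t:{0..1}|lborel. \<phi> (t, N) * lam k t N)" for N
    using lampos[of _ N] by (simp_all add: score_def \<psi>_def \<phi>_def X_def Y_def less_imp_neq[symmetric])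
  define E where "E \<psi> \<phi> = enn2real (\<integral>\<^sup>+N. k.compensator (\<lambda>w. k.positive_part {0..1} \<psi> w * k.positive_part {0..1} \<phi> w) N \<partial>P)" for \<psi> \<phi>
  have E: "E \<psi>' \<phi>' = enn2real (\<integral>\<^sup>+N. ennreal (\<psi>' (A, N)) * ennreal (\<phi>' (A, N)) * ennreal (lam k A N) \<partial>P)"
    if \<psi>': "\<psi>' \<in> borel_measurable (predictable K)" and \<phi>': "\<phi>' \<in> borel_measurable (predictable K)"
      and shift: "\<And>t r N. \<psi>' (t, shift r N) = \<psi>' (t - r, N)" "\<And>t r N. \<phi>' (t, shift r N) = \<phi>' (t - r, N)" for \<psi>' \<phi>'
  proof -
    let ?F = "\<lambda>t N. ennreal (\<psi>' (t, N)) * ennreal (\<phi>' (t, N)) * ennreal (lam k t N)"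
    have "(\<lambda>w. ennreal (\<psi>' w) * ennreal (\<phi>' w) * ennreal ((\<lambda>(t, N). lam k t N) w)) \<in> borel_measurable (predictable K)"
      using \<psi>' \<phi>' lamr by measurable
    then have F: "(\<lambda>(t, N). ?F t N) \<in> borel_measurable (predictable K)" by (simp add: case_prod_unfold)
    then have FP[measurable]: "(\<lambda>(t, N). ?F t N) \<in> borel_measurable (borel \<Otimes>\<^sub>M P)" by (rule k.predictable_jointly_measurable)
    have "(\<integral>\<^sup>+N. k.compensator (\<lambda>w. k.positive_part {0..1} \<psi>' w * k.positive_part {0..1} \<phi>' w) N \<partial>P) =
        (\<integral>\<^sup>+N. (\<integral>\<^sup>+t. indicator {0..1} t * ?F t N \<partial>lborel) \<partial>P)"
      unfolding k.compensator_def k.positive_part_def fst_conv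
      by (intro nn_integral_cong) (auto split: split_indicator)
    also have "\<dots> = (\<integral>\<^sup>+t. (\<integral>\<^sup>+N. indicator {0..1} t * ?F t N \<partial>P) \<partial>lborel)"
      by (rule Fubini') measurable
    also have "\<dots> = (\<integral>\<^sup>+t. indicator {0..1} t * (\<integral>\<^sup>+N. ?F t N \<partial>P) \<partial>lborel)"
      using measurable_at_time[OF FP] by (intro nn_integral_cong nn_integral_cmult)
    also have "\<dots> = (\<integral>\<^sup>+t. indicator {0..1::real} t * (\<integral>\<^sup>+N. ?F A N \<partial>P) \<partial>lborel)"
    proof -
      have "(\<integral>\<^sup>+N. ?F t N \<partial>P) = (\<integral>\<^sup>+N. ?F A N \<partial>P)" for t
        by (rule expectation_stationary[OF F]) (simp add: shift intensity_def lin_intensity_shift)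
      then show ?thesis by (intro nn_integral_cong) metis
    qed
    also have "\<dots> = (\<integral>\<^sup>+N. ?F A N \<partial>P)" by (simp add: nn_integral_multc)
    finally show ?thesis by (simp add: E_def)
  qed
  have sh: "\<psi> (t, shift r N) = \<psi> (t - r, N)" "\<phi> (t, shift r N) = \<phi> (t - r, N)" for t r N
    by (simp_all add: \<psi>_def \<phi>_def X_def Y_def intensity_def lin_intensity_shift)
  have "(\<integral>N. score K A \<nu> h x k N * score K A \<nu> h y k N \<partial>P) =
      E \<psi> \<phi> - E \<psi> (\<lambda>w. - \<phi> w) - E (\<lambda>w. - \<psi> w) \<phi> + E (\<lambda>w. - \<psi> w) (\<lambda>w. - \<phi> w)"
    unfolding score E_def by (rule k.signed_isometry[OF \<psi> \<phi> lam0 fe])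
  also have "\<dots> = (\<integral>N. \<psi> (A, N) * \<phi> (A, N) * lam k A N \<partial>P)"
  proof -
    have "(\<lambda>N. \<psi> (A, N)) \<in> borel_measurable P" "(\<lambda>N. \<phi> (A, N)) \<in> borel_measurable P"
      using measurable_Pair2[OF real_predictable_jointly_measurable[OF \<psi>], of A]
        measurable_Pair2[OF real_predictable_jointly_measurable[OF \<phi>], of A] by auto
    moreover have "integrable P (\<lambda>N. \<psi> (A, N) * \<phi> (A, N) * lam k A N)"
    proof -
      have "\<psi> (A, N) * \<phi> (A, N) * lam k A N = X A N * Y A N / lam k A N" for N
        using lampos[of A N] by (simp add: \<psi>_def \<phi>_def)
      then show ?thesis
        unfolding X_def Y_def using lin_intensity_product_integrable[OF k gx gy] by simp
    qed
    moreover have "(\<lambda>w. - \<psi> w) \<in> borel_measurable (predictable K)" "(\<lambda>w. - \<phi> w) \<in> borel_measurable (predictable K)"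
      using \<psi> \<phi> by auto
    ultimately show ?thesis
      using lam_measurable[OF k, of A] lam0 \<psi> \<phi>
      by (subst signed_product_expansion) (auto simp: E sh)
  qed
  also have "\<dots> = (\<integral>N. X A N * Y A N / lam k A N \<partial>P)"
    using lampos by (intro Bochner_Integration.integral_cong refl) (simp add: \<psi>_def \<phi>_def less_imp_neq[symmetric])
  finally show ?thesis .
qed

end

section \<open>Palm distributions\<close>

locale hawkes_palm = hawkes +
  fixes Q :: "real \<Rightarrow> nat \<Rightarrow> config measure"
  assumes palm: "palm_family K P Q"
begin

lemma Q_measurable:
  assumes "l < K"
  shows "(\<lambda>u. Q u l) \<in> measurable borel (subprob_algebra (config_space K))"
  using palm assms by (intro measurable_prob_algebraD) (simp add: palm_family_def)

lemma Q_sets: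
  assumes "l < K"
  shows "sets (Q u l) = sets (config_space K)"
proof -
  have "(\<lambda>u. Q u l) \<in> measurable borel (prob_algebra (config_space K))"
    using palm assms by (simp add: palm_family_def)
  from measurable_space[OF this, of u] show "sets (Q u l) = sets (config_space K)"
    by (auto simp: space_prob_algebra)
qed

lemma Q_space: "l < K \<Longrightarrow> space (Q u l) = configs K"
  using sets_eq_imp_space_eq[OF Q_sets] by simp

lemma measurable_Q: "l < K \<Longrightarrow> measurable (Q u l) L = measurable (config_space K) L"
  by (intro measurable_cong_sets Q_sets refl)

lemma campbell_nonneg:
  assumes l: "l < K" and \<Phi>: "(\<lambda>(u, N). \<Phi> u N) \<in> borel_measurable (borel \<Otimes>\<^sub>M config_space K)"
  shows "(\<integral>\<^sup>+N. (\<integral>\<^sup>+u. \<Phi> u N \<partial>count_space (N l)) \<partial>P) =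
    ennreal (\<mu> l) * (\<integral>\<^sup>+u. (\<integral>\<^sup>+N. \<Phi> u N \<partial>Q u l) \<partial>lborel)"
proof -
  define \<Psi> where "\<Psi> u j N = (if j = l then \<Phi> u N else 0)" for u j N
  have "(\<lambda>(u, N). \<Psi> u j N) \<in> borel_measurable (borel \<Otimes>\<^sub>M config_space K)" for j
    using \<Phi> by (cases "j = l") (simp_all add: \<Psi>_def)
  then have "(\<integral>\<^sup>+N. (\<Sum>j<K. \<integral>\<^sup>+u. \<Psi> u j N \<partial>count_space (N j)) \<partial>P) =
      (\<Sum>j<K. ennreal (\<mu> j) * (\<integral>\<^sup>+u. (\<integral>\<^sup>+N. \<Psi> u j N \<partial>Q u j) \<partial>lborel))"
    using palm unfolding palm_family_def by blast
  moreover have "(\<Sum>j<K. \<integral>\<^sup>+u. \<Psi> u j N \<partial>count_space (N j)) = (\<integral>\<^sup>+u. \<Phi> u N \<partial>count_space (N l))" for N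
  proof -
    have "(\<Sum>j<K. \<integral>\<^sup>+u. \<Psi> u j N \<partial>count_space (N j)) = (\<Sum>j<K. if j = l then \<integral>\<^sup>+u. \<Phi> u N \<partial>count_space (N l) else 0)"
      by (intro sum.cong) (auto simp: \<Psi>_def)
    then show ?thesis using l by simp
  qed
  moreover have "(\<Sum>j<K. ennreal (\<mu> j) * (\<integral>\<^sup>+u. (\<integral>\<^sup>+N. \<Psi> u j N \<partial>Q u j) \<partial>lborel)) =
      ennreal (\<mu> l) * (\<integral>\<^sup>+u. (\<integral>\<^sup>+N. \<Phi> u N \<partial>Q u l) \<partial>lborel)"
  proof -
    have "(\<Sum>j<K. ennreal (\<mu> j) * (\<integral>\<^sup>+u. (\<integral>\<^sup>+N. \<Psi> u j N \<partial>Q u j) \<partial>lborel)) =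
        (\<Sum>j<K. if j = l then ennreal (\<mu> l) * (\<integral>\<^sup>+u. (\<integral>\<^sup>+N. \<Phi> u N \<partial>Q u l) \<partial>lborel) else 0)"
      by (intro sum.cong) (auto simp: \<Psi>_def)
    then show ?thesis using l by simp
  qed
  ultimately show ?thesis by simp
qed

lemma palm_nn_integral_measurable:
  assumes l: "l < K" and \<Phi>: "(\<lambda>(u, N). \<Phi> u N) \<in> borel_measurable (borel \<Otimes>\<^sub>M config_space K)"
  shows "(\<lambda>u. \<integral>\<^sup>+N. \<Phi> u N \<partial>Q u l) \<in> borel_measurable borel"
  by (rule nn_integral_measurable_subprob_algebra2[OF \<Phi> Q_measurable[OF l]])

text \<open>
  An event that occurs at almost no point of the process is null for almost every Palm distribution; this
  uses that \<open>\<mu>\<^sub>l\<close> is positive.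
\<close>

lemma palm_AE:
  assumes l: "l < K" and B: "B \<in> sets (borel \<Otimes>\<^sub>M config_space K)"
    and P: "AE N in P. \<forall>u\<in>N l. (u, N) \<notin> B"
  shows "AE u in lborel. AE N in Q u l. (u, N) \<notin> B"
proof -
  have meas: "(\<lambda>(u, N). indicator B (u, N) :: ennreal) \<in> borel_measurable (borel \<Otimes>\<^sub>M config_space K)"
    using B by simp
  have "(\<integral>\<^sup>+N. (\<integral>\<^sup>+u. indicator B (u, N) \<partial>count_space (N l)) \<partial>P) = (\<integral>\<^sup>+N. 0 \<partial>P)"
  proof (rule nn_integral_cong_AE)
    show "AE N in P. (\<integral>\<^sup>+u. indicator B (u, N) \<partial>count_space (N l)) = 0"
      using P
    proof eventually_elim
      case (elim N)
      then have "(\<integral>\<^sup>+u. indicator B (u, N) \<partial>count_space (N l)) = (\<integral>\<^sup>+u. 0 \<partial>count_space (N l))"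
        by (intro nn_integral_cong) auto
      then show ?case by simp
    qed
  qed
  then have "ennreal (\<mu> l) * (\<integral>\<^sup>+u. (\<integral>\<^sup>+N. indicator B (u, N) \<partial>Q u l) \<partial>lborel) = 0"
    using campbell_nonneg[OF l meas] by simp
  then have "(\<integral>\<^sup>+u. (\<integral>\<^sup>+N. indicator B (u, N) \<partial>Q u l) \<partial>lborel) = 0"
    using \<mu>_pos[OF l] by (simp add: ennreal_eq_0_iff)
  moreover have "(\<lambda>u. \<integral>\<^sup>+N. indicator B (u, N) \<partial>Q u l) \<in> borel_measurable lborel"
    using palm_nn_integral_measurable[OF l meas] by simp
  ultimately have "AE u in lborel. (\<integral>\<^sup>+N. indicator B (u, N) \<partial>Q u l) = 0"
    by (simp add: nn_integral_0_iff_AE)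
  then show ?thesis
  proof eventually_elim
    case (elim u)
    have "(\<lambda>N. indicator B (u, N) :: ennreal) \<in> borel_measurable (Q u l)"
      unfolding measurable_Q[OF l] using measurable_Pair2[OF meas, of u] by simp
    with elim have "AE N in Q u l. (indicator B (u, N) :: ennreal) = 0"
      by (simp add: nn_integral_0_iff_AE)
    then show ?case by eventually_elim (auto split: split_indicator_asm)
  qed
qed

lemma points_jointly_measurable:
  assumes "l < K"
  shows "{w \<in> space (borel \<Otimes>\<^sub>M config_space K). fst w \<in> snd w l} \<in> sets (borel \<Otimes>\<^sub>M config_space K)"
proof -
  have [measurable]: "{w \<in> space (borel \<Otimes>\<^sub>M (borel \<Otimes>\<^sub>M config_space K)). fst w = fst (snd w)}
      \<in> sets ((borel :: real measure) \<Otimes>\<^sub>M (borel \<Otimes>\<^sub>M config_space K))" by measurable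
  have "(\<lambda>(x, N). \<integral>\<^sup>+s. indicator {w \<in> space (borel \<Otimes>\<^sub>M (borel \<Otimes>\<^sub>M config_space K)). fst w = fst (snd w)} (s, (x, N))
      \<partial>count_space (N l)) \<in> borel_measurable ((borel :: real measure) \<Otimes>\<^sub>M config_space K)"
    using assms by (intro points_integral_measurable) measurable
  then have "(\<lambda>w. indicator (snd w l) (fst w) :: ennreal) \<in> borel_measurable ((borel :: real measure) \<Otimes>\<^sub>M config_space K)"
  proof (rule measurable_cong[THEN iffD1, rotated])
    fix w :: "real \<times> config" assume w: "w \<in> space (borel \<Otimes>\<^sub>M config_space K)"
    obtain x N where [simp]: "w = (x, N)" by (cases w)
    have "(\<integral>\<^sup>+s. indicator {w \<in> space (borel \<Otimes>\<^sub>M (borel \<Otimes>\<^sub>M config_space K)). fst w = fst (snd w)} (s, (x, N)) \<partial>count_space (N l))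
        = (\<integral>\<^sup>+s. indicator {x} s \<partial>count_space (N l))"
      using w by (intro nn_integral_cong) (auto simp: space_pair_measure split: split_indicator)
    also have "\<dots> = indicator (N l) x"
    proof (cases "x \<in> N l")
      case True
      then have "(\<integral>\<^sup>+s. indicator {x} s \<partial>count_space (N l)) = (\<Sum>s\<in>{x}. indicator {x} s)"
        by (intro nn_integral_count_space') auto
      with True show ?thesis by simp
    next
      case False
      then have "(\<integral>\<^sup>+s. indicator {x} s \<partial>count_space (N l)) = (\<integral>\<^sup>+s. 0 \<partial>count_space (N l))"
        by (intro nn_integral_cong) (auto split: split_indicator)
      with False show ?thesis by simp
    qed
    finally show "(case w of (x, N) \<Rightarrow> \<integral>\<^sup>+s. indicator {w \<in> space (borel \<Otimes>\<^sub>M (borel \<Otimes>\<^sub>M config_space K)). fst w = fst (snd w)} (s, (x, N)) \<partial>count_space (N l))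
        = indicator (snd w l) (fst w)" by simp
  qed
  then have "{w \<in> space (borel \<Otimes>\<^sub>M config_space K). (indicator (snd w l) (fst w) :: ennreal) = 1} \<in> sets (borel \<Otimes>\<^sub>M config_space K)"
    by measurable
  also have "{w \<in> space (borel \<Otimes>\<^sub>M config_space K). (indicator (snd w l) (fst w) :: ennreal) = 1} =
      {w \<in> space (borel \<Otimes>\<^sub>M config_space K). fst w \<in> snd w l}"
    by (auto split: split_indicator_asm)
  finally show ?thesis .
qed

lemma palm_has_point:
  assumes l: "l < K"
  shows "AE u in lborel. AE N in Q u l. u \<in> N l"
proof -
  let ?B = "space (borel \<Otimes>\<^sub>M config_space K) - {w \<in> space (borel \<Otimes>\<^sub>M config_space K). fst w \<in> snd w l}"
  have "AE u in lborel. AE N in Q u l. (u, N) \<notin> ?B"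
    using points_jointly_measurable[OF l] by (intro palm_AE l) auto
  then show ?thesis
  proof eventually_elim
    case (elim u)
    then show ?case using AE_space
      by eventually_elim (auto simp: space_pair_measure Q_space[OF l])
  qed
qed

text \<open>
  The compensator has no atoms.
\<close>

lemma no_fixed_point:
  assumes k: "k < K"
  shows "AE N in P. t \<notin> N k"
proof -
  interpret k: point_process_with_intensity K P k "lam k" by (rule point_process[OF k])
  define C where "C = (\<lambda>w :: real \<times> config. indicator {t} (fst w) :: ennreal)"
  have C: "C \<in> borel_measurable (predictable K)"
    unfolding C_def by measurable
  have "k.compensator C N = 0" for N
  proof -
    have "AE s in lborel. s \<noteq> t" by (rule AE_lborel_singleton)
    then have "AE s in lborel. C (s, N) * ennreal (lam k s N) = 0" by eventually_elim (auto simp: C_def)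
    then have "k.compensator C N = (\<integral>\<^sup>+s. 0 \<partial>(lborel :: real measure))"
      unfolding k.compensator_def by (rule nn_integral_cong_AE)
    then show ?thesis by simp
  qed
  then have "(\<integral>\<^sup>+N. k.points_sum C N \<partial>P) = 0"
    using k.expectation_points_sum[OF C] by simp
  then have "AE N in P. k.points_sum C N = 0"
    using k.measurable_points_sum[OF C] by (simp add: nn_integral_0_iff_AE)
  then show ?thesis
  proof eventually_elim
    case (elim N)
    show ?case
    proof
      assume "t \<in> N k"
      then have "C (t, N) = 0"
        using elim unfolding k.points_sum_def by (simp add: nn_integral_0_iff_AE AE_count_space)
      then show False by (simp add: C_def)
    qed
  qed
qed

lemma palm_no_fixed_point:
  assumes l: "l < K" and j: "j < K"
  shows "AE u in lborel. AE N in Q u l. t \<notin> N j"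
proof -
  let ?D = "{w \<in> space (borel \<Otimes>\<^sub>M config_space K). fst w \<in> snd w j}"
  let ?B = "{w \<in> space (borel \<Otimes>\<^sub>M config_space K). t \<in> snd w j}"
  have "(\<lambda>w. (t, snd w)) \<in> measurable (borel \<Otimes>\<^sub>M config_space K) (borel \<Otimes>\<^sub>M config_space K)" by measurable
  from measurable_sets[OF this points_jointly_measurable[OF j]]
  have "(\<lambda>w. (t, snd w)) -` ?D \<inter> space (borel \<Otimes>\<^sub>M config_space K) \<in> sets ((borel :: real measure) \<Otimes>\<^sub>M config_space K)" .
  also have "(\<lambda>w. (t, snd w)) -` ?D \<inter> space (borel \<Otimes>\<^sub>M config_space K) = (?B :: (real \<times> config) set)"
    by (auto simp: space_pair_measure)
  finally have "AE u in lborel. AE N in Q u l. (u, N) \<notin> ?B"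
    using no_fixed_point[OF j, of t] by (intro palm_AE l) auto
  then show ?thesis
  proof eventually_elim
    case (elim u)
    then show ?case using AE_space
      by eventually_elim (auto simp: space_pair_measure Q_space[OF l])
  qed
qed

text \<open>
  Under integrability Campbell's formula extends to real functions. The support condition makes the sum over
  points finite.
\<close>

lemma campbell_signed:
  fixes \<Phi> :: "real \<Rightarrow> config \<Rightarrow> real"
  assumes l: "l < K" and \<Phi>: "(\<lambda>(u, N). \<Phi> u N) \<in> borel_measurable (borel \<Otimes>\<^sub>M config_space K)"
    and supp: "\<And>u N. u \<notin> {a..<b} \<Longrightarrow> \<Phi> u N = 0"
    and fin: "(\<integral>\<^sup>+N. (\<integral>\<^sup>+u. ennreal \<bar>\<Phi> u N\<bar> \<partial>count_space (N l)) \<partial>P) < \<infinity>"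
  shows "AE u in lborel. integrable (Q u l) (\<Phi> u)"
    and "integrable lborel (\<lambda>u. \<integral>N. \<Phi> u N \<partial>Q u l)"
    and "(\<integral>N. (\<Sum>u\<in>N l \<inter> {a..<b}. \<Phi> u N) \<partial>P) = \<mu> l * (\<integral>u. (\<integral>N. \<Phi> u N \<partial>Q u l) \<partial>lborel)"
proof -
  define n where "n f u = (\<integral>\<^sup>+N. ennreal (f u N) \<partial>Q u l)" for f :: "real \<Rightarrow> config \<Rightarrow> real" and u
  define s where "s f N = (\<integral>\<^sup>+u. ennreal (f u N) \<partial>count_space (N l))" for f :: "real \<Rightarrow> config \<Rightarrow> real" and N
  define pos neg abs where "pos = \<Phi>" and "neg = (\<lambda>u N. - \<Phi> u N)" and "abs = (\<lambda>u N. \<bar>\<Phi> u N\<bar>)"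
  have meas: "(\<lambda>(u, N). ennreal (f u N)) \<in> borel_measurable (borel \<Otimes>\<^sub>M config_space K)" if "f \<in> {pos, neg, abs}" for f
    using that \<Phi> by (auto simp: pos_def neg_def abs_def case_prod_unfold)
  have camp: "(\<integral>\<^sup>+N. s f N \<partial>P) = ennreal (\<mu> l) * (\<integral>\<^sup>+u. n f u \<partial>lborel)" if "f \<in> {pos, neg, abs}" for f
    unfolding s_def n_def by (rule campbell_nonneg[OF l meas[OF that]])
  have n_meas: "n f \<in> borel_measurable borel" if "f \<in> {pos, neg, abs}" for f
    unfolding n_def[abs_def] by (rule palm_nn_integral_measurable[OF l meas[OF that]])
  have s_meas: "s f \<in> borel_measurable P" if "f \<in> {pos, neg, abs}" for f
    unfolding s_def[abs_def] using points_integral_measurable'[OF l meas[OF that]]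
    by (intro measurable_P) simp
  have s_fin: "(\<integral>\<^sup>+N. s f N \<partial>P) < \<infinity>" if "f \<in> {pos, neg, abs}" for f
  proof -
    have "(\<integral>\<^sup>+N. s f N \<partial>P) \<le> (\<integral>\<^sup>+N. s abs N \<partial>P)"
      using that unfolding s_def by (intro nn_integral_mono ennreal_leI) (auto simp: pos_def neg_def abs_def)
    also have "\<dots> < \<infinity>" using fin by (simp add: s_def abs_def)
    finally show ?thesis .
  qed
  have n_fin: "(\<integral>\<^sup>+u. n f u \<partial>lborel) < \<infinity>" if "f \<in> {pos, neg, abs}" for f
    using s_fin[OF that] camp[OF that] \<mu>_pos[OF l] by (auto simp: ennreal_mult_less_top)
  have n_ae: "AE u in lborel. n f u < \<infinity>" if "f \<in> {pos, neg, abs}" for f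
  proof -
    have "AE u in lborel. n f u \<noteq> \<infinity>" using n_fin[OF that] n_meas[OF that] by (intro nn_integral_PInf_AE) auto
    then show ?thesis by (simp add: less_top)
  qed
  have \<Phi>Q: "\<Phi> u \<in> borel_measurable (Q u l)" for u
    unfolding measurable_Q[OF l] using measurable_Pair2[OF \<Phi>, of u] by simp
  show int: "AE u in lborel. integrable (Q u l) (\<Phi> u)"
    using n_ae[of abs]
    by (simp add: n_def abs_def integrable_iff_bounded \<Phi>Q)
  have split: "AE u in lborel. (\<integral>N. \<Phi> u N \<partial>Q u l) = enn2real (n pos u) - enn2real (n neg u)"
    using int by eventually_elim (simp add: real_lebesgue_integral_def n_def pos_def neg_def)
  have n_int: "integrable lborel (\<lambda>u. enn2real (n f u))" "(\<integral>u. enn2real (n f u) \<partial>lborel) = enn2real (\<integral>\<^sup>+u. n f u \<partial>lborel)"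
    if "f \<in> {pos, neg, abs}" for f
  proof -
    have eq: "(\<integral>\<^sup>+u. ennreal (enn2real (n f u)) \<partial>lborel) = (\<integral>\<^sup>+u. n f u \<partial>lborel)"
    proof (rule nn_integral_cong_AE)
      show "AE u in lborel. ennreal (enn2real (n f u)) = n f u"
        using n_ae[OF that] by eventually_elim simp
    qed
    show "integrable lborel (\<lambda>u. enn2real (n f u))"
      using eq n_fin[OF that] n_meas[OF that] by (intro integrableI_nonneg) auto
    show "(\<integral>u. enn2real (n f u) \<partial>lborel) = enn2real (\<integral>\<^sup>+u. n f u \<partial>lborel)"
      using n_meas[OF that] by (subst integral_eq_nn_integral) (auto simp: eq)
  qed
  have intQ: "(\<lambda>u. \<integral>N. \<Phi> u N \<partial>Q u l) \<in> borel_measurable borel"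
  proof -
    have "(\<lambda>u. integral\<^sup>L (distr (Q u l) (borel \<Otimes>\<^sub>M config_space K) (\<lambda>N. (u, N))) (\<lambda>(u, N). \<Phi> u N)) \<in> borel_measurable borel"
    proof (rule measurable_compose[OF _ integral_measurable_subprob_algebra[OF \<Phi>]])
      show "(\<lambda>u. distr (Q u l) (borel \<Otimes>\<^sub>M config_space K) (\<lambda>N. (u, N))) \<in> measurable borel (subprob_algebra (borel \<Otimes>\<^sub>M config_space K))"
        by (rule measurable_distr2[OF _ Q_measurable[OF l]]) measurable
    qed
    then show ?thesis
    proof (rule measurable_cong[THEN iffD1, rotated])
      fix u
      show "integral\<^sup>L (distr (Q u l) (borel \<Otimes>\<^sub>M config_space K) (\<lambda>N. (u, N))) (\<lambda>(u, N). \<Phi> u N) = (\<integral>N. \<Phi> u N \<partial>Q u l)"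
        using \<Phi> by (subst integral_distr) (auto simp: measurable_Q[OF l])
    qed
  qed
  have "integrable lborel (\<lambda>u. enn2real (n pos u) - enn2real (n neg u))"
    by (intro Bochner_Integration.integrable_diff n_int) auto
  then show "integrable lborel (\<lambda>u. \<integral>N. \<Phi> u N \<partial>Q u l)"
    by (rule integrable_cong_AE_imp) (use split intQ in auto)
  have int_eq: "(\<integral>u. (\<integral>N. \<Phi> u N \<partial>Q u l) \<partial>lborel) = enn2real (\<integral>\<^sup>+u. n pos u \<partial>lborel) - enn2real (\<integral>\<^sup>+u. n neg u \<partial>lborel)"
  proof -
    have "(\<integral>u. (\<integral>N. \<Phi> u N \<partial>Q u l) \<partial>lborel) = (\<integral>u. enn2real (n pos u) - enn2real (n neg u) \<partial>lborel)"
      using split intQ n_meas[of pos] n_meas[of neg] by (intro integral_cong_AE) auto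
    then show ?thesis using n_int[of pos] n_int[of neg] by simp
  qed
  have s_ae: "AE N in P. s f N < \<infinity>" if "f \<in> {pos, neg, abs}" for f
  proof -
    have "AE N in P. s f N \<noteq> \<infinity>" using s_fin[OF that] s_meas[OF that] by (intro nn_integral_PInf_AE) auto
    then show ?thesis by (simp add: less_top)
  qed
  have s_int: "integrable P (\<lambda>N. enn2real (s f N))" "(\<integral>N. enn2real (s f N) \<partial>P) = enn2real (\<integral>\<^sup>+N. s f N \<partial>P)"
    if "f \<in> {pos, neg, abs}" for f
  proof -
    have eq: "(\<integral>\<^sup>+N. ennreal (enn2real (s f N)) \<partial>P) = (\<integral>\<^sup>+N. s f N \<partial>P)"
    proof (rule nn_integral_cong_AE)
      show "AE N in P. ennreal (enn2real (s f N)) = s f N"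
        using s_ae[OF that] by eventually_elim simp
    qed
    show "integrable P (\<lambda>N. enn2real (s f N))"
      using eq s_fin[OF that] s_meas[OF that] by (intro integrableI_nonneg) auto
    show "(\<integral>N. enn2real (s f N) \<partial>P) = enn2real (\<integral>\<^sup>+N. s f N \<partial>P)"
      using s_meas[OF that] by (subst integral_eq_nn_integral) (auto simp: eq)
  qed
  have s_sum: "s f N = ennreal (\<Sum>u\<in>N l \<inter> {a..<b}. max 0 (f u N))" if "N \<in> configs K" "f \<in> {pos, neg, abs}" for f N
  proof -
    have "s f N = (\<Sum>u\<in>N l \<inter> {a..<b}. ennreal (f u N))"
      unfolding s_def using configs_finite(3)[OF that(1) l] that(2)
      by (intro nn_integral_count_space') (auto simp: pos_def neg_def abs_def supp)
    also have "\<dots> = (\<Sum>u\<in>N l \<inter> {a..<b}. ennreal (max 0 (f u N)))"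
      by (intro sum.cong) (auto simp: max_def ennreal_neg)
    also have "\<dots> = ennreal (\<Sum>u\<in>N l \<inter> {a..<b}. max 0 (f u N))" by (intro sum_ennreal) auto
    finally show ?thesis .
  qed
  have "(\<Sum>u\<in>N l \<inter> {a..<b}. \<Phi> u N) = enn2real (s pos N) - enn2real (s neg N)" if "N \<in> space P" for N
  proof -
    have N: "N \<in> configs K" using that by (simp add: space_P)
    have "(\<Sum>u\<in>N l \<inter> {a..<b}. \<Phi> u N) = (\<Sum>u\<in>N l \<inter> {a..<b}. max 0 (pos u N) - max 0 (neg u N))"
      by (intro sum.cong) (auto simp: max_def pos_def neg_def)
    then show ?thesis by (simp add: s_sum[OF N] sum_subtractf sum_nonneg)
  qed
  then have "(\<integral>N. (\<Sum>u\<in>N l \<inter> {a..<b}. \<Phi> u N) \<partial>P) = (\<integral>N. enn2real (s pos N) - enn2real (s neg N) \<partial>P)"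
    by (intro Bochner_Integration.integral_cong) auto
  also have "\<dots> = enn2real (\<integral>\<^sup>+N. s pos N \<partial>P) - enn2real (\<integral>\<^sup>+N. s neg N \<partial>P)"
    using s_int[of pos] s_int[of neg] by simp
  also have "\<dots> = \<mu> l * (\<integral>u. (\<integral>N. \<Phi> u N \<partial>Q u l) \<partial>lborel)"
    unfolding int_eq using camp[of pos] camp[of neg] \<mu>_pos[OF l]
    by (simp add: enn2real_mult right_diff_distrib)
  finally show "(\<integral>N. (\<Sum>u\<in>N l \<inter> {a..<b}. \<Phi> u N) \<partial>P) = \<mu> l * (\<integral>u. (\<integral>N. \<Phi> u N \<partial>Q u l) \<partial>lborel)" .
qed

end

section \<open>Square-integrable parameters\<close>

lemma AE_lborel_reflect:
  assumes "AE u in lborel. R u"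
  shows "AE x in lborel. R (A - x :: real)"
proof -
  obtain S where S: "{u \<in> space lborel. \<not> R u} \<subseteq> S" "S \<in> sets lborel" "emeasure lborel S = 0"
    using assms by (rule AE_E)
  have "AE u in lborel. u \<notin> S"
    using S by (intro AE_not_in) auto
  then have "AE x in lborel. A + (-1) * x \<notin> S"
    using S(2) by (intro AE_borel_affine) auto
  then show ?thesis by eventually_elim (use S(1) in auto)
qed

lemma L2_on_mult_integrable:
  assumes f: "f \<in> L2_on A" and g: "g \<in> L2_on A"
  shows "set_integrable lborel {0..A} (\<lambda>x. f x * g x)"
  unfolding set_integrable_def
proof (rule Bochner_Integration.integrable_bound)
  show "integrable lborel (\<lambda>x. indicator {0..A} x *\<^sub>R (f x)\<^sup>2 + indicator {0..A} x *\<^sub>R (g x)\<^sup>2)"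
    using f g by (intro Bochner_Integration.integrable_add) (auto simp: L2_on_def set_integrable_def)
  have "(\<lambda>x. (indicator {0..A} x *\<^sub>R f x) * (indicator {0..A} x *\<^sub>R g x)) \<in> borel_measurable lborel"
    using f g by (intro borel_measurable_times) (auto simp: L2_on_def set_borel_measurable_def)
  then show "(\<lambda>x. indicator {0..A} x *\<^sub>R (f x * g x)) \<in> borel_measurable lborel"
    by (rule measurable_cong[THEN iffD1, rotated]) (auto split: split_indicator)
  show "AE x in lborel. norm (indicator {0..A} x *\<^sub>R (f x * g x))
      \<le> norm (indicator {0..A} x *\<^sub>R (f x)\<^sup>2 + indicator {0..A} x *\<^sub>R (g x)\<^sup>2)"
    by (simp add: abs_mult_le_add_squares split: split_indicator)
qed

lemma L2_on_diff:
  assumes f: "f \<in> L2_on A" and g: "g \<in> L2_on A"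
  shows "(\<lambda>x. f x - g x) \<in> L2_on A"
proof -
  have "set_borel_measurable borel {0..A} (\<lambda>x. f x - g x)"
    using f g by (auto simp: L2_on_def set_borel_measurable_def right_diff_distrib)
  moreover have "set_integrable lborel {0..A} (\<lambda>x. (f x)\<^sup>2 - 2 * (f x * g x) + (g x)\<^sup>2)"
    using L2_on_mult_integrable[OF f g] f g
    by (intro set_integral_add set_integral_diff) (auto simp: L2_on_def)
  then have "set_integrable lborel {0..A} (\<lambda>x. (f x - g x)\<^sup>2)"
    by (simp add: power2_diff algebra_simps)
  ultimately show ?thesis by (simp add: L2_on_def)
qed

lemma L2_on_const: "(\<lambda>x. c) \<in> L2_on A"
proof -
  have "set_integrable lborel {0..A} (\<lambda>x. c\<^sup>2)" by (intro borel_integrable_atLeastAtMost') auto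
  then show ?thesis by (auto simp: L2_on_def set_borel_measurable_def)
qed

text \<open>
  Test against unit vectors for the finite-dimensional part and against \<open>z - z'\<close> for the functions.
\<close>

lemma param_inner_determines:
  assumes z: "z \<in> param_space K A" and z': "z' \<in> param_space K A"
    and eq: "\<And>x. x \<in> param_space K A \<Longrightarrow> param_inner K A x z = param_inner K A x z'"
    and l: "l < K" and k: "k < K"
  shows "fst z k = fst z' k" and "AE s in lborel. s \<in> {0..A} \<longrightarrow> snd z l k s = snd z' l k s"
proof -
  have L2: "snd z l k \<in> L2_on A" "snd z' l k \<in> L2_on A"
    using z z' l k by (auto simp: param_space_def)
  let ?e = "(\<lambda>i. if i = k then 1 else 0, \<lambda>i j s. 0) :: param"
  have "?e \<in> param_space K A" by (simp add: param_space_def L2_on_const)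
  from eq[OF this] show "fst z k = fst z' k"
    using k by (simp add: param_inner_def if_distrib[of "\<lambda>x. x * _"] cong: if_cong)
  define d where "d s = snd z l k s - snd z' l k s" for s
  have d: "d \<in> L2_on A" unfolding d_def[abs_def] by (rule L2_on_diff[OF L2])
  let ?d = "(\<lambda>i. 0, \<lambda>i j. if i = l \<and> j = k then d else (\<lambda>s. 0)) :: param"
  have mem: "?d \<in> param_space K A" using d by (auto simp: param_space_def L2_on_const)
  have inner: "param_inner K A ?d w = (LINT s:{0..A}|lborel. d s * snd w l k s)" for w
  proof -
    have "(\<Sum>i<K. \<Sum>j<K. LINT s:{0..A}|lborel. snd ?d i j s * snd w i j s) =
        (\<Sum>i<K. \<Sum>j<K. if i = l \<and> j = k then LINT s:{0..A}|lborel. d s * snd w l k s else 0)"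
      by (intro sum.cong) auto
    also have "\<dots> = (\<Sum>i<K. if i = l then LINT s:{0..A}|lborel. d s * snd w l k s else 0)"
      using k by (intro sum.cong) auto
    also have "\<dots> = (LINT s:{0..A}|lborel. d s * snd w l k s)" using l by simp
    finally show ?thesis by (simp add: param_inner_def)
  qed
  have "(LINT s:{0..A}|lborel. (d s)\<^sup>2) = (LINT s:{0..A}|lborel. d s * snd z l k s - d s * snd z' l k s)"
    by (simp add: d_def power2_eq_square right_diff_distrib)
  also have "\<dots> = (LINT s:{0..A}|lborel. d s * snd z l k s) - (LINT s:{0..A}|lborel. d s * snd z' l k s)"
    by (intro set_integral_diff L2_on_mult_integrable d L2)
  also have "\<dots> = 0" using eq[OF mem] by (simp add: inner)
  finally have "(\<integral>s. indicator {0..A} s *\<^sub>R (d s)\<^sup>2 \<partial>lborel) = 0" by (simp add: set_lebesgue_integral_def)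
  moreover have "integrable lborel (\<lambda>s. indicator {0..A} s *\<^sub>R (d s)\<^sup>2)"
    using d by (simp add: L2_on_def set_integrable_def)
  ultimately have "AE s in lborel. indicator {0..A} s *\<^sub>R (d s)\<^sup>2 = 0"
    by (subst (asm) integral_nonneg_eq_0_iff_AE) auto
  then show "AE s in lborel. s \<in> {0..A} \<longrightarrow> snd z l k s = snd z' l k s"
    by eventually_elim (auto simp: d_def)
qed

section \<open>Palm expectations as adjoints\<close>

context hawkes_palm
begin

lemma palm_integral_measurable:
  assumes "l < K" "F \<in> borel_measurable (config_space K)"
  shows "(\<lambda>u. \<integral>N. F N \<partial>Q u l :: real) \<in> borel_measurable borel"
  by (rule measurable_compose[OF Q_measurable[OF assms(1)] integral_measurable_subprob_algebra[OF assms(2)]])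

lemma window_mult_finite:
  assumes l: "l < K" and \<phi>: "\<phi> \<in> borel_measurable borel" "window_weight (\<lambda>x. (\<phi> x)\<^sup>2) < \<infinity>"
    and F: "F \<in> borel_measurable (config_space K)" "(\<integral>\<^sup>+N. (ennreal \<bar>F N\<bar>)\<^sup>2 \<partial>P) < \<infinity>"
  shows "(\<integral>\<^sup>+N. window_sum A l \<phi> A N * ennreal \<bar>F N\<bar> \<partial>P) < \<infinity>"
proof (rule L2_ennreal_product(1))
  obtain C where C: "C < \<infinity>" "\<And>l \<phi> t. l < K \<Longrightarrow> \<phi> \<in> borel_measurable borel \<Longrightarrow> window_weight (\<lambda>x. (\<phi> x)\<^sup>2) < \<infinity> \<Longrightarrow>
       (\<integral>\<^sup>+N. (window_sum A l \<phi> t N)\<^sup>2 \<partial>P) \<le> C * window_weight (\<lambda>x. (\<phi> x)\<^sup>2)"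
    by (rule window_sum_L2) blast
  show "(\<integral>\<^sup>+N. (window_sum A l \<phi> A N)\<^sup>2 \<partial>P) < \<infinity>"
    using C(2)[OF l \<phi>, of A] C(1) \<phi>(2) by (auto simp: ennreal_mult_less_top intro: le_less_trans)
  show "window_sum A l \<phi> A \<in> borel_measurable P" using window_sum_measurable[OF l \<phi>(1)] by simp
  show "(\<lambda>N. ennreal \<bar>F N\<bar>) \<in> borel_measurable P" using measurable_P[OF F(1)] by measurable
qed (rule F(2))

text \<open>
  Campbell's formula for \<open>\<Phi>(u, N) = f(A - u) F(N)\<close>: the adjoint of summing \<open>f(A - u)\<close> over the points is the
  Palm expectation. The second claim records when this expectation is a genuine integral.
\<close>

lemma palm_duality:
  assumes l: "l < K" and f: "f \<in> L2_on A"
    and F: "F \<in> borel_measurable (config_space K)" "(\<integral>\<^sup>+N. (ennreal \<bar>F N\<bar>)\<^sup>2 \<partial>P) < \<infinity>"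
  shows "(\<integral>N. (\<Sum>u\<in>N l \<inter> {0..<A}. f (A - u)) * F N \<partial>P) =
      (LINT x:{0..A}|lborel. f x * (\<mu> l * (\<integral>N. F N \<partial>Q (A - x) l)))"
    and "AE u in lborel. u \<in> {0..<A} \<and> f (A - u) \<noteq> 0 \<longrightarrow> integrable (Q u l) F"
proof -
  define fA where "fA x = indicator {0..A} x * f x" for x
  have fA[measurable]: "fA \<in> borel_measurable borel"
    unfolding fA_def[abs_def] by (rule L2_on_restrict_measurable[OF f])
  define \<Phi> where "\<Phi> u N = indicator {0..<A} u * fA (A - u) * F N" for u N
  note [measurable] = F(1)
  have \<Phi>: "(\<lambda>(u, N). \<Phi> u N) \<in> borel_measurable (borel \<Otimes>\<^sub>M config_space K)"
    unfolding \<Phi>_def by measurable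
  have abs: "(\<integral>\<^sup>+u. ennreal \<bar>\<Phi> u N\<bar> \<partial>count_space (N l)) = window_sum A l (\<lambda>x. ennreal \<bar>fA x\<bar>) A N * ennreal \<bar>F N\<bar>" for N
  proof -
    have "(\<integral>\<^sup>+u. ennreal \<bar>\<Phi> u N\<bar> \<partial>count_space (N l)) =
        (\<integral>\<^sup>+u. (ennreal \<bar>fA (A - u)\<bar> * indicator {A - A..<A} u) * ennreal \<bar>F N\<bar> \<partial>count_space (N l))"
      by (intro nn_integral_cong) (auto simp: \<Phi>_def abs_mult ennreal_mult split: split_indicator)
    then show ?thesis by (simp add: nn_integral_multc window_sum_def)
  qed
  have "(\<integral>\<^sup>+N. window_sum A l (\<lambda>x. ennreal \<bar>fA x\<bar>) A N * ennreal \<bar>F N\<bar> \<partial>P) < \<infinity>"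
    using L2_on_window_weight[OF f] by (intro window_mult_finite l F) (auto simp: fA_def[symmetric])
  then have fin: "(\<integral>\<^sup>+N. (\<integral>\<^sup>+u. ennreal \<bar>\<Phi> u N\<bar> \<partial>count_space (N l)) \<partial>P) < \<infinity>" by (simp add: abs)
  have supp: "\<Phi> u N = 0" if "u \<notin> {0..<A}" for u N using that by (simp add: \<Phi>_def)
  have camp: "AE u in lborel. integrable (Q u l) (\<Phi> u)"
      "(\<integral>N. (\<Sum>u\<in>N l \<inter> {0..<A}. \<Phi> u N) \<partial>P) = \<mu> l * (\<integral>u. (\<integral>N. \<Phi> u N \<partial>Q u l) \<partial>lborel)"
    by (rule campbell_signed[OF l \<Phi> _ fin, where a=0 and b=A]; erule supp)+
  have "AE u in lborel. integrable (Q u l) (\<lambda>N. (indicator {0..<A} u * fA (A - u)) * F N)"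
    using camp(1) by (simp only: \<Phi>_def[abs_def])
  then show "AE u in lborel. u \<in> {0..<A} \<and> f (A - u) \<noteq> 0 \<longrightarrow> integrable (Q u l) F"
    by eventually_elim (auto simp: fA_def)
  have IF[measurable]: "(\<lambda>u. \<integral>N. F N \<partial>Q u l) \<in> borel_measurable borel"
    by (rule palm_integral_measurable[OF l F(1)])
  have inner: "(\<integral>N. \<Phi> u N \<partial>Q u l) = indicator {0..<A} u * fA (A - u) * (\<integral>N. F N \<partial>Q u l)" for u
    unfolding \<Phi>_def by simp
  have "(\<integral>N. (\<Sum>u\<in>N l \<inter> {0..<A}. f (A - u)) * F N \<partial>P) = (\<integral>N. (\<Sum>u\<in>N l \<inter> {0..<A}. \<Phi> u N) \<partial>P)"
    by (intro Bochner_Integration.integral_cong) (auto simp: sum_distrib_right \<Phi>_def fA_def intro!: sum.cong)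
  also have "\<dots> = \<mu> l * (\<integral>u. indicator {0..<A} u * fA (A - u) * (\<integral>N. F N \<partial>Q u l) \<partial>lborel)"
    using camp(2) by (simp only: inner)
  also have "(\<integral>u. indicator {0..<A} u * fA (A - u) * (\<integral>N. F N \<partial>Q u l) \<partial>lborel) =
      (\<integral>x. indicator {0..<A} (A - x) * fA x * (\<integral>N. F N \<partial>Q (A - x) l) \<partial>lborel)"
    by (subst lborel_integral_real_affine[where c="-1" and t=A]) auto
  also have "\<dots> = (\<integral>x. fA x * (\<integral>N. F N \<partial>Q (A - x) l) \<partial>lborel)"
  proof (rule integral_cong_AE)
    show "AE x in lborel. indicator {0..<A} (A - x) * fA x * (\<integral>N. F N \<partial>Q (A - x) l) = fA x * (\<integral>N. F N \<partial>Q (A - x) l)"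
      using AE_lborel_singleton[of 0] by eventually_elim (auto simp: fA_def split: split_indicator)
  qed measurable
  also have "\<mu> l * (\<integral>x. fA x * (\<integral>N. F N \<partial>Q (A - x) l) \<partial>lborel) = (\<integral>x. \<mu> l * (fA x * (\<integral>N. F N \<partial>Q (A - x) l)) \<partial>lborel)"
    by simp
  also have "\<dots> = (LINT x:{0..A}|lborel. f x * (\<mu> l * (\<integral>N. F N \<partial>Q (A - x) l)))"
    unfolding set_lebesgue_integral_def by (intro Bochner_Integration.integral_cong) (auto simp: fA_def)
  finally show "(\<integral>N. (\<Sum>u\<in>N l \<inter> {0..<A}. f (A - u)) * F N \<partial>P) =
      (LINT x:{0..A}|lborel. f x * (\<mu> l * (\<integral>N. F N \<partial>Q (A - x) l)))" .
qed

text \<open>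
  Duality: let \<open>G\<close> be the Palm expectation of \<open>|F|\<close> times \<open>\<mu>\<^sub>l\<close>, and let \<open>\<phi> = min G n\<close>. Then
  \<open>\<integral> \<phi>\<^sup>2 \<le> \<integral> \<phi> G = E[(\<integral> \<phi>(A - u) dN\<^sub>u) |F|]\<close>, and by \<open>window_sum_L2\<close> the square of the right-hand side is at most
  \<open>C (\<integral> \<phi>\<^sup>2) E[F\<^sup>2]\<close>. As \<open>\<integral> \<phi>\<^sup>2\<close> is finite, one factor cancels, and the bound is uniform in \<open>n\<close>.
\<close>

lemma palm_L2_bound:
  fixes F :: "config \<Rightarrow> real"
  assumes l: "l < K"
    and F[measurable]: "F \<in> borel_measurable (config_space K)" and fin: "(\<integral>\<^sup>+N. (ennreal \<bar>F N\<bar>)\<^sup>2 \<partial>P) < \<infinity>"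
  shows "window_weight (\<lambda>x. (ennreal (\<mu> l) * (\<integral>\<^sup>+N. ennreal \<bar>F N\<bar> \<partial>Q (A - x) l))\<^sup>2) < \<infinity>"
proof -
  obtain C where C: "C < \<infinity>" "\<And>l \<phi> t. l < K \<Longrightarrow> \<phi> \<in> borel_measurable borel \<Longrightarrow> window_weight (\<lambda>x. (\<phi> x)\<^sup>2) < \<infinity> \<Longrightarrow>
       (\<integral>\<^sup>+N. (window_sum A l \<phi> t N)\<^sup>2 \<partial>P) \<le> C * window_weight (\<lambda>x. (\<phi> x)\<^sup>2)"
    by (rule window_sum_L2) blast
  define I where "I u = (\<integral>\<^sup>+N. ennreal \<bar>F N\<bar> \<partial>Q u l)" for u
  have I[measurable]: "I \<in> borel_measurable borel"
    unfolding I_def[abs_def] by (rule palm_nn_integral_measurable[OF l]) measurable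
  define G where "G x = ennreal (\<mu> l) * I (A - x)" for x
  have [measurable]: "G \<in> borel_measurable borel" unfolding G_def[abs_def] by measurable
  let ?B = "C * (\<integral>\<^sup>+N. (ennreal \<bar>F N\<bar>)\<^sup>2 \<partial>P)"
  have B: "?B < \<infinity>" using C fin by (simp add: ennreal_mult_less_top)
  have trunc: "window_weight (\<lambda>x. (min (G x) (of_nat n))\<^sup>2) \<le> ?B" for n :: nat
  proof -
    define \<phi> where "\<phi> x = min (G x) (of_nat n)" for x
    have \<phi>[measurable]: "\<phi> \<in> borel_measurable borel" unfolding \<phi>_def[abs_def] by measurable
    let ?S = "window_weight (\<lambda>x. (\<phi> x)\<^sup>2)"
    have Sfin: "?S < \<infinity>"
    \<comment> \<open>Truncation makes this quantity finite, so that it can be cancelled below.\<close>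
    proof (rule window_bounded_finite)
      fix x
      have "(\<phi> x)\<^sup>2 \<le> (of_nat n)\<^sup>2" unfolding \<phi>_def by (intro power_mono) auto
      then show "(\<phi> x)\<^sup>2 \<le> ennreal ((real n)\<^sup>2)" by (simp add: ennreal_of_nat_eq_real_of_nat ennreal_power)
    qed
    have "?S \<le> window_weight (\<lambda>x. \<phi> x * G x)"
      unfolding power2_eq_square by (intro nn_integral_mono mult_right_mono mult_left_mono) (auto simp: \<phi>_def)
    also have "\<dots> = ennreal (\<mu> l) * (\<integral>\<^sup>+x. (\<phi> x * indicator {0<..A} x) * I (A - x) \<partial>lborel)"
      by (subst nn_integral_cmult[symmetric]) (auto simp: G_def mult_ac intro!: nn_integral_cong)
    also have "(\<integral>\<^sup>+x. (\<phi> x * indicator {0<..A} x) * I (A - x) \<partial>lborel) =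
        (\<integral>\<^sup>+u. (\<phi> (A - u) * indicator {A - A..<A} u) * I u \<partial>lborel)"
      using nn_integral_real_affine[of "\<lambda>x. (\<phi> x * indicator {0<..A} x) * I (A - x)" "-1" A]
      by (auto intro!: nn_integral_cong split: split_indicator)
    also have "\<dots> = (\<integral>\<^sup>+u. (\<integral>\<^sup>+N. (\<phi> (A - u) * indicator {A - A..<A} u) * ennreal \<bar>F N\<bar> \<partial>Q u l) \<partial>lborel)"
      unfolding I_def by (intro nn_integral_cong nn_integral_cmult[symmetric]) (auto simp: measurable_Q[OF l])
    also have "ennreal (\<mu> l) * \<dots> = (\<integral>\<^sup>+N. (\<integral>\<^sup>+u. (\<phi> (A - u) * indicator {A - A..<A} u) * ennreal \<bar>F N\<bar> \<partial>count_space (N l)) \<partial>P)"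
      by (rule campbell_nonneg[OF l, symmetric]) measurable
    also have "\<dots> = (\<integral>\<^sup>+N. window_sum A l \<phi> A N * ennreal \<bar>F N\<bar> \<partial>P)"
      by (simp add: nn_integral_multc window_sum_def)
    finally have le: "?S \<le> (\<integral>\<^sup>+N. window_sum A l \<phi> A N * ennreal \<bar>F N\<bar> \<partial>P)" .
    have "?S\<^sup>2 \<le> (\<integral>\<^sup>+N. window_sum A l \<phi> A N * ennreal \<bar>F N\<bar> \<partial>P)\<^sup>2"
      by (intro power_mono le) auto
    also have "\<dots> \<le> (\<integral>\<^sup>+N. (window_sum A l \<phi> A N)\<^sup>2 \<partial>P) * (\<integral>\<^sup>+N. (ennreal \<bar>F N\<bar>)\<^sup>2 \<partial>P)"
      using window_sum_measurable[OF l \<phi>, of A] measurable_P[OF F]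
      by (intro Cauchy_Schwarz_nn_integral) auto
    also have "\<dots> \<le> (C * ?S) * (\<integral>\<^sup>+N. (ennreal \<bar>F N\<bar>)\<^sup>2 \<partial>P)"
      by (intro mult_right_mono C(2) l \<phi> Sfin) auto
    finally have "?S * ?S \<le> ?S * ?B" by (simp add: power2_eq_square mult_ac)
    then have "?S \<le> ?B"
      using Sfin ennreal_mult_strict_left_mono[of ?B ?S ?S] by (cases "?S = 0") (auto simp: not_le[symmetric] zero_less_iff_neq_zero)
    then show ?thesis by (simp add: \<phi>_def)
  qed
  have "window_weight (\<lambda>x. (G x)\<^sup>2) = (\<integral>\<^sup>+x. (SUP n::nat. (min (G x) (of_nat n))\<^sup>2 * indicator {0<..A} x) \<partial>lborel)"
    by (simp add: SUP_min_of_nat_power2 SUP_mult_right_ennreal[symmetric])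
  also have "\<dots> = (SUP n::nat. window_weight (\<lambda>x. (min (G x) (of_nat n))\<^sup>2))"
    by (intro nn_integral_monotone_convergence_SUP)
       (auto simp: incseq_def le_fun_def intro!: mult_right_mono power_mono min.mono)
  also have "\<dots> \<le> ?B" by (intro SUP_least trunc)
  finally show ?thesis using B by (simp add: G_def I_def le_less_trans)
qed

lemma palm_L2_on:
  fixes F :: "config \<Rightarrow> real"
  assumes l: "l < K" and F: "F \<in> borel_measurable (config_space K)" "(\<integral>\<^sup>+N. (ennreal \<bar>F N\<bar>)\<^sup>2 \<partial>P) < \<infinity>"
  shows "(\<lambda>x. \<mu> l * (\<integral>N. F N \<partial>Q (A - x) l)) \<in> L2_on A"
proof -
  let ?G = "\<lambda>x. \<mu> l * (\<integral>N. F N \<partial>Q (A - x) l)"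
  have [measurable]: "(\<lambda>u. \<integral>N. F N \<partial>Q u l) \<in> borel_measurable borel"
    by (rule palm_integral_measurable[OF l F(1)])
  have [measurable]: "?G \<in> borel_measurable borel" by measurable
  have le: "ennreal ((?G x)\<^sup>2) \<le> (ennreal (\<mu> l) * (\<integral>\<^sup>+N. ennreal \<bar>F N\<bar> \<partial>Q (A - x) l))\<^sup>2" for x
  proof -
    have "ennreal \<bar>\<integral>N. F N \<partial>Q (A - x) l\<bar> \<le> (\<integral>\<^sup>+N. ennreal \<bar>F N\<bar> \<partial>Q (A - x) l)"
    proof (cases "integrable (Q (A - x) l) F")
      case True
      then show ?thesis using integral_norm_bound_ennreal[OF True] by simp
    qed (simp add: not_integrable_integral_eq)
    then have "(ennreal (\<mu> l) * ennreal \<bar>\<integral>N. F N \<partial>Q (A - x) l\<bar>)\<^sup>2 \<le> (ennreal (\<mu> l) * (\<integral>\<^sup>+N. ennreal \<bar>F N\<bar> \<partial>Q (A - x) l))\<^sup>2"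
      by (intro power_mono mult_left_mono) auto
    then show ?thesis using \<mu>_pos[OF l] by (simp add: ennreal_mult'[symmetric] ennreal_power power_mult_distrib)
  qed
  have "(\<integral>\<^sup>+x. ennreal (norm (indicator {0..A} x *\<^sub>R (?G x)\<^sup>2)) \<partial>lborel) =
      (\<integral>\<^sup>+x. ennreal ((?G x)\<^sup>2) * indicator {0<..A} x \<partial>lborel)"
  proof (rule nn_integral_cong_AE)
    show "AE x in lborel. ennreal (norm (indicator {0..A} x *\<^sub>R (?G x)\<^sup>2)) = ennreal ((?G x)\<^sup>2) * indicator {0<..A} x"
      using AE_lborel_singleton[of 0] by eventually_elim (auto split: split_indicator)
  qed
  also have "\<dots> \<le> window_weight (\<lambda>x. (ennreal (\<mu> l) * (\<integral>\<^sup>+N. ennreal \<bar>F N\<bar> \<partial>Q (A - x) l))\<^sup>2)"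
    by (intro nn_integral_mono mult_right_mono le) auto
  also have "\<dots> < \<infinity>" by (rule palm_L2_bound[OF l F])
  finally have "integrable lborel (\<lambda>x. indicator {0..A} x *\<^sub>R (?G x)\<^sup>2)"
    by (subst integrable_iff_bounded) auto
  then show ?thesis by (simp add: L2_on_def set_integrable_def set_borel_measurable_def)
qed

end

section \<open>The information operator\<close>

lemma lin_intensity_single:
  assumes "j < K"
  shows "lin_intensity K A 0 (\<lambda>i. if i = j then f else (\<lambda>x. 0)) A N = (\<Sum>u\<in>N j \<inter> {0..<A}. f (A - u))"
proof -
  have "lin_intensity K A 0 (\<lambda>i. if i = j then f else (\<lambda>x. 0)) A N =
      (\<Sum>l<K. if l = j then \<Sum>u\<in>N j \<inter> {0..<A}. f (A - u) else 0)"
    unfolding lin_intensity_def diff_self add_0_left by (intro sum.cong refl) auto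
  with assms show ?thesis by simp
qed

lemma lin_intensity_const: "lin_intensity K A c (\<lambda>i x. 0) t N = c"
  by (simp add: lin_intensity_def)

context hawkes_palm
begin

lemma lin_intensity_measurable_config:
  assumes "\<And>l. l < K \<Longrightarrow> g l \<in> L2_on A"
  shows "(\<lambda>N. lin_intensity K A c g t N) \<in> borel_measurable (config_space K)"
  using lin_intensity_measurable[OF assms] by (simp add: measurable_cong_sets[OF sets_P refl])

lemma ratio_measurable:
  assumes "k < K" "\<And>l. l < K \<Longrightarrow> g l \<in> L2_on A"
  shows "(\<lambda>N. lin_intensity K A c g A N / lam k A N) \<in> borel_measurable (config_space K)"
proof -
  have "(\<lambda>N. lam k A N) \<in> borel_measurable (config_space K)"
    using lam_measurable[OF assms(1)] by (simp add: measurable_cong_sets[OF sets_P refl])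
  then show ?thesis
    using lin_intensity_measurable_config[OF assms(2)] by (intro borel_measurable_divide) auto
qed

lemma ratio_L2:
  assumes k: "k < K" and g: "\<And>l. l < K \<Longrightarrow> g l \<in> L2_on A"
  shows "(\<integral>\<^sup>+N. (ennreal \<bar>lin_intensity K A c g A N / lam k A N\<bar>)\<^sup>2 \<partial>P) < \<infinity>"
proof -
  obtain D where D: "D < \<infinity>" "\<And>t. (\<integral>\<^sup>+N. (ennreal \<bar>lin_intensity K A c g t N\<bar>)\<^sup>2 \<partial>P) \<le> D\<^sup>2"
    by (rule lin_intensity_L2[OF g]) blast+
  have "(ennreal \<bar>lin_intensity K A c g A N / lam k A N\<bar>)\<^sup>2 \<le> (ennreal (1 / \<nu> k))\<^sup>2 * (ennreal \<bar>lin_intensity K A c g A N\<bar>)\<^sup>2" for N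
  proof -
    have "\<bar>lin_intensity K A c g A N / lam k A N\<bar> \<le> \<bar>lin_intensity K A c g A N\<bar> / \<nu> k"
      using lam_ge[OF k, of A N] lam_pos[OF k, of A N] \<nu>_pos[OF k] by (auto intro!: divide_left_mono)
    also have "\<dots> = 1 / \<nu> k * \<bar>lin_intensity K A c g A N\<bar>" by simp
    finally have "ennreal \<bar>lin_intensity K A c g A N / lam k A N\<bar> \<le> ennreal (1 / \<nu> k * \<bar>lin_intensity K A c g A N\<bar>)"
      by (rule ennreal_leI)
    also have "\<dots> = ennreal (1 / \<nu> k) * ennreal \<bar>lin_intensity K A c g A N\<bar>"
      using \<nu>_pos[OF k] by (intro ennreal_mult) auto
    finally show ?thesis by (simp only: power_mult_distrib[symmetric]) (intro power_mono; simp)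
  qed
  then have "(\<integral>\<^sup>+N. (ennreal \<bar>lin_intensity K A c g A N / lam k A N\<bar>)\<^sup>2 \<partial>P) \<le>
      (\<integral>\<^sup>+N. (ennreal (1 / \<nu> k))\<^sup>2 * (ennreal \<bar>lin_intensity K A c g A N\<bar>)\<^sup>2 \<partial>P)"
    by (intro nn_integral_mono)
  also have "\<dots> = (ennreal (1 / \<nu> k))\<^sup>2 * (\<integral>\<^sup>+N. (ennreal \<bar>lin_intensity K A c g A N\<bar>)\<^sup>2 \<partial>P)"
    using lin_intensity_measurable[OF g] by (intro nn_integral_cmult) auto
  also have "\<dots> \<le> (ennreal (1 / \<nu> k))\<^sup>2 * D\<^sup>2" by (intro mult_left_mono D) auto
  also have "\<dots> < \<infinity>" using D by (simp add: ennreal_mult_less_top power_less_top_ennreal)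
  finally show ?thesis .
qed

lemma ratio_palm_integrable:
  assumes l: "l < K" and k: "k < K" and g: "\<And>l. l < K \<Longrightarrow> g l \<in> L2_on A"
  shows "AE u in lborel. u \<in> {0..<A} \<longrightarrow> integrable (Q u l) (\<lambda>N. lin_intensity K A c g A N / lam k A N)"
proof -
  have "AE u in lborel. u \<in> {0..<A} \<and> (1 :: real) \<noteq> 0 \<longrightarrow> integrable (Q u l) (\<lambda>N. lin_intensity K A c g A N / lam k A N)"
    by (rule palm_duality(2)[where f="\<lambda>x. 1", OF l L2_on_const]) (intro ratio_measurable ratio_L2 k g; assumption)+
  then show ?thesis by eventually_elim simp
qed

text \<open>
  Under the Palm distribution at \<open>u\<close> the point \<open>u\<close> itself carries the mark \<open>l\<close>, and for almost every \<open>u\<close> there is no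
  point at \<open>A\<close>. Hence the sum over \<open>[0, A)\<close> in the linear functional and the sum over \<open>[0, A]\<close> without \<open>(u, l)\<close> in
  \<open>palm_zeta\<close> differ exactly by \<open>g\<^sub>l(A - u)\<close>, and only for \<open>j = l\<close>.
\<close>

lemma palm_score_formula:
  assumes l: "l < K" and k: "k < K" and g: "\<And>l. l < K \<Longrightarrow> g l \<in> L2_on A"
  shows "AE u in lborel. u \<in> {0..<A} \<longrightarrow>
    (\<integral>N. lin_intensity K A c g A N / lam k A N \<partial>Q u l) =
      c * palm_p K A \<nu> h Q l k (A - u) + g l (A - u) * palm_p K A \<nu> h Q l k (A - u)
      + (\<Sum>j<K. palm_zeta K A \<nu> h Q l j k (g j) (A - u))"
proof -
  define T where "T j N = (\<Sum>u\<in>N j \<inter> {0..<A}. g j (A - u))" for j N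
  define S where "S j u N = (\<Sum>s \<in> {s \<in> N j \<inter> {0..A}. (s, j) \<noteq> (u, l)}. g j (A - s) / lam k A N)" for j u N
  have g1: "(if i = j then g j else (\<lambda>x. 0)) \<in> L2_on A" if "j < K" for i j
    using g[OF that] L2_on_const[of 0 A] by simp
  have T_lin: "T j N = lin_intensity K A 0 (\<lambda>i. if i = j then g j else (\<lambda>x. 0)) A N" if "j < K" for j N
    unfolding T_def by (rule lin_intensity_single[OF that, symmetric])
  have T_int: "AE u in lborel. u \<in> {0..<A} \<longrightarrow> integrable (Q u l) (\<lambda>N. T j N / lam k A N)" if "j < K" for j
    unfolding T_lin[OF that] by (intro ratio_palm_integrable l k g1 that)
  have T_meas: "(\<lambda>N. T j N / lam k A N) \<in> borel_measurable (config_space K)" if "j < K" for j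
    unfolding T_lin[OF that] by (intro ratio_measurable k g1 that)
  have one_int: "AE u in lborel. u \<in> {0..<A} \<longrightarrow> integrable (Q u l) (\<lambda>N. 1 / lam k A N)"
    using ratio_palm_integrable[OF l k, of "\<lambda>i x. 0" 1] unfolding lin_intensity_const by (simp add: L2_on_const)
  have one_meas: "(\<lambda>N. 1 / lam k A N) \<in> borel_measurable (config_space K)"
    using ratio_measurable[OF k, of "\<lambda>i x. 0" 1] unfolding lin_intensity_const by (simp add: L2_on_const)
  have pt_meas: "(\<lambda>N. indicator (N j) a :: real) \<in> borel_measurable (config_space K)" if j: "j < K" for j a
  proof -
    have "(\<lambda>N. (a, N)) \<in> measurable (config_space K) (borel \<Otimes>\<^sub>M config_space K)" by measurable
    from measurable_sets[OF this points_jointly_measurable[OF j]]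
    have "{N \<in> space (config_space K). a \<in> N j} \<in> sets (config_space K)"
      by (rule back_subst[of "\<lambda>S. S \<in> sets (config_space K)"]) (auto simp: space_pair_measure)
    then have "(\<lambda>N. indicator {N \<in> space (config_space K). a \<in> N j} N :: real) \<in> borel_measurable (config_space K)"
      by simp
    then show ?thesis
      by (rule measurable_cong[THEN iffD1, rotated]) (auto split: split_indicator)
  qed
  have S_eq: "S j u N = (T j N + indicator (N j) A * g j 0 - (if j = l then indicator (N l) u * g l (A - u) else 0)) / lam k A N"
    if j: "j < K" and N: "N \<in> configs K" and u: "u \<in> {0..<A}" for j u N
  proof -
    have fin: "finite (N j \<inter> {0..A})" "finite (N j \<inter> {0..<A})" by (rule configs_finite[OF N j])+
    have "(\<Sum>s\<in>N j \<inter> {0..A}. g j (A - s)) = T j N + indicator (N j) A * g j 0"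
    proof (cases "A \<in> N j")
      case True
      then have "N j \<inter> {0..A} = insert A (N j \<inter> {0..<A})" using A_pos by auto
      then show ?thesis using True fin(2) by (simp add: T_def)
    next
      case False
      then have "N j \<inter> {0..A} = N j \<inter> {0..<A}" by (auto simp: less_le)
      then show ?thesis using False by (simp add: T_def)
    qed
    moreover have "(\<Sum>s \<in> {s \<in> N j \<inter> {0..A}. (s, j) \<noteq> (u, l)}. g j (A - s)) =
        (\<Sum>s\<in>N j \<inter> {0..A}. g j (A - s)) - (if j = l then indicator (N l) u * g l (A - u) else 0)"
    proof (cases "j = l \<and> u \<in> N l")
      case True
      then have "{s \<in> N j \<inter> {0..A}. (s, j) \<noteq> (u, l)} = N j \<inter> {0..A} - {u}" by auto
      moreover have "u \<in> N j \<inter> {0..A}" using True u by auto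
      ultimately show ?thesis using True fin(1) by (simp add: sum_diff1)
    next
      case False
      then have "{s \<in> N j \<inter> {0..A}. (s, j) \<noteq> (u, l)} = N j \<inter> {0..A}" by auto
      then show ?thesis using False by auto
    qed
    ultimately show ?thesis by (simp add: S_def sum_divide_distrib[symmetric])
  qed
  have S_meas: "(\<lambda>N. S j u N) \<in> borel_measurable (config_space K)" if j: "j < K" and u: "u \<in> {0..<A}" for j u
  proof -
    have "(\<lambda>N. if j = l then indicator (N l) u * g l (A - u) else 0) \<in> borel_measurable (config_space K)"
      by (cases "j = l") (simp_all add: borel_measurable_times pt_meas l)
    then have "(\<lambda>N. T j N / lam k A N + indicator (N j) A * g j 0 * (1 / lam k A N)
        - (if j = l then indicator (N l) u * g l (A - u) else 0) * (1 / lam k A N)) \<in> borel_measurable (config_space K)"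
      by (intro borel_measurable_add borel_measurable_diff borel_measurable_times borel_measurable_const T_meas j pt_meas one_meas)
    then show ?thesis
      by (rule measurable_cong[THEN iffD1, rotated]) (simp add: S_eq[OF j _ u] add_divide_distrib diff_divide_distrib)
  qed
  have "AE u in lborel. \<forall>j\<in>{..<K}. AE N in Q u l. A \<notin> N j"
    using palm_no_fixed_point[OF l] by (intro AE_finite_allI) auto
  moreover have "AE u in lborel. \<forall>j\<in>{..<K}. u \<in> {0..<A} \<longrightarrow> integrable (Q u l) (\<lambda>N. T j N / lam k A N)"
    using T_int by (intro AE_finite_allI) auto
  ultimately show ?thesis
    using palm_has_point[OF l] one_int
  proof eventually_elim
    case (elim u)
    show ?case
    proof
      assume u: "u \<in> {0..<A}"
      have one: "integrable (Q u l) (\<lambda>N. 1 / lam k A N)" using elim u by simp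
      have T: "integrable (Q u l) (\<lambda>N. T j N / lam k A N)" if "j < K" for j using elim u that by simp
      have p: "palm_p K A \<nu> h Q l k (A - u) = (\<integral>N. 1 / lam k A N \<partial>Q u l)" by (simp add: palm_p_def)
      have \<zeta>: "palm_zeta K A \<nu> h Q l j k (g j) (A - u) =
          (\<integral>N. T j N / lam k A N \<partial>Q u l) - (if j = l then g l (A - u) * palm_p K A \<nu> h Q l k (A - u) else 0)"
        if j: "j < K" for j
      proof -
        have "palm_zeta K A \<nu> h Q l j k (g j) (A - u) = (\<integral>N. S j u N \<partial>Q u l)"
          by (simp add: palm_zeta_def S_def)
        also have "\<dots> = (\<integral>N. T j N / lam k A N - (if j = l then g l (A - u) else 0) * (1 / lam k A N) \<partial>Q u l)"
        proof (rule integral_cong_AE)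
          show "(\<lambda>N. S j u N) \<in> borel_measurable (Q u l)"
            unfolding measurable_Q[OF l] by (rule S_meas[OF j u])
          show "(\<lambda>N. T j N / lam k A N - (if j = l then g l (A - u) else 0) * (1 / lam k A N)) \<in> borel_measurable (Q u l)"
            unfolding measurable_Q[OF l] by (intro borel_measurable_diff borel_measurable_times borel_measurable_const T_meas j one_meas)
          have "AE N in Q u l. A \<notin> N j" using elim(1) j by simp
          then show "AE N in Q u l. S j u N = T j N / lam k A N - (if j = l then g l (A - u) else 0) * (1 / lam k A N)"
            using elim(3) AE_space
          proof eventually_elim
            case (elim N)
            then have "N \<in> configs K" by (simp add: Q_space[OF l])
            from S_eq[OF j this u] elim show ?case by (simp add: diff_divide_distrib)
          qed
        qed
        also have "\<dots> = (\<integral>N. T j N / lam k A N \<partial>Q u l) - (if j = l then g l (A - u) else 0) * (\<integral>N. 1 / lam k A N \<partial>Q u l)"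
          by (simp only: Bochner_Integration.integral_diff[OF T[OF j] integrable_mult_right[OF one]] integral_mult_right_zero)
        finally show ?thesis by (auto simp: p)
      qed
      have "lin_intensity K A c g A N / lam k A N = c * (1 / lam k A N) + (\<Sum>j<K. T j N / lam k A N)" for N
        by (simp add: lin_intensity_def T_def add_divide_distrib sum_divide_distrib)
      then have "(\<integral>N. lin_intensity K A c g A N / lam k A N \<partial>Q u l) =
          (\<integral>N. c * (1 / lam k A N) + (\<Sum>j<K. T j N / lam k A N) \<partial>Q u l)" by simp
      also have "\<dots> = c * palm_p K A \<nu> h Q l k (A - u) + (\<Sum>j<K. \<integral>N. T j N / lam k A N \<partial>Q u l)"
      proof -
        have "integrable (Q u l) (\<lambda>N. \<Sum>j<K. T j N / lam k A N)" using T by (intro Bochner_Integration.integrable_sum) auto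
        moreover have "(\<integral>N. (\<Sum>j<K. T j N / lam k A N) \<partial>Q u l) = (\<Sum>j<K. \<integral>N. T j N / lam k A N \<partial>Q u l)"
          using T by (intro Bochner_Integration.integral_sum) auto
        ultimately show ?thesis
          by (simp only: p Bochner_Integration.integral_add[OF integrable_mult_right[OF one]] integral_mult_right_zero)
      qed
      also have "(\<Sum>j<K. \<integral>N. T j N / lam k A N \<partial>Q u l) =
          (\<Sum>j<K. palm_zeta K A \<nu> h Q l j k (g j) (A - u) + (if j = l then g l (A - u) * palm_p K A \<nu> h Q l k (A - u) else 0))"
        by (intro sum.cong refl) (simp only: \<zeta> lessThan_iff diff_add_cancel)
      also have "\<dots> = g l (A - u) * palm_p K A \<nu> h Q l k (A - u) + (\<Sum>j<K. palm_zeta K A \<nu> h Q l j k (g j) (A - u))"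
        using l by (simp add: sum.distrib)
      finally show "(\<integral>N. lin_intensity K A c g A N / lam k A N \<partial>Q u l) =
        c * palm_p K A \<nu> h Q l k (A - u) + g l (A - u) * palm_p K A \<nu> h Q l k (A - u)
        + (\<Sum>j<K. palm_zeta K A \<nu> h Q l j k (g j) (A - u))" by simp
    qed
  qed
qed

lemma score_gradient:
  assumes x: "x \<in> param_space K A" and y: "y \<in> param_space K A" and k: "k < K"
  defines "F \<equiv> \<lambda>N. lin_intensity K A (fst y k) (\<lambda>j. snd y j k) A N / lam k A N"
  shows "(\<integral>N. score K A \<nu> h x k N * score K A \<nu> h y k N \<partial>P) =
    fst x k * (\<integral>N. F N \<partial>P) + (\<Sum>l<K. LINT s:{0..A}|lborel. snd x l k s * (\<mu> l * (\<integral>N. F N \<partial>Q (A - s) l)))"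
proof -
  have gx: "\<And>l. l < K \<Longrightarrow> snd x l k \<in> L2_on A" and gy: "\<And>l. l < K \<Longrightarrow> snd y l k \<in> L2_on A"
    using x y k by (auto simp: param_space_def)
  define T where "T l N = (\<Sum>u\<in>N l \<inter> {0..<A}. snd x l k (A - u))" for l N
  have g1: "(if i = j then snd x j k else (\<lambda>x. 0)) \<in> L2_on A" if "j < K" for i j
    using gx[OF that] L2_on_const[of 0 A] by simp
  have T_int: "integrable P (\<lambda>N. T l N * F N)" if "l < K" for l
  proof -
    have "integrable P (\<lambda>N. lin_intensity K A 0 (\<lambda>i. if i = l then snd x l k else (\<lambda>x. 0)) A N *
        lin_intensity K A (fst y k) (\<lambda>j. snd y j k) A N / lam k A N)"
      by (intro lin_intensity_product_integrable k g1 that gy)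
    then show ?thesis by (simp add: T_def F_def lin_intensity_single[OF that])
  qed
  have F_int: "integrable P F"
  proof -
    have "integrable P (\<lambda>N. lin_intensity K A 1 (\<lambda>i x. 0) A N * lin_intensity K A (fst y k) (\<lambda>j. snd y j k) A N / lam k A N)"
      by (intro lin_intensity_product_integrable k L2_on_const gy)
    then show ?thesis unfolding lin_intensity_const F_def by simp
  qed
  have "(\<integral>N. score K A \<nu> h x k N * score K A \<nu> h y k N \<partial>P) =
      (\<integral>N. lin_intensity K A (fst x k) (\<lambda>l. snd x l k) A N * lin_intensity K A (fst y k) (\<lambda>l. snd y l k) A N / lam k A N \<partial>P)"
    by (rule expectation_score_product[OF x y k])
  also have "\<dots> = (\<integral>N. fst x k * F N + (\<Sum>l<K. T l N * F N) \<partial>P)"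
  proof (intro Bochner_Integration.integral_cong refl)
    fix N
    have "lin_intensity K A (fst x k) (\<lambda>l. snd x l k) A N = fst x k + (\<Sum>l<K. T l N)"
      by (simp add: lin_intensity_def T_def)
    then show "lin_intensity K A (fst x k) (\<lambda>l. snd x l k) A N * lin_intensity K A (fst y k) (\<lambda>l. snd y l k) A N / lam k A N =
        fst x k * F N + (\<Sum>l<K. T l N * F N)"
      by (simp add: F_def distrib_right add_divide_distrib sum_distrib_right sum_divide_distrib)
  qed
  also have "\<dots> = fst x k * (\<integral>N. F N \<partial>P) + (\<Sum>l<K. \<integral>N. T l N * F N \<partial>P)"
  proof -
    have "integrable P (\<lambda>N. \<Sum>l<K. T l N * F N)" using T_int by (intro Bochner_Integration.integrable_sum) auto
    moreover have "(\<integral>N. (\<Sum>l<K. T l N * F N) \<partial>P) = (\<Sum>l<K. \<integral>N. T l N * F N \<partial>P)"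
      using T_int by (intro Bochner_Integration.integral_sum) auto
    ultimately show ?thesis
      by (simp only: Bochner_Integration.integral_add[OF integrable_mult_right[OF F_int]] integral_mult_right_zero)
  qed
  also have "(\<Sum>l<K. \<integral>N. T l N * F N \<partial>P) = (\<Sum>l<K. LINT s:{0..A}|lborel. snd x l k s * (\<mu> l * (\<integral>N. F N \<partial>Q (A - s) l)))"
    unfolding T_def F_def
    by (intro sum.cong refl palm_duality(1) gx ratio_measurable ratio_L2 k gy) auto
  finally show ?thesis .
qed

text \<open>
  The candidate for \<open>\<Gamma> y\<close>, read off from \<open>score_gradient\<close>.
\<close>

definition gradient :: "param \<Rightarrow> param" where
  "gradient y = (\<lambda>k. \<integral>N. lin_intensity K A (fst y k) (\<lambda>j. snd y j k) A N / lam k A N \<partial>P,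
     \<lambda>l k s. \<mu> l * (\<integral>N. lin_intensity K A (fst y k) (\<lambda>j. snd y j k) A N / lam k A N \<partial>Q (A - s) l))"

lemma gradient_in_param_space:
  assumes y: "y \<in> param_space K A"
  shows "gradient y \<in> param_space K A"
proof -
  have "(\<lambda>s. \<mu> l * (\<integral>N. lin_intensity K A (fst y k) (\<lambda>j. snd y j k) A N / lam k A N \<partial>Q (A - s) l)) \<in> L2_on A"
    if "l < K" "k < K" for l k
    using y that by (intro palm_L2_on ratio_measurable ratio_L2) (auto simp: param_space_def)
  then show ?thesis by (simp add: gradient_def param_space_def)
qed

lemma gradient_adjoint:
  assumes x: "x \<in> param_space K A" and y: "y \<in> param_space K A"
  shows "param_inner K A x (gradient y) = (\<Sum>k<K. \<integral>N. score K A \<nu> h x k N * score K A \<nu> h y k N \<partial>P)"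
proof -
  have "(\<Sum>k<K. \<integral>N. score K A \<nu> h x k N * score K A \<nu> h y k N \<partial>P) =
      (\<Sum>k<K. fst x k * fst (gradient y) k + (\<Sum>l<K. LINT s:{0..A}|lborel. snd x l k s * snd (gradient y) l k s))"
    using x y by (intro sum.cong refl) (simp add: score_gradient gradient_def)
  also have "\<dots> = param_inner K A x (gradient y)"
    unfolding param_inner_def sum.distrib by (subst (2) sum.swap) simp
  finally show ?thesis ..
qed

lemma information_operator_eq_gradient:
  assumes y: "y \<in> param_space K A" and l: "l < K" and k: "k < K"
  shows "fst (information_operator K A \<nu> h P y) k = fst (gradient y) k"
    and "AE s in lborel. s \<in> {0..A} \<longrightarrow> snd (information_operator K A \<nu> h P y) l k s = snd (gradient y) l k s"
proof -
  let ?I = "information_operator K A \<nu> h P y"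
  let ?adj = "\<lambda>z. z \<in> param_space K A \<and> (\<forall>x \<in> param_space K A. param_inner K A x z =
      (\<Sum>k<K. \<integral>N. score K A \<nu> h x k N * score K A \<nu> h y k N \<partial>P))"
  have "?adj (gradient y)"
    by (intro conjI ballI gradient_in_param_space gradient_adjoint y)
  then have adj: "?adj ?I"
    unfolding information_operator_def score_adjoint_def by (rule someI[where P="?adj"])
  have I1: "?I \<in> param_space K A" using adj by (rule conjunct1)
  have I2: "param_inner K A x ?I = param_inner K A x (gradient y)" if "x \<in> param_space K A" for x
    unfolding gradient_adjoint[OF that y] by (rule bspec[OF conjunct2[OF adj] that])
  show "fst ?I k = fst (gradient y) k" "AE s in lborel. s \<in> {0..A} \<longrightarrow> snd ?I l k s = snd (gradient y) l k s"
    by (rule param_inner_determines[OF I1 gradient_in_param_space[OF y] I2 l k]; assumption)+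
qed

lemma gradient_fst:
  assumes g: "\<And>j. j < K \<Longrightarrow> g j k \<in> L2_on A" and k: "k < K"
  shows "fst (gradient (\<xi>, g)) k = \<xi> k * (\<integral>N. 1 / lam k A N \<partial>P)
    + (\<integral>N. lin_intensity K A 0 (\<lambda>j. g j k) A N / lam k A N \<partial>P)"
proof -
  have 1: "integrable P (\<lambda>N. 1 / lam k A N)"
  proof -
    have "integrable P (\<lambda>N. lin_intensity K A 1 (\<lambda>i x. 0) A N * lin_intensity K A 1 (\<lambda>i x. 0) A N / lam k A N)"
      by (intro lin_intensity_product_integrable k L2_on_const)
    then show ?thesis unfolding lin_intensity_const by simp
  qed
  have 2: "integrable P (\<lambda>N. lin_intensity K A 0 (\<lambda>j. g j k) A N / lam k A N)"
  proof -
    have "integrable P (\<lambda>N. lin_intensity K A 1 (\<lambda>i x. 0) A N * lin_intensity K A 0 (\<lambda>j. g j k) A N / lam k A N)"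
      by (intro lin_intensity_product_integrable k L2_on_const g)
    then show ?thesis unfolding lin_intensity_const by simp
  qed
  have "fst (gradient (\<xi>, g)) k = (\<integral>N. \<xi> k * (1 / lam k A N) + lin_intensity K A 0 (\<lambda>j. g j k) A N / lam k A N \<partial>P)"
    by (simp add: gradient_def lin_intensity_def add_divide_distrib)
  also have "\<dots> = \<xi> k * (\<integral>N. 1 / lam k A N \<partial>P) + (\<integral>N. lin_intensity K A 0 (\<lambda>j. g j k) A N / lam k A N \<partial>P)"
    by (simp only: Bochner_Integration.integral_add[OF integrable_mult_right[OF 1] 2] integral_mult_right_zero)
  finally show ?thesis .
qed

lemma gradient_snd:
  assumes g: "\<And>j. j < K \<Longrightarrow> g j k \<in> L2_on A" and l: "l < K" and k: "k < K"
  shows "AE x in lborel. x \<in> {0..A} \<longrightarrow> snd (gradient (\<xi>, g)) l k x =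
      \<mu> l * \<xi> k * palm_p K A \<nu> h Q l k x + \<mu> l * g l k x * palm_p K A \<nu> h Q l k x
      + \<mu> l * (\<Sum>j<K. palm_zeta K A \<nu> h Q l j k (g j k) x)"
proof -
  let ?F = "\<lambda>N. lin_intensity K A (\<xi> k) (\<lambda>j. g j k) A N / lam k A N"
  have "AE u in lborel. u \<in> {0..<A} \<longrightarrow> (\<integral>N. ?F N \<partial>Q u l) =
      \<xi> k * palm_p K A \<nu> h Q l k (A - u) + g l k (A - u) * palm_p K A \<nu> h Q l k (A - u)
      + (\<Sum>j<K. palm_zeta K A \<nu> h Q l j k (g j k) (A - u))"
    by (intro palm_score_formula l k g)
  from AE_lborel_reflect[OF this, of A] AE_lborel_singleton[of 0] show ?thesis
    by eventually_elim (auto simp: gradient_def algebra_simps)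
qed

end

theorem lemma2p4:
  fixes K :: nat and A :: real
    and \<nu> :: "nat \<Rightarrow> real" and h :: "nat \<Rightarrow> nat \<Rightarrow> real \<Rightarrow> real"
    and P :: "config measure" and Q :: "real \<Rightarrow> nat \<Rightarrow> config measure"
    and \<xi> \<xi>' :: "nat \<Rightarrow> real" and g g' :: "nat \<Rightarrow> nat \<Rightarrow> real \<Rightarrow> real"
  assumes "K \<ge> 1" and "A > 0"
    and "hawkes_parameter K A \<nu> h"
    and "stationary_hawkes K A \<nu> h P"
    and "palm_family K P Q"
    and "(\<xi>, g) \<in> param_space K A"
    and "(\<xi>', g') = information_operator K A \<nu> h P (\<xi>, g)"
  shows "\<forall>l<K. \<forall>k<K.
     \<xi>' k = \<xi> k * (\<integral>N. 1 / intensity K A \<nu> h k A N \<partial>P)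
            + (\<integral>N. lin_intensity K A 0 (\<lambda>j. g j k) A N / intensity K A \<nu> h k A N \<partial>P)
     \<and> (AE x in lborel. x \<in> {0..A} \<longrightarrow>
          g' l k x = mean_intensity P l * \<xi> k * palm_p K A \<nu> h Q l k x
            + mean_intensity P l * g l k x * palm_p K A \<nu> h Q l k x
            + mean_intensity P l * (\<Sum>j<K. palm_zeta K A \<nu> h Q l j k (g j k) x))"
proof (intro allI impI conjI)
  fix l k assume l: "l < K" and k: "k < K"
  interpret hawkes_palm K A \<nu> h P Q
    using assms(2-5) by unfold_locales
  have g: "g j k \<in> L2_on A" if "j < K" for j
    using assms(6) that k by (simp add: param_space_def)
  have eq: "\<xi>' = fst (information_operator K A \<nu> h P (\<xi>, g))" "g' = snd (information_operator K A \<nu> h P (\<xi>, g))"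
    by (simp_all only: assms(7)[symmetric] fst_conv snd_conv)
  show "\<xi>' k = \<xi> k * (\<integral>N. 1 / intensity K A \<nu> h k A N \<partial>P)
      + (\<integral>N. lin_intensity K A 0 (\<lambda>j. g j k) A N / intensity K A \<nu> h k A N \<partial>P)"
    unfolding eq information_operator_eq_gradient(1)[OF assms(6) l k] by (intro gradient_fst g k)
  show "AE x in lborel. x \<in> {0..A} \<longrightarrow>
      g' l k x = mean_intensity P l * \<xi> k * palm_p K A \<nu> h Q l k x
        + mean_intensity P l * g l k x * palm_p K A \<nu> h Q l k x
        + mean_intensity P l * (\<Sum>j<K. palm_zeta K A \<nu> h Q l j k (g j k) x)"
  proof -
    have "AE x in lborel. x \<in> {0..A} \<longrightarrow> snd (gradient (\<xi>, g)) l k x =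
        \<mu> l * \<xi> k * palm_p K A \<nu> h Q l k x + \<mu> l * g l k x * palm_p K A \<nu> h Q l k x
        + \<mu> l * (\<Sum>j<K. palm_zeta K A \<nu> h Q l j k (g j k) x)"
      by (intro gradient_snd l k g)
    with information_operator_eq_gradient(2)[OF assms(6) l k] show ?thesis
      unfolding eq by eventually_elim simp
  qed
qed

end
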